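(* Suppose choices follow the Luce choice model with true parameter $\theta^\star\in\Theta_b$ and all (fixed) comparison sets have cardinality $k\ge2$. For each $t$, let $z_t$ be drawn uniformly at random from $S_t\setminus\{y_t\}$, independently across $t$, and let $\widehat\theta_1\in\arg\max_{\theta\in\Theta_b}\ell_1(\theta)$. If $\lambda_2(L_M)\ge 8k(k-1)e^{2b}\,n\log(n)/m$, then with probability at least $1-3/n$, $$\mathrm{MSE}(\widehat\theta_1,\theta^\star)\le D^2\frac{n(\log n+2)}{\lambda_2(L_M)^2}\frac1m,\qquad D=4k(k-1)e^{2b}.$$
   Context: Items $N=\{1,\dots,n\}$; observations $(S_t,y_t)$, $t=1,\dots,m$. Luce choice model: choices conditionally independent with $\Pr[y_t=i\mid S_t]=e^{\theta^\star_i}/\sum_{v\in S_t}e^{\theta^\star_v}$. Pseudo log-likelihood $\ell_1(\theta)=\sum_{t=1}^m\log\frac{e^{\theta_{y_t}}}{e^{\theta_{y_t}}+e^{\theta_{z_t}}}$. $\Theta_b=\{\theta\in[-b,b]^n:\sum\theta_i=0\}$; $\mathrm{MSE}=\frac1n\|\widehat\theta-\theta^\star\|_2^2$. $M$ has zero diagonal and off-diagonal entries $\frac nm\#\{t:\{i,j\}\subseteq S_t\}$; $L_A=\mathrm{diag}(A\mathbf 1)-A$; $\lambda_2$ is the second smallest eigenvalue. *)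

theory Defs
  imports "HOL-Probability.Probability" "Jordan_Normal_Form.Char_Poly"
begin

text \<open>Items are 1..n; observations are indexed by t in {..<m}.
  An outcome omega t = (y_t, z_t): chosen item and uniformly drawn alternative.\<close>

definition luce_pmf :: "(nat \<Rightarrow> real) \<Rightarrow> nat set \<Rightarrow> nat pmf" where
  "luce_pmf \<theta> S = embed_pmf (\<lambda>i. if i \<in> S then exp (\<theta> i) / (\<Sum>v\<in>S. exp (\<theta> v)) else 0)"

definition obs_pmf :: "(nat \<Rightarrow> real) \<Rightarrow> nat set \<Rightarrow> (nat \<times> nat) pmf" where
  "obs_pmf \<theta> S = do { y \<leftarrow> luce_pmf \<theta> S; z \<leftarrow> pmf_of_set (S - {y}); return_pmf (y, z) }"

definition sample_pmf :: "nat \<Rightarrow> (nat \<Rightarrow> nat set) \<Rightarrow> (nat \<Rightarrow> real) \<Rightarrow> (nat \<Rightarrow> nat \<times> nat) pmf" where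
  "sample_pmf m S \<theta> = Pi_pmf {..<m} (0, 0) (\<lambda>t. obs_pmf \<theta> (S t))"

definition Theta :: "nat \<Rightarrow> real \<Rightarrow> (nat \<Rightarrow> real) set" where
  "Theta n b = {\<theta>. (\<forall>i\<in>{1..n}. \<bar>\<theta> i\<bar> \<le> b) \<and> (\<Sum>i=1..n. \<theta> i) = 0}"

definition loglik1 :: "nat \<Rightarrow> (nat \<Rightarrow> nat \<times> nat) \<Rightarrow> (nat \<Rightarrow> real) \<Rightarrow> real" where
  "loglik1 m \<omega> \<theta> = (\<Sum>t<m. ln (exp (\<theta> (fst (\<omega> t))) /
       (exp (\<theta> (fst (\<omega> t))) + exp (\<theta> (snd (\<omega> t))))))"

definition MSE :: "nat \<Rightarrow> (nat \<Rightarrow> real) \<Rightarrow> (nat \<Rightarrow> real) \<Rightarrow> real" where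
  "MSE n \<theta>h \<theta>s = (1 / real n) * (\<Sum>i=1..n. (\<theta>h i - \<theta>s i)^2)"

text \<open>M as an n x n matrix; row/column index i corresponds to item i+1.\<close>
definition Mmat :: "nat \<Rightarrow> nat \<Rightarrow> (nat \<Rightarrow> nat set) \<Rightarrow> real mat" where
  "Mmat n m S = mat n n (\<lambda>(i, j). if i = j then 0
      else real n / real m * real (card {t\<in>{..<m}. {i+1, j+1} \<subseteq> S t}))"

definition laplacian :: "real mat \<Rightarrow> real mat" where
  "laplacian A = mat (dim_row A) (dim_col A) (\<lambda>(i, j).
      (if i = j then (\<Sum>l<dim_col A. A $$ (i, l)) else 0) - A $$ (i, j))"

text \<open>Second smallest eigenvalue (with multiplicity): for real symmetric matrices
  the characteristic polynomial splits over the reals.\<close>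
definition lambda2 :: "real mat \<Rightarrow> real" where
  "lambda2 A = sorted_list_of_multiset (proots (char_poly A)) ! 1"

end

theory Submission
  imports Defs
begin

text \<open>
  Write \<open>x\<^sub>t = \<theta> (y\<^sub>t) - \<theta> (z\<^sub>t)\<close>, let \<open>H\<close> be the Hessian of the negative pseudo log-likelihood at the true
  parameter and \<open>g\<close> its score there. First-order optimality of the maximizer against the true
  parameter gives \<open>\<Sum>t. (sig x\<^sub>t - sig x\<^sup>*\<^sub>t) \<delta>\<^sub>t \<le> g \<bullet> \<Delta>\<close>, and a secant of the logistic function \<open>sig\<close> on
  \<open>[-2b, 2b]\<close> has at least \<open>\<psi> = (1 - exp (-2b)) / 2b\<close> times the slope at its base point. Hence
  \<open>\<psi> \<Delta>\<^sup>T H \<Delta> \<le> g \<bullet> \<Delta>\<close>. It is essential to compare in the geometry of \<open>H\<close>: bounding the Euclidean norm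
  of \<open>g\<close> and the curvature uniformly on the box would put \<open>exp (4b)\<close> into the constant \<open>D\<close>.

  \<^item> Given the unordered pairs \<open>{y\<^sub>t, z\<^sub>t}\<close>, the orientations are independent Bradley--Terry choices, so
    \<open>H\<close> is the conditional covariance of \<open>g\<close>. Bernstein's inequality in an eigenbasis of \<open>H\<close> and a union bound
    give \<open>(g \<bullet> \<Delta>)\<^sup>2 \<le> n K \<Delta>\<^sup>T H \<Delta>\<close> for all \<open>\<Delta>\<close>, with \<open>K\<close> of order \<open>ln n\<close>.
  \<^item> On vectors of sum zero \<open>E H\<close> is at least \<open>A/2\<close>, where \<open>A = exp (-2b) m \<lambda>\<^sub>2 / (n k (k - 1))\<close>. A matrix
    Chernoff bound keeps \<open>H\<close> above \<open>5/8\<close> of this. It follows from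
    \<open>E tr exp (- \<Sum> X\<^sub>t) \<le> tr exp (- c \<Sum> E X\<^sub>t)\<close>, proved by exchanging the independent rank-one summands one at
    a time with Klein's inequality.

  Together these give an error of at most \<open>16 exp (2b) (ln n + 1) / A\<close>, which is below the claimed bound because
  \<open>\<lambda>\<^sub>2\<close> is at most the trace divided by \<open>n - 1\<close>. The concentration bounds need
  \<open>A > 4 (ln n + 1) exp (2b) / b\<^sup>2\<close>; otherwise the bound exceeds the squared diameter \<open>4 b\<^sup>2\<close> of the box.
\<close>

section \<open>Spectral theorem for real symmetric matrices\<close>

text \<open>Vectors are functions on \<open>nat\<close> read on a finite index set \<open>I\<close>,
  so that one theory serves both the items \<open>{1..n}\<close> and the matrix indices
  \<open>{..<n}\<close>.\<close>

definition ip :: "nat set \<Rightarrow> (nat \<Rightarrow> real) \<Rightarrow> (nat \<Rightarrow> real) \<Rightarrow> real" where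
  "ip I x y = (\<Sum>l\<in>I. x l * y l)"

definition mv :: "nat set \<Rightarrow> (nat \<Rightarrow> nat \<Rightarrow> real) \<Rightarrow> (nat \<Rightarrow> real) \<Rightarrow> nat \<Rightarrow> real" where
  "mv I A x l = (\<Sum>j\<in>I. A l j * x j)"

text \<open>The second conjunct is the completeness relation: the eigenvectors resolve the identity
  on \<open>I\<close>. Parseval's identity rests on it.\<close>

definition eigensystem ::
  "nat set \<Rightarrow> (nat \<Rightarrow> nat \<Rightarrow> real) \<Rightarrow> (nat \<Rightarrow> real) \<Rightarrow> (nat \<Rightarrow> nat \<Rightarrow> real) \<Rightarrow> bool" where
  "eigensystem I A a u \<longleftrightarrow>
     (\<forall>i\<in>I. \<forall>j\<in>I. ip I (u i) (u j) = of_bool (i = j)) \<and>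
     (\<forall>l\<in>I. \<forall>l'\<in>I. (\<Sum>i\<in>I. u i l * u i l') = of_bool (l = l')) \<and>
     (\<forall>i\<in>I. \<forall>l\<in>I. mv I A (u i) l = a i * u i l)"

definition symmetric_on :: "nat set \<Rightarrow> (nat \<Rightarrow> nat \<Rightarrow> real) \<Rightarrow> bool" where
  "symmetric_on I A \<longleftrightarrow> (\<forall>i\<in>I. \<forall>j\<in>I. A i j = A j i)"

lemma ip_commute: "ip I x y = ip I y x"
  by (simp add: ip_def mult.commute)

lemma ip_add_right: "ip I x (\<lambda>l. y l + z l) = ip I x y + ip I x z"
  by (simp add: ip_def algebra_simps sum.distrib)

lemma ip_diff_right: "ip I x (\<lambda>l. y l - z l) = ip I x y - ip I x z"
  by (simp add: ip_def algebra_simps sum_subtractf)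

lemma ip_scale_right: "ip I x (\<lambda>l. c * y l) = c * ip I x y"
  by (simp add: ip_def algebra_simps sum_distrib_left)

lemma ip_diff_left: "ip I (\<lambda>l. y l - z l) x = ip I y x - ip I z x"
  by (simp add: ip_def algebra_simps sum_subtractf)

lemma ip_scale_left: "ip I (\<lambda>l. c * y l) x = c * ip I y x"
  by (simp add: ip_def algebra_simps sum_distrib_left)

lemma ip_cong: "(\<And>l. l \<in> I \<Longrightarrow> x l = x' l) \<Longrightarrow> (\<And>l. l \<in> I \<Longrightarrow> y l = y' l) \<Longrightarrow> ip I x y = ip I x' y'"
  unfolding ip_def by (rule sum.cong) auto

lemma ip_self_nonneg: "ip I x x \<ge> 0"
  unfolding ip_def by (rule sum_nonneg) simp

lemma ip_self_eq_0: "finite I \<Longrightarrow> ip I x x = 0 \<longleftrightarrow> (\<forall>l\<in>I. x l = 0)"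
  unfolding ip_def by (subst sum_nonneg_eq_0_iff) auto

lemma mv_cong: "(\<And>l. l \<in> I \<Longrightarrow> x l = x' l) \<Longrightarrow> mv I A x l = mv I A x' l"
  unfolding mv_def by (rule sum.cong) auto

lemma mv_diff: "mv I A (\<lambda>l. x l - y l) l = mv I A x l - mv I A y l"
  by (simp add: mv_def algebra_simps sum_subtractf)

lemma mv_scale: "mv I A (\<lambda>l. c * x l) l = c * mv I A x l"
  by (simp add: mv_def algebra_simps sum_distrib_left)

lemma ip_mv_symmetric:
  assumes "symmetric_on I A"
  shows "ip I x (mv I A y) = ip I (mv I A x) y"
proof -
  have "ip I x (mv I A y) = (\<Sum>l\<in>I. \<Sum>j\<in>I. x l * A l j * y j)"
    by (simp add: ip_def mv_def sum_distrib_left algebra_simps)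
  also have "\<dots> = (\<Sum>j\<in>I. \<Sum>l\<in>I. x l * A l j * y j)"
    by (rule sum.swap)
  also have "\<dots> = (\<Sum>j\<in>I. \<Sum>l\<in>I. A j l * x l * y j)"
    using assms by (intro sum.cong refl) (simp add: symmetric_on_def)
  also have "\<dots> = ip I (mv I A x) y"
    by (simp add: ip_def mv_def sum_distrib_right)
  finally show ?thesis .
qed

text \<open>A root of the characteristic polynomial yields a complex eigenvector
  \<open>x + i y\<close>. Symmetry equates \<open>ip y (A x)\<close> with \<open>ip x (A y)\<close>,
  which forces \<open>Im k = 0\<close>; then \<open>x\<close> and \<open>y\<close> both satisfy the
  real eigenvalue equation, and one of them is nonzero.\<close>

lemma symmetric_eigenvector_exists:
  assumes "n > 0" and sym: "symmetric_on {..<n} A"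
  obtains e v where "ip {..<n} v v \<noteq> 0" "\<And>l. l < n \<Longrightarrow> mv {..<n} A v l = e * v l"
proof -
  define B where "B = mat n n (\<lambda>(i, j). complex_of_real (A i j))"
  have B: "B \<in> carrier_mat n n" by (simp add: B_def)
  have "degree (char_poly B) = n" using degree_monic_char_poly[OF B] by simp
  hence "\<not> constant (poly (char_poly B))" using \<open>n > 0\<close> by (simp add: constant_degree)
  then obtain k where "poly (char_poly B) k = 0" using fundamental_theorem_of_algebra by blast
  hence "eigenvalue B k" using eigenvalue_root_char_poly[OF B] by simp
  then obtain w where w: "w \<in> carrier_vec n" "w \<noteq> 0\<^sub>v n" "B *\<^sub>v w = k \<cdot>\<^sub>v w"
    using B by (auto simp: eigenvalue_def eigenvector_def)
  define x where "x l = Re (vec_index w l)" for l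
  define y where "y l = Im (vec_index w l)" for l
  have eq: "(\<Sum>j<n. complex_of_real (A l j) * vec_index w j) = k * vec_index w l" if "l < n" for l
  proof -
    have "vec_index (B *\<^sub>v w) l = (\<Sum>j<n. complex_of_real (A l j) * vec_index w j)"
      using w(1) that by (simp add: B_def scalar_prod_def atLeast0LessThan)
    thus ?thesis using w(1,3) that by simp
  qed
  have ax: "mv {..<n} A x l = Re k * x l - Im k * y l" if "l < n" for l
    using arg_cong[OF eq[OF that], of Re] by (simp add: mv_def x_def y_def)
  have ay: "mv {..<n} A y l = Im k * x l + Re k * y l" if "l < n" for l
    using arg_cong[OF eq[OF that], of Im] by (simp add: mv_def x_def y_def)
  have "ip {..<n} y (mv {..<n} A x) = ip {..<n} y (\<lambda>l. Re k * x l - Im k * y l)"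
    by (rule ip_cong) (auto simp: ax)
  moreover have "ip {..<n} x (mv {..<n} A y) = ip {..<n} x (\<lambda>l. Im k * x l + Re k * y l)"
    by (rule ip_cong) (auto simp: ay)
  moreover have "ip {..<n} x (mv {..<n} A y) = ip {..<n} y (mv {..<n} A x)"
    using ip_mv_symmetric[OF sym, of x y] ip_commute by metis
  ultimately have "Im k * (ip {..<n} x x + ip {..<n} y y) = 0"
    using ip_commute[of "{..<n}" x y]
    by (simp add: ip_add_right ip_diff_right ip_scale_right algebra_simps)
  moreover have nz: "ip {..<n} x x \<noteq> 0 \<or> ip {..<n} y y \<noteq> 0"
  proof (rule ccontr)
    assume "\<not> ?thesis"
    hence "\<forall>l<n. x l = 0 \<and> y l = 0" by (auto simp: ip_self_eq_0)
    hence "w = 0\<^sub>v n" using w(1) by (intro eq_vecI) (auto simp: x_def y_def complex_eq_iff)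
    with w(2) show False by simp
  qed
  moreover have "ip {..<n} x x \<ge> 0" "ip {..<n} y y \<ge> 0" by (rule ip_self_nonneg)+
  ultimately have "Im k = 0" by (metis add_nonneg_eq_0_iff mult_eq_0_iff)
  thus ?thesis using that nz ax ay by auto
qed

text \<open>Induction on the dimension: conjugating with the Householder reflection that takes the first
  coordinate vector to a unit eigenvector splits off that eigenvector.\<close>

lemma orthonormal_eigenvectors_exist:
  assumes "symmetric_on {..<n} A"
  shows "\<exists>a u. (\<forall>i<n. \<forall>j<n. ip {..<n} (u i) (u j) = of_bool (i = j)) \<and>
           (\<forall>i<n. \<forall>l<n. mv {..<n} A (u i) l = a i * u i l)"
  using assms
proof (induction n arbitrary: A)
  case 0
  show ?case by simp
next
  case (Suc n)
  let ?I = "{..<Suc n}"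
  obtain e v0 where v0: "ip ?I v0 v0 \<noteq> 0" "\<And>l. l < Suc n \<Longrightarrow> mv ?I A v0 l = e * v0 l"
    using symmetric_eigenvector_exists[OF _ Suc.prems] by (metis zero_less_Suc)
  define v where "v l = (1 / sqrt (ip ?I v0 v0)) * v0 l" for l
  have v1: "ip ?I v v = 1"
  proof -
    have "ip ?I v v = ip ?I v0 v0 / (sqrt (ip ?I v0 v0) * sqrt (ip ?I v0 v0))"
      unfolding v_def[abs_def] ip_scale_right ip_scale_left by simp
    thus ?thesis using v0(1) ip_self_nonneg[of ?I v0] by simp
  qed
  have ve: "mv ?I A v l = e * v l" if "l < Suc n" for l
    using v0(2)[OF that] by (simp add: v_def[abs_def] mv_scale del: times_divide_eq_left)
  define z :: "nat \<Rightarrow> real" where "z l = of_bool (l = 0)" for l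
  have z0: "z 0 = 1" by (simp add: z_def)
  have ipz: "ip ?I x z = x 0" "ip ?I z x = x 0" for x
    by (simp_all add: ip_def z_def sum.If_cases lessThan_Suc_eq_insert_0 sum.reindex)
  define w where "w l = v l - z l" for l
  \<comment> \<open>\<open>Q\<close> is the reflection along \<open>w = v - z\<close>, which
    exchanges the unit vectors \<open>z\<close> and \<open>v\<close>. If \<open>v\<close> and
    \<open>z\<close> agree on the index set, then \<open>ip ?I w w = 0\<close> and division by zero
    turns \<open>Q\<close> into the identity, as it should be.\<close>
  define Q where "Q x l = x l - 2 * ip ?I w x / ip ?I w w * w l" for x l
  have Q_ip: "ip ?I (Q x) (Q y) = ip ?I x y" for x y
  proof (cases "ip ?I w w = 0")
    case True
    thus ?thesis by (simp add: Q_def[abs_def])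
  next
    case False
    thus ?thesis
      using ip_commute[of ?I w x]
      by (simp add: Q_def[abs_def] ip_diff_left ip_diff_right ip_scale_left ip_scale_right
          del: times_divide_eq_left) (simp add: field_simps)
  qed
  have QQ: "Q (Q x) = x" for x
  proof (rule ext)
    fix l
    have "ip ?I w (Q x) = ip ?I w x - 2 * ip ?I w x / ip ?I w w * ip ?I w w"
      unfolding Q_def[abs_def] ip_diff_right ip_scale_right by simp
    thus "Q (Q x) l = x l"
      by (cases "ip ?I w w = 0") (simp_all add: Q_def[of "Q x"] Q_def[of x])
  qed
  have Q_adj: "ip ?I (Q x) y = ip ?I x (Q y)" for x y
    using Q_ip[of x "Q y"] QQ by simp
  have Q_cong: "Q x l = Q y l" if "\<And>l. l < Suc n \<Longrightarrow> x l = y l" "l < Suc n" for x y l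
    using that ip_cong[of ?I w w x y] by (simp add: Q_def)
  have Q_scale: "Q (\<lambda>l. c * x l) l = c * Q x l" for c x l
    by (simp add: Q_def ip_scale_right algebra_simps)
  have Qz: "Q z l = v l" if "l < Suc n" for l
  proof (cases "ip ?I w w = 0")
    case True
    hence "w l = 0" using that by (simp add: ip_self_eq_0)
    thus ?thesis using True by (simp add: Q_def w_def)
  next
    case False
    have "ip ?I w w = 2 - 2 * v 0" "ip ?I w z = v 0 - 1"
      using v1 by (simp_all add: w_def[abs_def] ip_diff_left ip_diff_right ipz z0)
    with False show ?thesis by (simp add: Q_def) (simp add: w_def field_simps)
  qed
  define BB where "BB x = Q (mv ?I A (Q x))" for x
  have BB_adj: "ip ?I x (BB y) = ip ?I (Q x) (mv ?I A (Q y))" for x y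
    by (simp add: BB_def Q_adj)
  have BB_sym: "ip ?I x (BB y) = ip ?I y (BB x)" for x y
    unfolding BB_adj using ip_mv_symmetric[OF Suc.prems, of "Q x" "Q y"] by (simp add: ip_commute)
  \<comment> \<open>The first output coordinate of the conjugated operator depends on the first
    input coordinate only. With symmetry this makes the operator block diagonal.\<close>
  have BB0: "BB x 0 = e * x 0" for x
  proof -
    have "BB x 0 = ip ?I z (BB x)" by (simp add: ipz)
    also have "\<dots> = ip ?I x (BB z)" by (rule BB_sym)
    also have "\<dots> = ip ?I (Q x) (\<lambda>l. e * Q z l)"
      unfolding BB_adj
    proof (rule ip_cong)
      fix l assume "l \<in> ?I"
      have "mv ?I A (Q z) l = mv ?I A v l" by (rule mv_cong) (simp add: Qz)
      thus "mv ?I A (Q z) l = e * Q z l" using \<open>l \<in> ?I\<close> by (simp add: ve Qz)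
    qed simp
    finally show ?thesis by (simp add: ip_scale_right Q_ip ipz)
  qed
  define lift where "lift x l = (case l of 0 \<Rightarrow> 0 | Suc k \<Rightarrow> x k)" for x :: "nat \<Rightarrow> real" and l
  define d :: "nat \<Rightarrow> nat \<Rightarrow> real" where "d j l = of_bool (l = Suc j)" for j l
  have ipd: "ip ?I (d i) x = x (Suc i)" if "i < n" for i x
    using that by (simp add: ip_def d_def)
  have lift_d: "lift x l = (\<Sum>j<n. x j * d j l)" if "l < Suc n" for x l
    using that by (cases l) (auto simp: lift_def d_def)
  have Q_sum: "Q (\<lambda>l. \<Sum>j\<in>J. c j * X j l) l = (\<Sum>j\<in>J. c j * Q (X j) l)" for J :: "nat set" and c X l
  proof -
    have "ip ?I w (\<lambda>l. \<Sum>j\<in>J. c j * X j l) = (\<Sum>j\<in>J. c j * ip ?I w (X j))"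
      unfolding ip_def sum_distrib_left by (subst sum.swap) (simp add: algebra_simps)
    moreover have "(\<Sum>j\<in>J. c j * Q (X j) l) =
        (\<Sum>j\<in>J. c j * X j l) - (\<Sum>j\<in>J. c j * ip ?I w (X j)) * (2 / ip ?I w w * w l)"
      unfolding sum_distrib_right sum_subtractf[symmetric]
      by (rule sum.cong) (simp_all add: Q_def algebra_simps)
    ultimately show ?thesis by (simp add: Q_def)
  qed
  have mv_sum: "mv ?I A (\<lambda>l. \<Sum>j\<in>J. c j * X j l) l = (\<Sum>j\<in>J. c j * mv ?I A (X j) l)"
    for J :: "nat set" and c X l
    unfolding mv_def sum_distrib_left by (subst sum.swap) (simp add: algebra_simps)
  have BB_lift: "BB (lift x) l = (\<Sum>j<n. x j * BB (d j) l)" if "l < Suc n" for x l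
  proof -
    have "mv ?I A (Q (lift x)) k = mv ?I A (\<lambda>l. \<Sum>j<n. x j * Q (d j) l) k" for k
      by (rule mv_cong) (subst Q_sum[symmetric], rule Q_cong, auto simp: lift_d)
    hence "BB (lift x) = Q (\<lambda>k. \<Sum>j<n. x j * mv ?I A (Q (d j)) k)"
      unfolding BB_def mv_sum by (intro arg_cong[where f = Q] ext)
    thus ?thesis by (simp add: Q_sum BB_def)
  qed
  \<comment> \<open>\<open>B\<close> is the block on the coordinates \<open>1..n\<close>, reindexed
    from 0; \<open>lift\<close> embeds its eigenvectors with first coordinate 0.\<close>
  define B where "B i j = BB (d j) (Suc i)" for i j
  have "symmetric_on {..<n} B"
    unfolding symmetric_on_def B_def
  proof (intro ballI)
    fix i j assume "i \<in> {..<n}" "j \<in> {..<n}"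
    thus "BB (d j) (Suc i) = BB (d i) (Suc j)"
      using ipd[of i "BB (d j)"] ipd[of j "BB (d i)"] BB_sym[of "d i" "d j"] by simp
  qed
  from Suc.IH[OF this] obtain a u where
    "\<forall>i<n. \<forall>j<n. ip {..<n} (u i) (u j) = of_bool (i = j)"
    "\<forall>i<n. \<forall>l<n. mv {..<n} B (u i) l = a i * u i l"
    by (elim exE conjE)
  hence u1: "\<And>i j. i < n \<Longrightarrow> j < n \<Longrightarrow> ip {..<n} (u i) (u j) = of_bool (i = j)"
    and u2: "\<And>i l. i < n \<Longrightarrow> l < n \<Longrightarrow> mv {..<n} B (u i) l = a i * u i l"
    by simp_all
  have BBu: "BB (lift (u i)) l = a i * lift (u i) l" if "i < n" "l < Suc n" for i l
  proof (cases l)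
    case 0
    thus ?thesis by (simp add: BB0 lift_def)
  next
    case (Suc k)
    hence "BB (lift (u i)) l = mv {..<n} B (u i) k"
      using that by (subst BB_lift) (auto simp: mv_def B_def mult.commute)
    thus ?thesis using Suc that u2 by (simp add: lift_def)
  qed
  define a' where "a' i = (case i of 0 \<Rightarrow> e | Suc k \<Rightarrow> a k)" for i
  define u' where "u' i = (case i of 0 \<Rightarrow> Q z | Suc k \<Rightarrow> Q (lift (u k)))" for i
  have lift_ip: "ip ?I (lift x) (lift y) = ip {..<n} x y" for x y
    by (simp add: ip_def lift_def lessThan_Suc_eq_insert_0 sum.reindex)
  have orth: "ip ?I (u' i) (u' j) = of_bool (i = j)" if "i < Suc n" "j < Suc n" for i j
    using that by (auto simp: u'_def Q_ip ipz lift_ip u1 split: nat.splits) (simp_all add: z_def lift_def)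
  have "mv ?I A (u' i) l = a' i * u' i l" if "i < Suc n" "l < Suc n" for i l
  proof (cases i)
    case 0
    have "mv ?I A (Q z) l = mv ?I A v l" by (rule mv_cong) (simp add: Qz)
    thus ?thesis using 0 that by (simp add: u'_def a'_def ve Qz)
  next
    case (Suc k)
    have "mv ?I A (Q (lift (u k))) l = Q (BB (lift (u k))) l"
      by (simp add: BB_def QQ)
    also have "\<dots> = Q (\<lambda>l. a k * lift (u k) l) l"
      using that Suc BBu by (intro Q_cong) auto
    finally show ?thesis using Suc by (simp add: u'_def a'_def Q_scale)
  qed
  with orth show ?case by blast
qed

text \<open>The matrix of eigenvectors is square with orthonormal rows, so its right inverse is a
  left inverse, which is the completeness relation. The diagonalization then factors the
  characteristic polynomial and ties the eigensystem to \<open>lambda2\<close>.\<close>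

lemma eigensystem_exists_lessThan:
  assumes "symmetric_on {..<n} A"
  obtains a u where "eigensystem {..<n} A a u"
    "char_poly (mat n n (\<lambda>(i, j). A i j)) = (\<Prod>i<n. [:- a i, 1:])"
proof -
  obtain a u where u1: "\<And>i j. i < n \<Longrightarrow> j < n \<Longrightarrow> ip {..<n} (u i) (u j) = of_bool (i = j)"
    and u2: "\<And>i l. i < n \<Longrightarrow> l < n \<Longrightarrow> mv {..<n} A (u i) l = a i * u i l"
    using orthonormal_eigenvectors_exist[OF assms] by blast
  define U where "U = mat n n (\<lambda>(i, l). u i l)"
  define V where "V = mat n n (\<lambda>(l, i). u i l)"
  define D where "D = mat n n (\<lambda>(i, j). if i = j then a i else 0)"
  define M where "M = mat n n (\<lambda>(i, j). A i j)"
  have carr: "U \<in> carrier_mat n n" "V \<in> carrier_mat n n" "D \<in> carrier_mat n n" "M \<in> carrier_mat n n"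
    by (simp_all add: U_def V_def D_def M_def)
  have UV: "U * V = 1\<^sub>m n"
    by (rule eq_matI) (auto simp: U_def V_def scalar_prod_def u1[unfolded ip_def] atLeast0LessThan)
  have VU: "V * U = 1\<^sub>m n"
    by (rule mat_mult_left_right_inverse[OF carr(1,2) UV])
  have compl: "(\<Sum>i<n. u i l * u i l') = of_bool (l = l')" if "l < n" "l' < n" for l l'
  proof -
    have "(V * U) $$ (l, l') = (\<Sum>i<n. u i l * u i l')"
      using that by (simp add: U_def V_def scalar_prod_def atLeast0LessThan)
    thus ?thesis using that by (simp add: VU one_mat_def of_bool_def)
  qed
  have MV: "M * V = V * D"
  proof (rule eq_matI)
    fix l i assume "l < dim_row (V * D)" "i < dim_col (V * D)"
    hence li: "l < n" "i < n" by (simp_all add: V_def D_def)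
    have "(M * V) $$ (l, i) = mv {..<n} A (u i) l"
      using li by (simp add: M_def V_def scalar_prod_def mv_def atLeast0LessThan)
    also have "\<dots> = (\<Sum>j<n. u j l * (if j = i then a j else 0))"
      using li u2 by (simp add: if_distrib cong: if_cong)
    also have "\<dots> = (V * D) $$ (l, i)"
      using li by (simp add: V_def D_def scalar_prod_def atLeast0LessThan)
    finally show "(M * V) $$ (l, i) = (V * D) $$ (l, i)" .
  qed (simp_all add: M_def V_def D_def)
  have "M = M * (V * U)" using carr by (simp add: VU)
  also have "\<dots> = V * D * U" using carr MV by (simp flip: assoc_mult_mat)
  finally have "similar_mat_wit M D V U"
    using carr UV VU by (intro similar_mat_witI) auto
  hence "char_poly M = char_poly D"
    by (intro char_poly_similar) (auto simp: similar_mat_def)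
  also have "\<dots> = (\<Prod>c\<leftarrow>diag_mat D. [:- c, 1:])"
    by (rule char_poly_upper_triangular[OF carr(3)]) (auto simp: D_def)
  also have "diag_mat D = map a [0..<n]"
    unfolding diag_mat_def by (auto simp: D_def intro!: map_cong)
  also have "(\<Prod>c\<leftarrow>map a [0..<n]. [:- c, 1:]) = (\<Prod>i<n. [:- a i, 1:])"
    by (simp add: prod.list_conv_set_nth o_def atLeast0LessThan)
  finally show ?thesis
    using that[of a u] u1 u2 compl by (simp add: eigensystem_def M_def)
qed

lemma eigensystem_exists:
  assumes "finite I" "symmetric_on I A"
  obtains a u where "eigensystem I A a u"
proof -
  obtain h where h: "bij_betw h {..<card I} I"
    using ex_bij_betw_nat_finite[OF assms(1)] by (auto simp: atLeast0LessThan)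
  define g where "g = inv_into {..<card I} h"
  have g: "bij_betw g I {..<card I}"
    unfolding g_def by (rule bij_betw_inv_into[OF h])
  have hI: "h i \<in> I" if "i < card I" for i using h that by (auto simp: bij_betw_def)
  have gI: "g i < card I" "h (g i) = i" if "i \<in> I" for i
    using g h that by (auto simp: bij_betw_def g_def f_inv_into_f)
  have gh: "g i = g j \<longleftrightarrow> i = j" if "i \<in> I" "j \<in> I" for i j
    using g that by (auto simp: bij_betw_def inj_on_def)
  have sum: "(\<Sum>l<card I. f l) = (\<Sum>l\<in>I. f (g l))" for f :: "nat \<Rightarrow> real"
    using sum.reindex_bij_betw[OF g, of f] by simp
  have "symmetric_on {..<card I} (\<lambda>i j. A (h i) (h j))"
    using assms(2) hI by (auto simp: symmetric_on_def)
  then obtain a u where *: "eigensystem {..<card I} (\<lambda>i j. A (h i) (h j)) a u"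
    using eigensystem_exists_lessThan by blast
  have "(\<Sum>j\<in>I. A l j * u (g i) (g j)) = a (g i) * u (g i) (g l)" if "i \<in> I" "l \<in> I" for i l
  proof -
    have "(\<Sum>j\<in>I. A l j * u (g i) (g j)) = (\<Sum>j\<in>I. A (h (g l)) (h (g j)) * u (g i) (g j))"
      using that gI(2) by (intro sum.cong refl) simp
    also have "\<dots> = a (g i) * u (g i) (g l)"
      using * gI(1)[OF that(1)] gI(1)[OF that(2)] unfolding eigensystem_def mv_def sum by blast
    finally show ?thesis .
  qed
  hence "eigensystem I A (\<lambda>i. a (g i)) (\<lambda>i l. u (g i) (g l))"
    using * unfolding eigensystem_def ip_def mv_def sum by (simp add: gI(1) gh)
  thus ?thesis by (rule that)
qed

section \<open>Trace exponentials\<close>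

lemma eigensystemD:
  assumes "eigensystem I A a u"
  shows "\<And>i j. i \<in> I \<Longrightarrow> j \<in> I \<Longrightarrow> ip I (u i) (u j) = of_bool (i = j)"
    and "\<And>l l'. l \<in> I \<Longrightarrow> l' \<in> I \<Longrightarrow> (\<Sum>i\<in>I. u i l * u i l') = of_bool (l = l')"
    and "\<And>i l. i \<in> I \<Longrightarrow> l \<in> I \<Longrightarrow> mv I A (u i) l = a i * u i l"
  using assms by (auto simp: eigensystem_def)

lemma eigensystem_parseval:
  assumes "finite I" "eigensystem I A a u"
  shows "(\<Sum>i\<in>I. ip I (u i) x * ip I (u i) y) = ip I x y"
proof -
  have "(\<Sum>i\<in>I. ip I (u i) x * ip I (u i) y) =
      (\<Sum>i\<in>I. \<Sum>l\<in>I. \<Sum>l'\<in>I. (u i l * u i l') * (x l * y l'))"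
    by (simp add: ip_def sum_product algebra_simps)
  also have "\<dots> = (\<Sum>l\<in>I. \<Sum>l'\<in>I. \<Sum>i\<in>I. (u i l * u i l') * (x l * y l'))"
    by (rule trans[OF sum.swap], rule sum.cong[OF refl], rule sum.swap)
  also have "\<dots> = (\<Sum>l\<in>I. \<Sum>l'\<in>I. of_bool (l = l') * (x l * y l'))"
    using eigensystemD(2)[OF assms(2)] by (intro sum.cong refl) (simp flip: sum_distrib_right)
  also have "\<dots> = ip I x y"
    using assms(1) by (simp add: ip_def of_bool_def if_distrib[of "\<lambda>c. c * _"] cong: if_cong)
  finally show ?thesis .
qed

lemma eigensystem_ip_mv:
  assumes "symmetric_on I A" "eigensystem I A a u" "i \<in> I"
  shows "ip I (u i) (mv I A x) = a i * ip I (u i) x"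
proof -
  have "ip I (u i) (mv I A x) = ip I (mv I A (u i)) x"
    by (rule ip_mv_symmetric[OF assms(1)])
  also have "\<dots> = ip I (\<lambda>l. a i * u i l) x"
    using eigensystemD(3)[OF assms(2)] assms(3) by (intro ip_cong) auto
  finally show ?thesis by (simp add: ip_scale_left)
qed

lemma eigensystem_quadratic_form:
  assumes "finite I" "symmetric_on I A" "eigensystem I A a u"
  shows "ip I x (mv I A x) = (\<Sum>i\<in>I. a i * (ip I (u i) x)\<^sup>2)"
  using eigensystem_parseval[OF assms(1,3), of x "mv I A x"] eigensystem_ip_mv[OF assms(2,3)]
  by (simp add: power2_eq_square algebra_simps)

lemma eigensystem_eigenvalue:
  assumes "eigensystem I A a u" "i \<in> I"
  shows "ip I (u i) (mv I A (u i)) = a i"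
proof -
  have "ip I (u i) (mv I A (u i)) = ip I (u i) (\<lambda>l. a i * u i l)"
    using eigensystemD(3)[OF assms(1)] assms(2) by (intro ip_cong) auto
  thus ?thesis using eigensystemD(1)[OF assms(1)] assms(2) by (simp add: ip_scale_right)
qed

text \<open>The trace of the matrix exponential of \<open>- A\<close>, read off one chosen
  eigensystem. Trace inequalities proved for arbitrary eigensystems apply to the chosen one.\<close>

definition exp_trace :: "nat set \<Rightarrow> (nat \<Rightarrow> nat \<Rightarrow> real) \<Rightarrow> real" where
  "exp_trace I A = (let (a, u) = SOME (a, u). eigensystem I A a u in \<Sum>i\<in>I. exp (- a i))"

lemma exp_trace_eigensystem:
  assumes "finite I" "symmetric_on I A"
  obtains a u where "eigensystem I A a u" "exp_trace I A = (\<Sum>i\<in>I. exp (- a i))"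
proof -
  obtain a0 u0 where "eigensystem I A a0 u0" by (rule eigensystem_exists[OF assms])
  hence *: "case (SOME (a, u). eigensystem I A a u) of (a, u) \<Rightarrow> eigensystem I A a u"
    by (intro someI[where P = "\<lambda>(a, u). eigensystem I A a u" and x = "(a0, u0)"]) simp
  obtain a u where au: "(SOME (a, u). eigensystem I A a u) = (a, u)" by fastforce
  from * have "eigensystem I A a u" unfolding au by simp
  moreover have "exp_trace I A = (\<Sum>i\<in>I. exp (- a i))"
    unfolding exp_trace_def au by simp
  ultimately show ?thesis by (rule that)
qed

text \<open>For two eigensystems, the weights \<open>(u\<^sub>i \<bullet> v\<^sub>j)\<^sup>2\<close> form a doubly stochastic matrix, which turns
  scalar inequalities between eigenvalues into trace inequalities.\<close>

context
  fixes I :: "nat set" and A B :: "nat \<Rightarrow> nat \<Rightarrow> real" and a b :: "nat \<Rightarrow> real"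
    and u v :: "nat \<Rightarrow> nat \<Rightarrow> real"
  assumes fin: "finite I" and symA: "symmetric_on I A" and symB: "symmetric_on I B"
    and A: "eigensystem I A a u" and B: "eigensystem I B b v"
begin

lemma overlap_sum_right: "i \<in> I \<Longrightarrow> (\<Sum>j\<in>I. (ip I (u i) (v j))\<^sup>2) = 1"
  using eigensystem_parseval[OF fin B, of "u i" "u i"] eigensystemD(1)[OF A]
  by (simp add: power2_eq_square ip_commute)

lemma overlap_sum_left: "j \<in> I \<Longrightarrow> (\<Sum>i\<in>I. (ip I (u i) (v j))\<^sup>2) = 1"
  using eigensystem_parseval[OF fin A, of "v j" "v j"] eigensystemD(1)[OF B]
  by (simp add: power2_eq_square ip_commute)

lemma sum_overlap_left:
  "(\<Sum>i\<in>I. f i) = (\<Sum>i\<in>I. \<Sum>j\<in>I. (ip I (u i) (v j))\<^sup>2 * f i)"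
  using overlap_sum_right by (simp flip: sum_distrib_right)

lemma sum_overlap_right:
  "(\<Sum>j\<in>I. f j) = (\<Sum>i\<in>I. \<Sum>j\<in>I. (ip I (u i) (v j))\<^sup>2 * f j)"
  by (subst sum.swap) (use overlap_sum_left in \<open>simp flip: sum_distrib_right\<close>)

text \<open>\<open>A\<close> acts on \<open>u i\<close> from the left and \<open>B\<close> on
  \<open>v j\<close> from the right. If \<open>B - A\<close> has rank one, the right-hand side
  factorizes, which determines the overlaps.\<close>

lemma overlap_gap:
  assumes "i \<in> I" "j \<in> I"
  shows "(b j - a i) * ip I (u i) (v j) =
    ip I (u i) (mv I B (v j)) - ip I (u i) (mv I A (v j))"
proof -
  have "ip I (u i) (mv I B (v j)) = ip I (u i) (\<lambda>l. b j * v j l)"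
    using eigensystemD(3)[OF B] assms by (intro ip_cong) auto
  thus ?thesis
    using eigensystem_ip_mv[OF symA A assms(1), of "v j"] by (simp add: ip_scale_right algebra_simps)
qed

lemma overlap_gap_sum:
  assumes "i \<in> I"
  shows "(\<Sum>j\<in>I. (ip I (u i) (v j))\<^sup>2 * (b j - a i)) =
    ip I (u i) (mv I B (u i)) - ip I (u i) (mv I A (u i))"
proof -
  have "(\<Sum>j\<in>I. (ip I (u i) (v j))\<^sup>2 * (b j - a i)) =
      (\<Sum>j\<in>I. b j * (ip I (v j) (u i))\<^sup>2) - a i * (\<Sum>j\<in>I. (ip I (u i) (v j))\<^sup>2)"
    by (simp add: algebra_simps sum_subtractf sum_distrib_left ip_commute[of I "u i"])
  thus ?thesis
    using overlap_sum_right[OF assms] eigensystem_quadratic_form[OF fin symB B, of "u i"]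
      eigensystem_eigenvalue[OF A assms] by simp
qed

text \<open>The convex function tr exp(-X) lies above its tangent at \<open>A\<close>. The scalar
  tangent inequality for each pair of eigenvalues, weighted by the squared overlaps, gives this for
  noncommuting matrices.\<close>

lemma klein_inequality:
  "(\<Sum>j\<in>I. exp (- b j)) \<ge> (\<Sum>i\<in>I. exp (- a i)) -
     (\<Sum>i\<in>I. exp (- a i) * (ip I (u i) (mv I B (u i)) - ip I (u i) (mv I A (u i))))"
proof -
  have "(\<Sum>i\<in>I. exp (- a i)) -
     (\<Sum>i\<in>I. exp (- a i) * (ip I (u i) (mv I B (u i)) - ip I (u i) (mv I A (u i)))) =
     (\<Sum>i\<in>I. \<Sum>j\<in>I. (ip I (u i) (v j))\<^sup>2 * (exp (- a i) * (1 - (b j - a i))))"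
    unfolding sum_overlap_left[of "\<lambda>i. exp (- a i)"]
    by (simp add: algebra_simps sum_subtractf sum.distrib sum_distrib_left flip: overlap_gap_sum)
  also have "\<dots> \<le> (\<Sum>i\<in>I. \<Sum>j\<in>I. (ip I (u i) (v j))\<^sup>2 * exp (- b j))"
  proof (intro sum_mono mult_left_mono)
    fix i j
    have "exp (- a i) * (1 - (b j - a i)) \<le> exp (- a i) * exp (- (b j - a i))"
      using exp_ge_add_one_self[of "- (b j - a i)"] by (intro mult_left_mono) (auto simp del: exp_ge_add_one_self)
    thus "exp (- a i) * (1 - (b j - a i)) \<le> exp (- b j)" by (simp flip: exp_add)
  qed simp
  finally show ?thesis by (simp flip: sum_overlap_right)
qed

end

text \<open>This is \<open>1 - x \<le> exp (- x)\<close> multiplied by \<open>exp x\<close>. The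
  expression occurs as a factor of the derivatives in \<open>exp_taylor_bound\<close> and
  \<open>exp_pade_mono\<close>.\<close>

lemma exp_mult_pred_ge: "exp x * (x - 1) + 1 \<ge> 0" for x :: real
proof -
  have "exp x * (1 - x) \<le> exp x * exp (- x)"
    using exp_ge_add_one_self[of "- x"] by (intro mult_left_mono) auto
  thus ?thesis by (simp add: exp_minus field_simps)
qed

text \<open>With these coefficients both sides agree to third order at 0, and the weight \<open>exp (- y)\<close> on a part of
  the quadratic term makes the bound hold for negative \<open>y\<close> as well.\<close>

lemma exp_taylor_bound: "1 - exp (- y) \<ge> y - (2 + exp (- y)) * y\<^sup>2 / 6" for y :: real
proof -
  \<comment> \<open>\<open>f\<close> is \<open>exp y\<close> times the difference of the two sides;
    after this multiplication the derivative factorizes and has the sign of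
    \<open>y\<close>.\<close>
  define f where "f y = exp y * (1 - y + y\<^sup>2 / 3) - 1 + y\<^sup>2 / 6" for y :: real
  have der: "(f has_real_derivative (y / 3) * (exp y * (y - 1) + 1)) (at y)" for y
    unfolding f_def by (auto intro!: derivative_eq_intros simp: power2_eq_square field_simps)
  have "f y \<ge> 0"
  proof (cases "y \<ge> 0")
    case True
    have "f 0 \<le> f y"
      by (rule DERIV_nonneg_imp_nondecreasing[OF True]) (use der exp_mult_pred_ge in force)
    thus ?thesis by (simp add: f_def)
  next
    case False
    hence "y \<le> 0" by simp
    have "f 0 \<le> f y"
    proof (rule DERIV_nonpos_imp_nonincreasing[OF \<open>y \<le> 0\<close>])
      fix x assume "x \<le> (0::real)"
      hence "(x / 3) * (exp x * (x - 1) + 1) \<le> 0" using exp_mult_pred_ge[of x] by (intro mult_nonpos_nonneg) auto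
      thus "\<exists>z. (f has_real_derivative z) (at x) \<and> z \<le> 0" using der by blast
    qed
    thus ?thesis by (simp add: f_def)
  qed
  hence "exp (- y) * f y \<ge> 0" by simp
  thus ?thesis by (simp add: f_def algebra_simps exp_minus field_simps)
qed

section \<open>Rank-one updates of the trace exponential\<close>

lemma mv_add_matrix: "mv I (\<lambda>l j. C l j + D l j) x l = mv I C x l + mv I D x l"
  by (simp add: mv_def algebra_simps sum.distrib)

lemma mv_scale_matrix: "mv I (\<lambda>l j. c * D l j) y l = c * mv I D y l"
  by (simp add: mv_def sum_distrib_left mult.assoc)

lemma ip_mv_rank_one: "ip I y (mv I (\<lambda>l j. x l * x j) z) = ip I x y * ip I x z"
  unfolding ip_def mv_def sum_product by (simp only: sum_distrib_left) (simp only: mult_ac)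

lemma ip_mv_rank_one_sum:
  "ip I y (mv I (\<lambda>l j. \<Sum>t\<in>J. c t * (x t l * x t j)) z) = (\<Sum>t\<in>J. c t * (ip I (x t) y * ip I (x t) z))"
proof -
  have "ip I y (mv I (\<lambda>l j. \<Sum>t\<in>J. c t * (x t l * x t j)) z) =
      (\<Sum>l\<in>I. \<Sum>j\<in>I. \<Sum>t\<in>J. c t * ((x t l * y l) * (x t j * z j)))"
    by (simp add: ip_def mv_def sum_distrib_left sum_distrib_right mult_ac)
  also have "\<dots> = (\<Sum>l\<in>I. \<Sum>t\<in>J. \<Sum>j\<in>I. c t * ((x t l * y l) * (x t j * z j)))"
    by (rule sum.cong[OF refl], rule sum.swap)
  also have "\<dots> = (\<Sum>t\<in>J. \<Sum>l\<in>I. \<Sum>j\<in>I. c t * ((x t l * y l) * (x t j * z j)))"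
    by (rule sum.swap)
  also have "\<dots> = (\<Sum>t\<in>J. c t * (ip I (x t) y * ip I (x t) z))"
    unfolding ip_def sum_product by (simp only: sum_distrib_left)
  finally show ?thesis .
qed

text \<open>For a rank-one difference the overlap times the eigenvalue gap is
  \<open>ip I x (u i) * ip I x (v j)\<close>. Hence the sums produced by
  \<open>exp_taylor_bound\<close> factorize: the linear term is \<alpha>, and the quadratic ones are
  \<open>ip I x x\<close> times \<alpha> and \<beta>. Since \<beta> \<le> \<alpha>, the total
  quadratic loss is at most \<open>ip I x x * \<alpha> / 2\<close>.\<close>

lemma exp_trace_rank_one_update:
  assumes fin: "finite I" and symC: "symmetric_on I C"
    and C: "eigensystem I C a u" and norm: "ip I x x \<le> s"
  shows "exp_trace I (\<lambda>l j. C l j + x l * x j) \<le>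
    (\<Sum>i\<in>I. exp (- a i)) - (1 - s / 2) * (\<Sum>i\<in>I. exp (- a i) * (ip I x (u i))\<^sup>2)"
proof -
  define B where "B l j = C l j + x l * x j" for l j
  have symB: "symmetric_on I B" using symC by (auto simp: symmetric_on_def B_def)
  obtain b v where B: "eigensystem I B b v" and T: "exp_trace I B = (\<Sum>i\<in>I. exp (- b i))"
    by (rule exp_trace_eigensystem[OF fin symB])
  have BC: "ip I y (mv I B z) - ip I y (mv I C z) = ip I x y * ip I x z" for y z
  proof -
    have "ip I y (mv I B z) = ip I y (\<lambda>l. mv I C z l + mv I (\<lambda>l j. x l * x j) z l)"
      by (rule ip_cong) (simp_all add: B_def[abs_def] mv_add_matrix)
    thus ?thesis by (simp add: ip_add_right ip_mv_rank_one)
  qed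
  define w where "w i j = (ip I (u i) (v j))\<^sup>2" for i j
  define \<alpha> where "\<alpha> = (\<Sum>i\<in>I. exp (- a i) * (ip I x (u i))\<^sup>2)"
  define \<beta> where "\<beta> = (\<Sum>j\<in>I. exp (- b j) * (ip I x (v j))\<^sup>2)"
  define TA where "TA = (\<Sum>i\<in>I. exp (- a i))"
  define TB where "TB = (\<Sum>i\<in>I. exp (- b i))"
  have gap: "(b j - a i) * ip I (u i) (v j) = ip I x (u i) * ip I x (v j)" if "i \<in> I" "j \<in> I" for i j
    using overlap_gap[OF fin symC symB C B that] BC by simp
  have w2: "w i j * (b j - a i)\<^sup>2 = (ip I x (u i))\<^sup>2 * (ip I x (v j))\<^sup>2" if "i \<in> I" "j \<in> I" for i j
    using arg_cong[OF gap[OF that], of "\<lambda>z. z\<^sup>2"] by (simp add: w_def power_mult_distrib mult.commute)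
  have pars: "(\<Sum>j\<in>I. (ip I x (v j))\<^sup>2) = ip I x x" "(\<Sum>j\<in>I. (ip I x (u j))\<^sup>2) = ip I x x"
    using eigensystem_parseval[OF fin B, of x x] eigensystem_parseval[OF fin C, of x x]
    by (simp_all add: power2_eq_square ip_commute)
  have lin: "(\<Sum>i\<in>I. \<Sum>j\<in>I. w i j * (exp (- a i) * (b j - a i))) = \<alpha>"
  proof -
    have "(\<Sum>j\<in>I. w i j * (exp (- a i) * (b j - a i))) = exp (- a i) * (ip I x (u i))\<^sup>2" if "i \<in> I" for i
    proof -
      have "(\<Sum>j\<in>I. w i j * (exp (- a i) * (b j - a i))) = exp (- a i) * (\<Sum>j\<in>I. w i j * (b j - a i))"
        unfolding sum_distrib_left by (simp only: mult_ac)
      thus ?thesis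
        using overlap_gap_sum[OF fin symC symB C B that] BC[of "u i" "u i"]
        by (simp add: w_def power2_eq_square)
    qed
    thus ?thesis unfolding \<alpha>_def by (rule sum.cong[OF refl])
  qed
  have quadA: "(\<Sum>i\<in>I. \<Sum>j\<in>I. w i j * (exp (- a i) * (b j - a i)\<^sup>2)) = ip I x x * \<alpha>"
  proof -
    have "(\<Sum>i\<in>I. \<Sum>j\<in>I. w i j * (exp (- a i) * (b j - a i)\<^sup>2)) =
        (\<Sum>i\<in>I. \<Sum>j\<in>I. exp (- a i) * ((ip I x (u i))\<^sup>2 * (ip I x (v j))\<^sup>2))"
      by (intro sum.cong refl) (simp add: w2[symmetric])
    also have "\<dots> = (\<Sum>i\<in>I. exp (- a i) * (ip I x (u i))\<^sup>2 * ip I x x)"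
      unfolding pars(1)[symmetric] by (simp add: sum_distrib_left mult.assoc)
    finally show ?thesis by (simp add: \<alpha>_def sum_distrib_left mult.commute)
  qed
  have quadB: "(\<Sum>i\<in>I. \<Sum>j\<in>I. w i j * (exp (- b j) * (b j - a i)\<^sup>2)) = ip I x x * \<beta>"
  proof -
    have "(\<Sum>i\<in>I. \<Sum>j\<in>I. w i j * (exp (- b j) * (b j - a i)\<^sup>2)) =
        (\<Sum>i\<in>I. \<Sum>j\<in>I. exp (- b j) * ((ip I x (u i))\<^sup>2 * (ip I x (v j))\<^sup>2))"
      by (intro sum.cong refl) (simp add: w2[symmetric])
    also have "\<dots> = (\<Sum>i\<in>I. (ip I x (u i))\<^sup>2 * \<beta>)"
      by (simp add: \<beta>_def sum_distrib_left algebra_simps)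
    also have "\<dots> = ip I x x * \<beta>"
      unfolding pars(2)[symmetric] by (simp add: sum_distrib_right)
    finally show ?thesis .
  qed
  have k1: "TB \<ge> TA - \<alpha>"
    using klein_inequality[OF fin symC symB C B] BC
    by (simp add: TA_def TB_def \<alpha>_def power2_eq_square)
  have "ip I (v i) (mv I C (v i)) - ip I (v i) (mv I B (v i)) = - (ip I x (v i))\<^sup>2" for i
    using BC[of "v i" "v i"] by (simp add: power2_eq_square)
  hence k2: "TA \<ge> TB + \<beta>"
    using klein_inequality[OF fin symB symC B C]
    by (simp add: TA_def TB_def \<beta>_def sum_negf)
  have "TA - TB = (\<Sum>i\<in>I. \<Sum>j\<in>I. w i j * (exp (- a i) - exp (- b j)))"
    unfolding TA_def TB_def w_def right_diff_distrib sum_subtractf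
    by (subst sum_overlap_left[OF fin symC symB C B], subst (2) sum_overlap_right[OF fin symC symB C B], rule refl)
  also have "\<dots> \<ge> (\<Sum>i\<in>I. \<Sum>j\<in>I. w i j * (exp (- a i) * (b j - a i)
      - exp (- a i) * (b j - a i)\<^sup>2 / 3 - exp (- b j) * (b j - a i)\<^sup>2 / 6))"
  proof (intro sum_mono mult_left_mono)
    fix i j
    define y where "y = b j - a i"
    have bj: "exp (- b j) = exp (- a i) * exp (- y)" by (simp add: y_def flip: exp_add)
    have "exp (- a i) * (1 - exp (- y)) \<ge> exp (- a i) * (y - (2 + exp (- y)) * y\<^sup>2 / 6)"
      by (intro mult_left_mono exp_taylor_bound) simp
    thus "exp (- a i) * (b j - a i) - exp (- a i) * (b j - a i)\<^sup>2 / 3 - exp (- b j) * (b j - a i)\<^sup>2 / 6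
        \<le> exp (- a i) - exp (- b j)"
      unfolding bj y_def[symmetric] by (simp add: field_simps)
  qed (simp add: w_def)
  also have "(\<Sum>i\<in>I. \<Sum>j\<in>I. w i j * (exp (- a i) * (b j - a i)
      - exp (- a i) * (b j - a i)\<^sup>2 / 3 - exp (- b j) * (b j - a i)\<^sup>2 / 6)) =
      (\<Sum>i\<in>I. \<Sum>j\<in>I. w i j * (exp (- a i) * (b j - a i)))
      - (\<Sum>i\<in>I. \<Sum>j\<in>I. w i j * (exp (- a i) * (b j - a i)\<^sup>2)) / 3
      - (\<Sum>i\<in>I. \<Sum>j\<in>I. w i j * (exp (- b j) * (b j - a i)\<^sup>2)) / 6"
    unfolding sum_divide_distrib sum_subtractf[symmetric]
    by (intro sum.cong refl) (simp add: algebra_simps)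
  finally have main: "TA - TB \<ge> \<alpha> - ip I x x * \<alpha> / 3 - ip I x x * \<beta> / 6"
    unfolding lin quadA quadB .
  \<comment> \<open>Klein's inequality in both directions encloses \<open>TA - TB\<close> between
    \<beta> and \<alpha>.\<close>
  have "\<beta> \<le> \<alpha>" using k1 k2 by linarith
  hence "ip I x x * \<beta> \<le> ip I x x * \<alpha>" by (intro mult_left_mono ip_self_nonneg)
  moreover have "ip I x x * \<alpha> \<le> s * \<alpha>"
    using norm by (intro mult_right_mono) (auto simp: \<alpha>_def intro!: sum_nonneg)
  ultimately have "TA - TB \<ge> \<alpha> - s * \<alpha> / 2" using main by linarith
  thus ?thesis using T by (simp add: B_def[abs_def] TA_def TB_def \<alpha>_def algebra_simps)
qed

section \<open>Trace exponentials of independent sums\<close>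

lemma ip_mv_expectation:
  assumes "finite (set_pmf p)"
  shows "ip I y (mv I (\<lambda>l j. measure_pmf.expectation p (\<lambda>z. x z l * x z j)) y) =
    measure_pmf.expectation p (\<lambda>z. (ip I (x z) y)\<^sup>2)"
proof -
  have E: "measure_pmf.expectation p f = (\<Sum>z\<in>set_pmf p. pmf p z * f z)" for f :: "'a \<Rightarrow> real"
    by (subst integral_measure_pmf[OF assms]) auto
  show ?thesis unfolding E ip_mv_rank_one_sum by (simp add: power2_eq_square)
qed

text \<open>The rank-one bound is affine in the matrix \<open>x z l * x z j\<close>, so averaging it
  gives the tangent at \<open>C\<close> in the direction \<open>(1 - s / 2)\<close> times the mean
  matrix. Klein's inequality puts this tangent below the trace exponential at the shifted
  matrix.\<close>

lemma exp_trace_random_update: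
  assumes fin: "finite I" and symC: "symmetric_on I C" and finp: "finite (set_pmf p)"
    and norm: "\<And>z. z \<in> set_pmf p \<Longrightarrow> ip I (x z) (x z) \<le> s"
  shows "measure_pmf.expectation p (\<lambda>z. exp_trace I (\<lambda>l j. C l j + x z l * x z j)) \<le>
    exp_trace I (\<lambda>l j. C l j + (1 - s / 2) * measure_pmf.expectation p (\<lambda>z. x z l * x z j))"
proof -
  obtain a u where C: "eigensystem I C a u" by (rule eigensystem_exists[OF fin symC])
  define TC where "TC = (\<Sum>i\<in>I. exp (- a i))"
  have E: "measure_pmf.expectation p f = (\<Sum>z\<in>set_pmf p. pmf p z * f z)" for f :: "'a \<Rightarrow> real"
    by (subst integral_measure_pmf[OF finp]) auto
  define D where "D l j = (1 - s / 2) * (\<Sum>z\<in>set_pmf p. pmf p z * (x z l * x z j))" for l j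
  have symD: "symmetric_on I (\<lambda>l j. C l j + D l j)"
    using symC by (auto simp: symmetric_on_def D_def mult_ac)
  have qD: "ip I y (mv I D y) = (1 - s / 2) * (\<Sum>z\<in>set_pmf p. pmf p z * (ip I (x z) y)\<^sup>2)" for y
    unfolding D_def[abs_def] mv_scale_matrix[abs_def] ip_scale_right ip_mv_rank_one_sum
    by (simp add: power2_eq_square)
  obtain b v where B: "eigensystem I (\<lambda>l j. C l j + D l j) b v"
    and T: "exp_trace I (\<lambda>l j. C l j + D l j) = (\<Sum>i\<in>I. exp (- b i))"
    by (rule exp_trace_eigensystem[OF fin symD])
  have diff: "ip I y (mv I (\<lambda>l j. C l j + D l j) y) - ip I y (mv I C y) = ip I y (mv I D y)" for y
    by (simp add: mv_add_matrix[abs_def] ip_add_right)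
  have "measure_pmf.expectation p (\<lambda>z. exp_trace I (\<lambda>l j. C l j + x z l * x z j)) \<le>
      (\<Sum>z\<in>set_pmf p. pmf p z * (TC - (1 - s / 2) * (\<Sum>i\<in>I. exp (- a i) * (ip I (x z) (u i))\<^sup>2)))"
    unfolding E TC_def
    by (intro sum_mono mult_left_mono exp_trace_rank_one_update[OF fin symC C] norm) auto
  also have "\<dots> = TC - (1 - s / 2) * (\<Sum>z\<in>set_pmf p. \<Sum>i\<in>I. pmf p z * (exp (- a i) * (ip I (x z) (u i))\<^sup>2))"
    using sum_pmf_eq_1[OF finp order_refl]
    by (simp add: right_diff_distrib sum_subtractf sum_distrib_left mult.left_commute flip: sum_distrib_right)
  also have "(\<Sum>z\<in>set_pmf p. \<Sum>i\<in>I. pmf p z * (exp (- a i) * (ip I (x z) (u i))\<^sup>2)) =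
      (\<Sum>i\<in>I. exp (- a i) * (\<Sum>z\<in>set_pmf p. pmf p z * (ip I (x z) (u i))\<^sup>2))"
    by (subst sum.swap) (simp add: sum_distrib_left mult.left_commute)
  also have "TC - (1 - s / 2) * \<dots> = TC - (\<Sum>i\<in>I. exp (- a i) * ip I (u i) (mv I D (u i)))"
    by (simp add: qD sum_distrib_left mult.left_commute)
  also have "\<dots> \<le> exp_trace I (\<lambda>l j. C l j + D l j)"
    using klein_inequality[OF fin symC symD C B] unfolding T TC_def diff .
  finally show ?thesis unfolding E D_def[abs_def] .
qed

text \<open>Induction on the number of summands with \<open>C\<close> arbitrary. For a fixed last
  sample its rank-one term is absorbed into \<open>C\<close> and the induction hypothesis averages
  the others; then their mean is absorbed into \<open>C\<close> and the last sample is
  averaged.\<close>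

lemma exp_trace_independent_sum:
  fixes m :: nat
  assumes "finite I" and "symmetric_on I C"
    and "\<And>t. t < m \<Longrightarrow> finite (set_pmf (p t))"
    and "\<And>t z. t < m \<Longrightarrow> z \<in> set_pmf (p t) \<Longrightarrow> ip I (x t z) (x t z) \<le> s"
  shows "measure_pmf.expectation (Pi_pmf {..<m} d p)
      (\<lambda>\<omega>. exp_trace I (\<lambda>l j. C l j + (\<Sum>t<m. x t (\<omega> t) l * x t (\<omega> t) j))) \<le>
    exp_trace I (\<lambda>l j. C l j + (1 - s / 2) * (\<Sum>t<m. measure_pmf.expectation (p t) (\<lambda>z. x t z l * x t z j)))"
  using assms(2-4)
proof (induction m arbitrary: C)
  case 0
  show ?case by simp
next
  case (Suc m)
  let ?P = "Pi_pmf {..<m} d p"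
  have finP: "finite (set_pmf ?P)"
    using Suc.prems(2) by (subst set_Pi_pmf) (auto intro!: finite_PiE_dflt)
  have finm: "finite (set_pmf (p m))" using Suc.prems(2) by simp
  define F where "F \<omega> = exp_trace I (\<lambda>l j. C l j + (\<Sum>t<Suc m. x t (\<omega> t) l * x t (\<omega> t) j))" for \<omega>
  define G where "G l j = (1 - s / 2) * (\<Sum>t<m. measure_pmf.expectation (p t) (\<lambda>z. x t z l * x t z j))" for l j
  have "Pi_pmf {..<Suc m} d p = p m \<bind> (\<lambda>y. map_pmf (\<lambda>f. f(m := y)) ?P)"
    unfolding lessThan_Suc by (subst Pi_pmf_insert') (simp_all add: map_pmf_def)
  hence "measure_pmf.expectation (Pi_pmf {..<Suc m} d p) F =
      (\<Sum>y\<in>set_pmf (p m). pmf (p m) y * measure_pmf.expectation ?P (\<lambda>f. F (f(m := y))))"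
    using finP by (simp add: pmf_expectation_bind[OF finm])
  also have "\<dots> \<le> (\<Sum>y\<in>set_pmf (p m). pmf (p m) y * exp_trace I (\<lambda>l j. (C l j + G l j) + x m y l * x m y j))"
  proof (intro sum_mono mult_left_mono)
    fix y
    have "F (f(m := y)) = exp_trace I (\<lambda>l j. (C l j + x m y l * x m y j) + (\<Sum>t<m. x t (f t) l * x t (f t) j))" for f
      unfolding F_def by (simp add: algebra_simps)
    moreover have "symmetric_on I (\<lambda>l j. C l j + x m y l * x m y j)"
      using Suc.prems(1) by (auto simp: symmetric_on_def)
    ultimately have "measure_pmf.expectation ?P (\<lambda>f. F (f(m := y))) \<le>
        exp_trace I (\<lambda>l j. (C l j + x m y l * x m y j) + G l j)"
      using Suc.IH[of "\<lambda>l j. C l j + x m y l * x m y j"] Suc.prems(2,3)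
      unfolding G_def by simp
    thus "measure_pmf.expectation ?P (\<lambda>f. F (f(m := y))) \<le>
        exp_trace I (\<lambda>l j. (C l j + G l j) + x m y l * x m y j)"
      by (simp add: algebra_simps)
  qed simp
  also have "\<dots> = measure_pmf.expectation (p m) (\<lambda>y. exp_trace I (\<lambda>l j. (C l j + G l j) + x m y l * x m y j))"
    by (subst integral_measure_pmf[OF finm]) auto
  also have "\<dots> \<le> exp_trace I (\<lambda>l j. (C l j + G l j)
      + (1 - s / 2) * measure_pmf.expectation (p m) (\<lambda>z. x m z l * x m z j))"
  proof (rule exp_trace_random_update[OF assms(1) _ finm])
    show "symmetric_on I (\<lambda>l j. C l j + G l j)"
      using Suc.prems(1) by (auto simp: symmetric_on_def G_def mult_ac)
  qed (use Suc.prems(3) in auto)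
  finally show ?case unfolding F_def G_def by (simp add: algebra_simps)
qed

text \<open>A Rayleigh quotient of at most \<open>r\<close> forces some eigenvalue to be at most
  \<open>r\<close>, and its term alone contributes \<open>exp (- r)\<close>.\<close>

lemma exp_trace_ge:
  assumes "finite I" "symmetric_on I A" "ip I y y > 0" "ip I y (mv I A y) \<le> r * ip I y y"
  shows "exp_trace I A \<ge> exp (- r)"
proof -
  obtain a u where A: "eigensystem I A a u" and T: "exp_trace I A = (\<Sum>i\<in>I. exp (- a i))"
    by (rule exp_trace_eigensystem[OF assms(1,2)])
  have pars: "(\<Sum>i\<in>I. (ip I (u i) y)\<^sup>2) = ip I y y"
    using eigensystem_parseval[OF assms(1) A, of y y] by (simp add: power2_eq_square)
  have "\<exists>i\<in>I. a i \<le> r"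
  proof (rule ccontr)
    assume "\<not> ?thesis"
    hence gt: "\<And>i. i \<in> I \<Longrightarrow> r < a i" by force
    have "\<exists>i\<in>I. (ip I (u i) y)\<^sup>2 > 0"
    proof (rule ccontr)
      assume "\<not> ?thesis"
      hence "(\<Sum>i\<in>I. (ip I (u i) y)\<^sup>2) = 0" by (intro sum.neutral) auto
      with pars assms(3) show False by simp
    qed
    then obtain i where "i \<in> I" "(ip I (u i) y)\<^sup>2 > 0" by blast
    hence "r * (ip I (u i) y)\<^sup>2 < a i * (ip I (u i) y)\<^sup>2"
      using gt by (intro mult_strict_right_mono) auto
    hence "(\<Sum>i\<in>I. r * (ip I (u i) y)\<^sup>2) < (\<Sum>i\<in>I. a i * (ip I (u i) y)\<^sup>2)"
      using gt \<open>i \<in> I\<close>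
      by (intro sum_strict_mono_ex1[OF assms(1)] ballI mult_right_mono bexI[of _ i]) (auto simp: less_imp_le)
    thus False
      using assms(4) eigensystem_quadratic_form[OF assms(1,2) A, of y] pars
      by (simp flip: sum_distrib_left)
  qed
  then obtain i where i: "i \<in> I" "a i \<le> r" by blast
  hence "exp (- r) \<le> exp (- a i)" by simp
  also have "\<dots> \<le> (\<Sum>i\<in>I. exp (- a i))"
    by (rule member_le_sum[OF i(1)]) (simp_all add: assms(1))
  finally show ?thesis by (simp add: T)
qed

lemma exp_trace_le:
  assumes "finite I" "symmetric_on I A" "\<And>y. r * ip I y y \<le> ip I y (mv I A y)"
  shows "exp_trace I A \<le> card I * exp (- r)"
proof -
  obtain a u where A: "eigensystem I A a u" and T: "exp_trace I A = (\<Sum>i\<in>I. exp (- a i))"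
    by (rule exp_trace_eigensystem[OF assms(1,2)])
  have "r \<le> a i" if "i \<in> I" for i
    using assms(3)[of "u i"] eigensystem_eigenvalue[OF A that] eigensystemD(1)[OF A that that] by simp
  hence "(\<Sum>i\<in>I. exp (- a i)) \<le> (\<Sum>i\<in>I. exp (- r))" by (intro sum_mono) simp
  thus ?thesis by (simp add: T)
qed

text \<open>All eigenvectors except one, \<open>u i0\<close>, have eigenvalue at least \<lambda>2 >
  0 and are therefore orthogonal to the kernel vector of ones. So the ones vector is carried by
  \<open>u i0\<close> alone, and a vector of sum zero has no component along
  \<open>u i0\<close>.\<close>

lemma lambda2_quadratic_form:
  assumes "symmetric_on {..<n} A" "n \<ge> 2" and ker: "\<And>l. l < n \<Longrightarrow> mv {..<n} A (\<lambda>_. 1) l = 0"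
    and pos: "lambda2 (mat n n (\<lambda>(i, j). A i j)) > 0" and x: "ip {..<n} (\<lambda>_. 1) x = 0"
  shows "ip {..<n} x (mv {..<n} A x) \<ge> lambda2 (mat n n (\<lambda>(i, j). A i j)) * ip {..<n} x x"
proof -
  let ?I = "{..<n}" and ?lam = "lambda2 (mat n n (\<lambda>(i, j). A i j))"
  obtain a u where au: "eigensystem ?I A a u"
    and cp: "char_poly (mat n n (\<lambda>(i, j). A i j)) = (\<Prod>i<n. [:- a i, 1:])"
    by (rule eigensystem_exists_lessThan[OF assms(1)])
  have pr: "proots (char_poly (mat n n (\<lambda>(i, j). A i j))) = image_mset a (mset_set {..<n})"
  proof -
    have "(\<Sum>i\<in>F. {#a i#}) = image_mset a (mset_set F)" if "finite F" for F
      using that by (induction F rule: finite_induct) auto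
    thus ?thesis unfolding cp by (subst proots_prod) auto
  qed
  define xs where "xs = sorted_list_of_multiset (image_mset a (mset_set {..<n}))"
  have xs: "mset xs = image_mset a (mset_set {..<n})" "sorted xs" by (simp_all add: xs_def)
  hence "length xs = n" by (metis card_lessThan size_image_mset size_mset size_mset_set)
  then obtain x0 x1 ys where xs_eq: "xs = x0 # x1 # ys"
    using \<open>n \<ge> 2\<close> by (cases xs; cases "tl xs") auto
  have lam: "?lam = x1" unfolding lambda2_def pr xs_def[symmetric] xs_eq by simp
  \<comment> \<open>Multisets keep multiplicities: the smallest eigenvalue is removed at the single
    index \<open>i0\<close>, and all remaining ones are at least the list entry of index 1.\<close>
  have "x0 \<in># image_mset a (mset_set {..<n})" using xs(1) xs_eq by (metis list.set_intros(1) set_mset_mset)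
  then obtain i0 where i0: "i0 < n" "a i0 = x0" by auto
  have "mset_set {..<n} = add_mset i0 (mset_set ({..<n} - {i0}))"
    using i0(1) by (subst mset_set.remove[of "{..<n}" i0]) auto
  hence rest: "image_mset a (mset_set ({..<n} - {i0})) = mset (x1 # ys)"
    using xs(1) i0(2) by (simp add: xs_eq)
  have ge: "?lam \<le> a i" if "i < n" "i \<noteq> i0" for i
  proof -
    have "a i \<in># image_mset a (mset_set ({..<n} - {i0}))" using that by auto
    hence "a i \<in> set (x1 # ys)" unfolding rest by (simp only: set_mset_mset)
    thus ?thesis using xs(2) unfolding lam xs_eq by auto
  qed
  have one: "ip ?I (u i) (\<lambda>_. 1) = 0" if "i < n" "i \<noteq> i0" for i
  proof -
    have "a i * ip ?I (u i) (\<lambda>_. 1) = ip ?I (u i) (mv ?I A (\<lambda>_. 1))"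
      using eigensystem_ip_mv[OF assms(1) au] that by simp
    also have "\<dots> = ip ?I (u i) (\<lambda>_. 0)" by (rule ip_cong) (auto simp: ker)
    finally show ?thesis using ge[OF that] pos by (auto simp: ip_def)
  qed
  have i0x: "ip ?I (u i0) x = 0"
  proof -
    have "0 = (\<Sum>i<n. ip ?I (u i) (\<lambda>_. 1) * ip ?I (u i) x)"
      using eigensystem_parseval[OF _ au, of "\<lambda>_. 1" x] x by simp
    also have "\<dots> = ip ?I (u i0) (\<lambda>_. 1) * ip ?I (u i0) x"
      using i0(1) one by (subst sum.remove[of _ i0]) auto
    finally have "ip ?I (u i0) (\<lambda>_. 1) = 0 \<or> ip ?I (u i0) x = 0" by simp
    moreover have "(\<Sum>i<n. ip ?I (u i) (\<lambda>_. 1) * ip ?I (u i) (\<lambda>_. 1)) = n"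
      using eigensystem_parseval[OF _ au, of "\<lambda>_. 1" "\<lambda>_. 1"] by (simp add: ip_def)
    hence "ip ?I (u i0) (\<lambda>_. 1) * ip ?I (u i0) (\<lambda>_. 1) = n"
      using i0(1) one by (subst (asm) sum.remove[of _ i0]) auto
    ultimately show ?thesis using \<open>n \<ge> 2\<close> by auto
  qed
  have "?lam * ip ?I x x = (\<Sum>i<n. ?lam * (ip ?I (u i) x)\<^sup>2)"
    using eigensystem_parseval[OF _ au, of x x] by (simp add: power2_eq_square flip: sum_distrib_left)
  also have "\<dots> \<le> (\<Sum>i<n. a i * (ip ?I (u i) x)\<^sup>2)"
  proof (rule sum_mono)
    fix i assume "i \<in> {..<n}"
    thus "?lam * (ip ?I (u i) x)\<^sup>2 \<le> a i * (ip ?I (u i) x)\<^sup>2"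
      using ge[of i] i0x by (cases "i = i0") (auto intro: mult_right_mono)
  qed
  also have "\<dots> = ip ?I x (mv ?I A x)"
    by (rule eigensystem_quadratic_form[symmetric]) (use assms(1) au in auto)
  finally show ?thesis .
qed

section \<open>The logistic function and first-order optimality\<close>

definition sig :: "real \<Rightarrow> real" where
  "sig x = 1 / (1 + exp (- x))"

text \<open>Both the derivative of \<open>sig\<close> and the variance of a Bernoulli variable with
  mean \<open>sig x\<close>. This coincidence makes the Hessian the conditional covariance of the
  score.\<close>

definition dsig :: "real \<Rightarrow> real" where
  "dsig x = sig x * (1 - sig x)"

lemma sig_pos: "sig x > 0"
  by (simp add: sig_def add_pos_pos)

lemma sig_less_1: "sig x < 1"
  by (simp add: sig_def add_pos_pos)

lemma sig_minus: "sig (- x) = 1 - sig x"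
proof -
  have "1 + exp x > 0" by (simp add: add_pos_pos)
  thus ?thesis by (simp add: sig_def exp_minus divide_simps)
qed

lemma sig_diff: "sig (x - y) = exp x / (exp x + exp y)"
  by (simp add: sig_def exp_diff field_simps add_pos_pos)

lemma dsig_pos: "dsig x > 0"
  using sig_pos[of x] sig_less_1[of x] by (simp add: dsig_def)

lemma dsig_minus: "dsig (- x) = dsig x"
  by (simp add: dsig_def sig_minus)

lemma dsig_le: "dsig x \<le> 1 / 4"
proof -
  have "0 \<le> (sig x - 1 / 2)\<^sup>2" by simp
  thus ?thesis by (simp add: dsig_def power2_eq_square algebra_simps)
qed

text \<open>In this form the dependence on \<bar>x\<bar> alone and the decrease in \<bar>x\<bar> are
  visible.\<close>

lemma dsig_cosh: "dsig x = 1 / (2 + 2 * cosh x)"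
proof -
  have *: "1 + exp x > 0" by (simp add: add_pos_pos)
  have "dsig x = exp x / (1 + exp x)\<^sup>2"
    using * by (simp add: dsig_def sig_def exp_minus power2_eq_square field_simps)
  also have "\<dots> = 1 / ((1 + exp x)\<^sup>2 / exp x)" by simp
  also have "(1 + exp x)\<^sup>2 / exp x = 2 + 2 * cosh x"
    by (simp add: cosh_field_def exp_minus power2_eq_square field_simps)
  finally show ?thesis .
qed

lemma dsig_antimono: "\<bar>x\<bar> \<le> \<bar>y\<bar> \<Longrightarrow> dsig y \<le> dsig x"
proof -
  assume "\<bar>x\<bar> \<le> \<bar>y\<bar>"
  hence "cosh \<bar>x\<bar> \<le> cosh \<bar>y\<bar>" by (subst cosh_real_nonneg_le_iff) auto
  hence "cosh x \<le> cosh y" by (simp add: abs_if split: if_splits)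
  thus "dsig y \<le> dsig x"
    unfolding dsig_cosh using cosh_real_pos[of x] by (intro divide_left_mono) (auto intro!: mult_pos_pos add_pos_pos)
qed

lemma sig_has_derivative: "(sig has_real_derivative dsig x) (at x)"
proof -
  have "1 + exp (- x) > 0" by (simp add: add_pos_pos)
  hence "1 + exp (- x) \<noteq> 0" by linarith
  thus ?thesis
    unfolding sig_def dsig_def by (auto intro!: derivative_eq_intros simp: field_simps power2_eq_square)
qed

lemma ln_sig_has_derivative: "((\<lambda>x. ln (sig x)) has_real_derivative 1 - sig x) (at x)"
  using sig_pos[of x]
  by (auto intro!: derivative_eq_intros sig_has_derivative simp: dsig_def)

text \<open>The function \<open>1 - exp (- d)\<close> is concave in \<open>d\<close>, so on
  \<open>[0, c]\<close> it lies above its chord.\<close>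

lemma one_minus_exp_chord:
  fixes c d :: real
  assumes "0 < c" "0 \<le> d" "d \<le> c"
  shows "(1 - exp (- c)) / c * d \<le> 1 - exp (- d)"
proof -
  have "exp ((1 - d / c) *\<^sub>R 0 + (d / c) *\<^sub>R (- c)) \<le> (1 - d / c) * exp 0 + (d / c) * exp (- c)"
    using assms by (intro convex_onD[OF exp_convex]) auto
  hence "exp (- d) \<le> 1 - d / c + d / c * exp (- c)" using assms by simp
  moreover have "(1 - exp (- c)) / c * d = d / c - d / c * exp (- c)"
    by (simp add: diff_divide_distrib algebra_simps)
  ultimately show ?thesis by linarith
qed

text \<open>With \<open>p = exp u\<close> and \<open>q = exp (x - u)\<close> the increment is
  exactly \<open>p * (q - 1) / ((1 + p * q) * (1 + p))\<close>. As \<open>q \<ge> 1\<close>, the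
  factor \<open>1 + p * q\<close> may be replaced by \<open>(1 + p) * q\<close>.\<close>

lemma sig_increment_lower_bound:
  assumes "u \<le> x"
  shows "sig x - sig u \<ge> dsig u * (1 - exp (- (x - u)))"
proof -
  define p where "p = exp u"
  define q where "q = exp (x - u)"
  have pq: "p > 0" "q \<ge> 1" using assms by (simp_all add: p_def q_def)
  have x: "exp x = p * q" by (simp add: p_def q_def flip: exp_add)
  have "sig x = p * q / (1 + p * q)" using pq by (simp add: sig_def exp_minus x field_simps add_pos_pos)
  moreover have su: "sig u = p / (1 + p)" using pq by (simp add: sig_def exp_minus p_def field_simps add_pos_pos)
  ultimately have "sig x - sig u = p * q / (1 + p * q) - p / (1 + p)" by simp
  also have "\<dots> = p * (q - 1) / ((1 + p * q) * (1 + p))"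
  proof -
    have "1 + p * q > 0" "1 + p > 0" using pq by (auto intro!: add_pos_pos)
    thus ?thesis by (simp add: diff_frac_eq) (simp add: algebra_simps)
  qed
  also have "\<dots> \<ge> p * (q - 1) / ((1 + p) * q * (1 + p))"
    using pq by (intro divide_left_mono mult_right_mono mult_nonneg_nonneg mult_pos_pos add_pos_pos) (auto simp: algebra_simps)
  also have "p * (q - 1) / ((1 + p) * q * (1 + p)) = dsig u * (1 - 1 / q)"
  proof -
    have "1 + p > 0" using pq by simp
    hence "1 - p / (1 + p) = 1 / (1 + p)" "1 - 1 / q = (q - 1) / q" using pq by (simp_all add: field_simps)
    thus ?thesis by (simp add: dsig_def su mult_ac)
  qed
  also have "1 / q = exp (- (x - u))" unfolding q_def exp_minus by (simp add: inverse_eq_divide)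
  finally show ?thesis .
qed

text \<open>Three positions of the secant are treated. For \<open>u \<ge> 0\<close> the chord bound
  applies. For \<open>x \<le> - u\<close> the slope on the way is at least \<open>dsig u\<close>.
  Otherwise the interval is split at \<open>- u\<close>, where the slope equals
  \<open>dsig u\<close> again.\<close>

lemma sig_secant_upward:
  assumes "b > 0" "u \<le> x" "\<bar>u\<bar> \<le> 2 * b" "\<bar>x\<bar> \<le> 2 * b"
  shows "sig x - sig u \<ge> (1 - exp (- (2 * b))) / (2 * b) * dsig u * (x - u)"
proof -
  define \<psi> where "\<psi> = (1 - exp (- (2 * b))) / (2 * b)"
  have psi1: "\<psi> \<le> 1"
    using exp_ge_add_one_self[of "- (2 * b)"] assms(1) by (simp add: \<psi>_def field_simps)
  \<comment> \<open>Starting at \<open>v \<ge> 0\<close> keeps the interval shorter than or equal to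
    \<open>2 * b\<close>, although two points of the full range may be \<open>4 * b\<close> apart.
    This is why \<psi> involves only \<open>2 * b\<close>.\<close>
  have right: "sig x - sig v \<ge> \<psi> * dsig v * (x - v)" if "0 \<le> v" "v \<le> x" for v
  proof -
    have "\<psi> * (x - v) \<le> 1 - exp (- (x - v))"
      unfolding \<psi>_def using that assms by (intro one_minus_exp_chord) auto
    hence "dsig v * (\<psi> * (x - v)) \<le> dsig v * (1 - exp (- (x - v)))"
      using dsig_pos[of v] by (intro mult_left_mono) auto
    thus ?thesis using sig_increment_lower_bound[OF that(2)] by (simp add: mult_ac)
  qed
  have centre: "sig w - sig u \<ge> dsig u * (w - u)" if "u \<le> w" "w \<le> - u" for w
  proof (cases "u = w")
    case False
    hence "u < w" using that by simp
    then obtain z where z: "z > u" "z < w" "sig w - sig u = (w - u) * dsig z"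
      using MVT2[of u w sig dsig] sig_has_derivative by blast
    have "dsig u \<le> dsig z" using z that by (intro dsig_antimono) auto
    hence "dsig u * (w - u) \<le> dsig z * (w - u)" using that by (intro mult_right_mono) auto
    thus ?thesis using z by (simp add: mult.commute)
  qed simp
  have weak: "\<psi> * (dsig u * (w - u)) \<le> dsig u * (w - u)" if "u \<le> w" for w
    using psi1 dsig_pos[of u] that by (intro mult_left_le_one_le) (auto simp: \<psi>_def assms(1) less_imp_le)
  show ?thesis
  proof (cases "u \<ge> 0")
    case True
    thus ?thesis using right[of u] assms(2) by (simp add: \<psi>_def)
  next
    case False
    show ?thesis
    proof (cases "x \<le> - u")
      case True
      thus ?thesis using centre[of x] weak[of x] assms(2) by (simp add: \<psi>_def mult.assoc)
    next
      case False
      with \<open>\<not> u \<ge> 0\<close> have "sig x - sig (- u) \<ge> \<psi> * dsig u * (x - - u)"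
        using right[of "- u"] by (simp add: dsig_minus)
      moreover have "sig (- u) - sig u \<ge> \<psi> * (dsig u * (- u - u))"
        using centre[of "- u"] weak[of "- u"] \<open>\<not> u \<ge> 0\<close> by linarith
      ultimately show ?thesis unfolding \<psi>_def[symmetric] by (simp add: algebra_simps)
    qed
  qed
qed

text \<open>The downward secant is the upward one after the reflection of both points at 0, under
  which \<open>dsig\<close> is even and \<open>sig\<close> is odd up to a constant.\<close>

lemma sig_secant:
  assumes "b > 0" "\<bar>u\<bar> \<le> 2 * b" "\<bar>x\<bar> \<le> 2 * b"
  shows "(sig x - sig u) * (x - u) \<ge> (1 - exp (- (2 * b))) / (2 * b) * (dsig u * (x - u)\<^sup>2)"
proof (cases "u \<le> x")
  case True
  hence "(1 - exp (- (2 * b))) / (2 * b) * dsig u * (x - u) * (x - u) \<le> (sig x - sig u) * (x - u)"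
    using sig_secant_upward[OF assms(1) True assms(2,3)] by (intro mult_right_mono) auto
  thus ?thesis by (simp add: power2_eq_square mult.assoc)
next
  case False
  hence "(1 - exp (- (2 * b))) / (2 * b) * dsig (- u) * (- x - - u) * (- x - - u) \<le> (sig (- x) - sig (- u)) * (- x - - u)"
    using sig_secant_upward[OF assms(1), of "- u" "- x"] assms by (intro mult_right_mono) auto
  moreover have "(1 - exp (- (2 * b))) / (2 * b) * dsig u * (- x - - u) * (- x - - u) =
      (1 - exp (- (2 * b))) / (2 * b) * (dsig u * (x - u)\<^sup>2)"
    by (simp add: power2_eq_square mult.assoc) (simp add: algebra_simps)
  moreover have "(sig (- x) - sig (- u)) * (- x - - u) = (sig x - sig u) * (x - u)"
    by (simp add: sig_minus algebra_simps)
  ultimately show ?thesis unfolding dsig_minus by linarith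
qed

text \<open>The expression vanishes at 0, so its monotonicity compares
  \<open>exp x * (2 - x)\<close> with \<open>2 + x\<close> on either side of 0. This is the
  comparison of the exponential with its Pade approximant.\<close>

lemma exp_pade_mono:
  fixes x y :: real
  assumes "x \<le> y"
  shows "x + 2 + exp x * (x - 2) \<le> y + 2 + exp y * (y - 2)"
proof (rule DERIV_nonneg_imp_nondecreasing[OF assms])
  fix z :: real
  have "((\<lambda>x. x + 2 + exp x * (x - 2)) has_real_derivative exp z * (z - 1) + 1) (at z)"
    by (auto intro!: derivative_eq_intros simp: field_simps)
  thus "\<exists>d. ((\<lambda>x. x + 2 + exp x * (x - 2)) has_real_derivative d) (at z) \<and> 0 \<le> d"
    using exp_mult_pred_ge by blast
qed

text \<open>The difference \<open>g\<close> of the two sides has derivative \<open>h x / 3\<close>,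
  where \<open>h\<close> is the increasing function of \<open>exp_pade_mono\<close>. Hence
  \<open>g\<close> has its minimum at 0, with value 0.\<close>

lemma exp_cubic_factor_bound: "(1 - x / 3) * (exp x - 1 - x) \<le> x\<^sup>2 / 2" for x :: real
proof -
  define g where "g x = x\<^sup>2 / 2 - (1 - x / 3) * (exp x - 1 - x)" for x :: real
  define h where "h x = x + 2 + exp x * (x - 2)" for x :: real
  have dg: "(g has_real_derivative h x / 3) (at x)" for x
    unfolding g_def h_def by (auto intro!: derivative_eq_intros simp: field_simps power2_eq_square)
  have h_mono: "h x \<le> h y" if "x \<le> y" for x y
    unfolding h_def by (rule exp_pade_mono[OF that])
  have h0: "h 0 = 0" and g0: "g 0 = 0" by (simp_all add: h_def g_def)
  have "g x \<ge> 0"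
  proof (cases "x \<ge> 0")
    case True
    have "g 0 \<le> g x"
    proof (rule DERIV_nonneg_imp_nondecreasing[OF True])
      fix y assume "0 \<le> (y::real)"
      thus "\<exists>z. (g has_real_derivative z) (at y) \<and> 0 \<le> z" using dg h_mono[of 0 y] h0 by force
    qed
    thus ?thesis using g0 by simp
  next
    case False
    hence "x \<le> 0" by simp
    have "g 0 \<le> g x"
    proof (rule DERIV_nonpos_imp_nonincreasing[OF \<open>x \<le> 0\<close>])
      fix y assume "y \<le> (0::real)"
      thus "\<exists>z. (g has_real_derivative z) (at y) \<and> z \<le> 0" using dg h_mono[of y 0] h0 by force
    qed
    thus ?thesis using g0 by simp
  qed
  thus ?thesis by (simp add: g_def)
qed

lemma exp_quadratic_bound:
  fixes x B :: real
  assumes "x \<le> B" "B < 3"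
  shows "exp x \<le> 1 + x + x\<^sup>2 / (2 * (1 - B / 3))"
proof -
  have "exp x - 1 - x \<ge> 0" using exp_ge_add_one_self[of x] by linarith
  hence "(1 - B / 3) * (exp x - 1 - x) \<le> (1 - x / 3) * (exp x - 1 - x)"
    using assms by (intro mult_right_mono) auto
  also have "\<dots> \<le> x\<^sup>2 / 2" by (rule exp_cubic_factor_bound)
  finally show ?thesis using assms(2) by (simp add: field_simps)
qed

section \<open>First-order optimality of the constrained maximizer\<close>

lemma loglik1_sig: "loglik1 m \<omega> \<theta> = (\<Sum>t<m. ln (sig (\<theta> (fst (\<omega> t)) - \<theta> (snd (\<omega> t)))))"
  by (simp add: loglik1_def sig_diff)

text \<open>The segment from the maximizer to the true parameter stays in the convex set
  \<open>Theta n b\<close>, so the derivative \<open>D\<close> of the objective along it is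
  nonpositive at its start. Adding and subtracting \<open>sig (x0 t)\<close> moves the score from
  the maximizer to the true parameter.\<close>

lemma loglik1_maximizer_gradient:
  assumes "\<theta>h \<in> Theta n b" "\<theta>s \<in> Theta n b"
    and max: "\<forall>\<theta>\<in>Theta n b. loglik1 m \<omega> \<theta> \<le> loglik1 m \<omega> \<theta>h"
  defines "x \<equiv> \<lambda>t. \<theta>h (fst (\<omega> t)) - \<theta>h (snd (\<omega> t))"
    and "x0 \<equiv> \<lambda>t. \<theta>s (fst (\<omega> t)) - \<theta>s (snd (\<omega> t))"
  shows "(\<Sum>t<m. (sig (x t) - sig (x0 t)) * (x t - x0 t)) \<le> (\<Sum>t<m. (1 - sig (x0 t)) * (x t - x0 t))"
proof -
  define f where "f e = (\<Sum>t<m. ln (sig (x t + e * (x0 t - x t))))" for e :: real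
  define D where "D = (\<Sum>t<m. (1 - sig (x t)) * (x0 t - x t))"
  have "((\<lambda>e. ln (sig (x t + e * (x0 t - x t)))) has_real_derivative (1 - sig (x t)) * (x0 t - x t)) (at 0)" for t
  proof -
    have "((\<lambda>e. x t + e * (x0 t - x t)) has_real_derivative (x0 t - x t)) (at 0)"
      by (auto intro!: derivative_eq_intros)
    from DERIV_chain2[OF _ this, of "\<lambda>x. ln (sig x)"] show ?thesis using ln_sig_has_derivative by simp
  qed
  hence "(f has_real_derivative D) (at 0)"
    unfolding f_def D_def by (intro DERIV_sum) auto
  moreover have "f e \<le> f 0" if "0 \<le> e" "e \<le> 1" for e
  proof -
    define \<theta> where "\<theta> i = \<theta>h i + e * (\<theta>s i - \<theta>h i)" for i
    have "\<theta> \<in> Theta n b"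
    proof -
      have "\<bar>\<theta> i\<bar> \<le> b" if i: "i \<in> {1..n}" for i
      proof -
        have "\<theta> i = (1 - e) * \<theta>h i + e * \<theta>s i" by (simp add: \<theta>_def algebra_simps)
        also have "\<bar>\<dots>\<bar> \<le> (1 - e) * \<bar>\<theta>h i\<bar> + e * \<bar>\<theta>s i\<bar>"
          using \<open>0 \<le> e\<close> \<open>e \<le> 1\<close> by (intro order_trans[OF abs_triangle_ineq]) (simp add: abs_mult)
        also have "\<dots> \<le> (1 - e) * b + e * b"
          using assms(1,2) i \<open>0 \<le> e\<close> \<open>e \<le> 1\<close>
          by (intro add_mono mult_left_mono) (auto simp: Theta_def)
        finally show ?thesis by (simp add: algebra_simps)
      qed
      moreover have "(\<Sum>i=1..n. \<theta> i) = 0"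
        using assms(1,2) by (simp add: Theta_def \<theta>_def sum.distrib sum_subtractf flip: sum_distrib_left)
      ultimately show ?thesis by (simp add: Theta_def)
    qed
    hence "loglik1 m \<omega> \<theta> \<le> loglik1 m \<omega> \<theta>h" using max by blast
    moreover have "loglik1 m \<omega> \<theta> = f e" "loglik1 m \<omega> \<theta>h = f 0"
      by (simp_all add: loglik1_sig f_def \<theta>_def x_def x0_def algebra_simps)
    ultimately show ?thesis by simp
  qed
  ultimately have "D \<le> 0"
  proof -
    assume D: "(f has_real_derivative D) (at 0)" and f: "\<And>e. 0 \<le> e \<Longrightarrow> e \<le> 1 \<Longrightarrow> f e \<le> f 0"
    show "D \<le> 0"
    proof (rule ccontr)
      assume "\<not> D \<le> 0"
      then obtain d where d: "d > 0" "\<And>h. h > 0 \<Longrightarrow> h < d \<Longrightarrow> f 0 < f (0 + h)"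
        using DERIV_pos_inc_right[OF D] by force
      have "f 0 < f (0 + min (d / 2) 1)" using d(1) by (intro d(2)) auto
      moreover have "f (min (d / 2) 1) \<le> f 0" using d(1) by (intro f) auto
      ultimately show False by simp
    qed
  qed
  moreover have "(\<Sum>t<m. (sig (x t) - sig (x0 t)) * (x t - x0 t)) = (\<Sum>t<m. (1 - sig (x0 t)) * (x t - x0 t)) + D"
    unfolding D_def sum.distrib[symmetric] by (intro sum.cong refl) (simp add: algebra_simps)
  ultimately show ?thesis by simp
qed

text \<open>Integrating \<open>cosh \<ge> 1\<close> three times gives this Taylor bound. It is used
  to bound \<open>\<psi> * exp b = sinh b / b\<close> from below.\<close>

lemma sinh_lower_bound:
  fixes b :: real
  assumes "b \<ge> 0"
  shows "sinh b \<ge> b + b ^ 3 / 6"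
proof -
  have mono: "f 0 \<le> f x"
    if "\<And>y. y \<ge> 0 \<Longrightarrow> (f has_real_derivative f' y) (at y)" "\<And>y. y \<ge> 0 \<Longrightarrow> f' y \<ge> 0" "x \<ge> 0"
    for f f' :: "real \<Rightarrow> real" and x
    by (rule DERIV_nonneg_imp_nondecreasing[OF that(3)]) (use that in blast)
  have s1: "sinh x \<ge> x" if "x \<ge> 0" for x :: real
  proof -
    have "sinh 0 - 0 \<le> sinh x - x"
      by (rule mono[where f' = "\<lambda>x. cosh x - 1"])
        (use that in \<open>auto intro!: derivative_eq_intros simp: cosh_real_ge_1\<close>)
    thus ?thesis by simp
  qed
  have c2: "cosh x \<ge> 1 + x\<^sup>2 / 2" if "x \<ge> 0" for x :: real
  proof -
    have "cosh 0 - 1 - 0\<^sup>2 / 2 \<le> cosh x - 1 - x\<^sup>2 / 2"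
    proof (rule mono[where f' = "\<lambda>x. sinh x - x"])
      show "((\<lambda>x. cosh x - 1 - x\<^sup>2 / 2) has_real_derivative sinh y - y) (at y)" for y :: real
        by (rule derivative_eq_intros refl | simp)+
      show "0 \<le> sinh y - y" if "y \<ge> 0" for y :: real
        using s1[OF that] by simp
    qed (rule that)
    thus ?thesis by simp
  qed
  have "sinh 0 - 0 - 0 ^ 3 / 6 \<le> sinh b - b - b ^ 3 / 6"
  proof (rule mono[where f' = "\<lambda>x. cosh x - 1 - x\<^sup>2 / 2"])
    show "((\<lambda>x. sinh x - x - x ^ 3 / 6) has_real_derivative cosh y - 1 - y\<^sup>2 / 2) (at y)" for y :: real
      by (rule derivative_eq_intros refl | simp)+
    show "0 \<le> cosh y - 1 - y\<^sup>2 / 2" if "y \<ge> 0" for y :: real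
      using c2[OF that] by simp
  qed (rule assms)
  thus ?thesis by simp
qed

section \<open>The observation model\<close>

text \<open>Redraws which item of a given pair wins. For two distinct items the law depends on the
  unordered pair only, since swapping \<open>w\<close> swaps both the outcomes and their
  probabilities.\<close>

definition flip_pmf :: "(nat \<Rightarrow> real) \<Rightarrow> nat \<times> nat \<Rightarrow> (nat \<times> nat) pmf" where
  "flip_pmf \<theta> w = map_pmf (\<lambda>c. if c then w else prod.swap w) (bernoulli_pmf (sig (\<theta> (fst w) - \<theta> (snd w))))"

lemma pmf_luce_pmf:
  assumes "finite S" "S \<noteq> {}"
  shows "pmf (luce_pmf \<theta> S) i = (if i \<in> S then exp (\<theta> i) / (\<Sum>v\<in>S. exp (\<theta> v)) else 0)"
  unfolding luce_pmf_def
proof (rule pmf_embed_pmf)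
  have Z: "(\<Sum>v\<in>S. exp (\<theta> v)) > 0" using assms by (intro sum_pos) auto
  show "0 \<le> (if i \<in> S then exp (\<theta> i) / (\<Sum>v\<in>S. exp (\<theta> v)) else 0)" for i
    by (auto intro!: divide_nonneg_nonneg sum_nonneg)
  have "(\<integral>\<^sup>+ i. ennreal (if i \<in> S then exp (\<theta> i) / (\<Sum>v\<in>S. exp (\<theta> v)) else 0) \<partial>count_space UNIV) =
      (\<Sum>i\<in>S. ennreal (if i \<in> S then exp (\<theta> i) / (\<Sum>v\<in>S. exp (\<theta> v)) else 0))"
    by (rule nn_integral_count_space'[OF assms(1)]) auto
  also have "\<dots> = (\<Sum>i\<in>S. ennreal (exp (\<theta> i) / (\<Sum>v\<in>S. exp (\<theta> v))))"
    by (rule sum.cong) auto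
  also have "\<dots> = ennreal (\<Sum>i\<in>S. exp (\<theta> i) / (\<Sum>v\<in>S. exp (\<theta> v)))"
    by (intro sum_ennreal divide_nonneg_nonneg sum_nonneg) auto
  also have "(\<Sum>i\<in>S. exp (\<theta> i) / (\<Sum>v\<in>S. exp (\<theta> v))) = 1"
    using Z by (simp flip: sum_divide_distrib)
  finally show "(\<integral>\<^sup>+ i. ennreal (if i \<in> S then exp (\<theta> i) / (\<Sum>v\<in>S. exp (\<theta> v)) else 0) \<partial>count_space UNIV) = 1"
    by simp
qed

lemma pmf_obs_pmf:
  assumes "finite S" "card S \<ge> 2"
  shows "pmf (obs_pmf \<theta> S) (y, z) =
    (if y \<in> S \<and> z \<in> S \<and> y \<noteq> z then exp (\<theta> y) / ((\<Sum>v\<in>S. exp (\<theta> v)) * (real (card S) - 1)) else 0)"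
proof -
  have S: "S \<noteq> {}" using assms by auto
  have ne: "S - {y'} \<noteq> {}" if "y' \<in> S" for y'
  proof
    assume "S - {y'} = {}"
    hence "S = {y'}" using that by auto
    thus False using assms(2) by simp
  qed
  have sub: "set_pmf (luce_pmf \<theta> S) \<subseteq> S"
    by (auto simp: set_pmf_eq pmf_luce_pmf[OF assms(1) S] split: if_splits)
  have "obs_pmf \<theta> S = luce_pmf \<theta> S \<bind> (\<lambda>y. map_pmf (Pair y) (pmf_of_set (S - {y})))"
    by (simp add: obs_pmf_def map_pmf_def)
  hence "pmf (obs_pmf \<theta> S) (y, z) =
      measure_pmf.expectation (luce_pmf \<theta> S) (\<lambda>y'. pmf (map_pmf (Pair y') (pmf_of_set (S - {y'}))) (y, z))"
    by (simp add: pmf_bind)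
  also have "\<dots> = (\<Sum>y'\<in>S. pmf (luce_pmf \<theta> S) y' * pmf (map_pmf (Pair y') (pmf_of_set (S - {y'}))) (y, z))"
    using sub by (subst integral_measure_pmf[OF assms(1)]) auto
  also have "\<dots> = (\<Sum>y'\<in>S. if y' = y then pmf (luce_pmf \<theta> S) y * pmf (pmf_of_set (S - {y})) z else 0)"
  proof (intro sum.cong refl)
    fix y' assume "y' \<in> S"
    have "pmf (map_pmf (Pair y') (pmf_of_set (S - {y'}))) (y, z) =
        (if y' = y then pmf (pmf_of_set (S - {y})) z else 0)"
    proof (cases "y' = y")
      case True
      thus ?thesis by (simp add: pmf_map_inj' inj_on_def)
    next
      case False
      hence "(y, z) \<notin> set_pmf (map_pmf (Pair y') (pmf_of_set (S - {y'})))" by auto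
      hence "pmf (map_pmf (Pair y') (pmf_of_set (S - {y'}))) (y, z) = 0" unfolding set_pmf_iff by blast
      thus ?thesis using False by simp
    qed
    thus "pmf (luce_pmf \<theta> S) y' * pmf (map_pmf (Pair y') (pmf_of_set (S - {y'}))) (y, z) =
        (if y' = y then pmf (luce_pmf \<theta> S) y * pmf (pmf_of_set (S - {y})) z else 0)" by simp
  qed
  also have "\<dots> = (if y \<in> S then pmf (luce_pmf \<theta> S) y * pmf (pmf_of_set (S - {y})) z else 0)"
    using assms(1) by simp
  also have "\<dots> = (if y \<in> S \<and> z \<in> S \<and> y \<noteq> z
      then exp (\<theta> y) / ((\<Sum>v\<in>S. exp (\<theta> v)) * (real (card S) - 1)) else 0)"
  proof (cases "y \<in> S")
    case True
    have "real (card (S - {y})) = real (card S) - 1" using True assms by (simp add: card_Diff_singleton)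
    thus ?thesis
      using True ne[OF True] assms by (auto simp: pmf_luce_pmf[OF assms(1) S] pmf_of_set indicator_def)
  qed simp
  finally show ?thesis .
qed

lemma set_pmf_obs_pmf:
  assumes "finite S" "card S \<ge> 2"
  shows "set_pmf (obs_pmf \<theta> S) \<subseteq> {(y, z). y \<in> S \<and> z \<in> S \<and> y \<noteq> z}"
  using pmf_obs_pmf[OF assms, of \<theta>] by (auto simp: set_pmf_eq split: if_splits)

lemma finite_set_pmf_obs_pmf:
  assumes "finite S" "card S \<ge> 2"
  shows "finite (set_pmf (obs_pmf \<theta> S))"
  by (rule finite_subset[OF set_pmf_obs_pmf[OF assms]])
    (use assms(1) in \<open>auto intro: finite_subset[of _ "S \<times> S"]\<close>)

lemma expectation_obs_pmf:
  fixes f :: "nat \<times> nat \<Rightarrow> real"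
  assumes "finite S" "card S \<ge> 2"
  shows "measure_pmf.expectation (obs_pmf \<theta> S) f = (\<Sum>y\<in>S. \<Sum>z\<in>S. pmf (obs_pmf \<theta> S) (y, z) * f (y, z))"
proof -
  have "measure_pmf.expectation (obs_pmf \<theta> S) f = (\<Sum>w\<in>S \<times> S. pmf (obs_pmf \<theta> S) w * f w)"
    using set_pmf_obs_pmf[OF assms, of \<theta>] assms(1) by (subst integral_measure_pmf[of "S \<times> S"]) auto
  thus ?thesis by (simp add: sum.cartesian_product)
qed

lemma pmf_flip_pmf:
  assumes "y \<noteq> z"
  shows "pmf (flip_pmf \<theta> (y, z)) w =
    (if w = (y, z) then sig (\<theta> y - \<theta> z) else if w = (z, y) then sig (\<theta> z - \<theta> y) else 0)"
proof -
  let ?f = "\<lambda>c. if c then (y, z) else prod.swap (y, z)"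
  have p: "0 \<le> sig x" "sig x \<le> 1" for x using sig_pos[of x] sig_less_1[of x] by auto
  have "pmf (flip_pmf \<theta> (y, z)) w = measure_pmf.prob (bernoulli_pmf (sig (\<theta> y - \<theta> z))) (?f -` {w})"
    by (simp add: flip_pmf_def pmf_map)
  also have "?f -` {w} = (if w = (y, z) then {True} else if w = (z, y) then {False} else {})"
    using assms by (auto split: if_splits)
  also have "measure_pmf.prob (bernoulli_pmf (sig (\<theta> y - \<theta> z))) \<dots> =
      (if w = (y, z) then sig (\<theta> y - \<theta> z) else if w = (z, y) then sig (\<theta> z - \<theta> y) else 0)"
    using p sig_minus[of "\<theta> y - \<theta> z"] by (simp add: measure_pmf_single)
  finally show ?thesis .
qed

text \<open>Conditionally on the unordered pair, the winner follows a Bradley--Terry model, so the law of an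
  observation is invariant under re-drawing its orientation.\<close>

lemma obs_pmf_flip:
  assumes "finite S" "card S \<ge> 2"
  shows "obs_pmf \<theta> S \<bind> flip_pmf \<theta> = obs_pmf \<theta> S"
proof (rule pmf_eqI)
  fix w :: "nat \<times> nat"
  obtain y z where w: "w = (y, z)" by fastforce
  define Z where "Z = (\<Sum>v\<in>S. exp (\<theta> v)) * (real (card S) - 1)"
  have P: "pmf (obs_pmf \<theta> S) (i, j) = (if i \<in> S \<and> j \<in> S \<and> i \<noteq> j then exp (\<theta> i) / Z else 0)" for i j
    by (simp add: pmf_obs_pmf[OF assms] Z_def)
  have "pmf (obs_pmf \<theta> S \<bind> flip_pmf \<theta>) w =
      (\<Sum>i\<in>S. \<Sum>j\<in>S. pmf (obs_pmf \<theta> S) (i, j) * pmf (flip_pmf \<theta> (i, j)) (y, z))"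
    unfolding w pmf_bind by (rule expectation_obs_pmf[OF assms])
  also have "\<dots> = (\<Sum>i\<in>S. \<Sum>j\<in>S. if i = y \<and> j = z then pmf (obs_pmf \<theta> S) (y, z) * sig (\<theta> y - \<theta> z) else
      if i = z \<and> j = y then pmf (obs_pmf \<theta> S) (z, y) * sig (\<theta> y - \<theta> z) else 0)"
  proof (intro sum.cong refl)
    fix i j
    show "pmf (obs_pmf \<theta> S) (i, j) * pmf (flip_pmf \<theta> (i, j)) (y, z) =
      (if i = y \<and> j = z then pmf (obs_pmf \<theta> S) (y, z) * sig (\<theta> y - \<theta> z) else
        if i = z \<and> j = y then pmf (obs_pmf \<theta> S) (z, y) * sig (\<theta> y - \<theta> z) else 0)"
    proof (cases "i = j")
      case True
      thus ?thesis by (simp add: P)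
    next
      case False
      thus ?thesis unfolding pmf_flip_pmf[OF False] by force
    qed
  qed
  also have "\<dots> = pmf (obs_pmf \<theta> S) w"
  proof (cases "y \<in> S \<and> z \<in> S \<and> y \<noteq> z")
    case True
    have "(\<Sum>i\<in>S. \<Sum>j\<in>S. if i = y \<and> j = z then pmf (obs_pmf \<theta> S) (y, z) * sig (\<theta> y - \<theta> z) else
        if i = z \<and> j = y then pmf (obs_pmf \<theta> S) (z, y) * sig (\<theta> y - \<theta> z) else 0) =
      (\<Sum>i\<in>S. \<Sum>j\<in>S. if j = z then if i = y then pmf (obs_pmf \<theta> S) (y, z) * sig (\<theta> y - \<theta> z) else 0 else 0) +
      (\<Sum>i\<in>S. \<Sum>j\<in>S. if j = y then if i = z then pmf (obs_pmf \<theta> S) (z, y) * sig (\<theta> y - \<theta> z) else 0 else 0)"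
      unfolding sum.distrib[symmetric] using True by (intro sum.cong refl) auto
    also have "\<dots> = (exp (\<theta> y) / Z + exp (\<theta> z) / Z) * sig (\<theta> y - \<theta> z)"
      using True assms(1) by (simp add: P algebra_simps)
    also have "\<dots> = exp (\<theta> y) / Z"
    proof -
      have "exp (\<theta> y) + exp (\<theta> z) > 0" by (simp add: add_pos_pos)
      thus ?thesis by (simp add: sig_diff flip: add_divide_distrib)
    qed
    finally show ?thesis using True by (simp add: w P)
  next
    case False
    thus ?thesis by (auto simp: w P intro!: sum.neutral)
  qed
  finally show "pmf (obs_pmf \<theta> S \<bind> flip_pmf \<theta>) w = pmf (obs_pmf \<theta> S) w" .
qed

text \<open>Writing the sample as a sample followed by independent redraws of all orientations
  allows conditioning on the unordered pairs by fixing the first stage.\<close>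

lemma sample_pmf_flip:
  assumes "\<And>t. t < m \<Longrightarrow> finite (S t) \<and> card (S t) \<ge> 2"
  shows "sample_pmf m S \<theta> = sample_pmf m S \<theta> \<bind> (\<lambda>\<omega>. Pi_pmf {..<m} (0, 0) (\<lambda>t. flip_pmf \<theta> (\<omega> t)))"
proof -
  have "sample_pmf m S \<theta> = Pi_pmf {..<m} (0, 0) (\<lambda>t. obs_pmf \<theta> (S t) \<bind> flip_pmf \<theta>)"
    unfolding sample_pmf_def by (rule Pi_pmf_cong) (use assms obs_pmf_flip in auto)
  also have "\<dots> = sample_pmf m S \<theta> \<bind> (\<lambda>\<omega>. Pi_pmf {..<m} (0, 0) (\<lambda>t. flip_pmf \<theta> (\<omega> t)))"
    unfolding sample_pmf_def by (rule Pi_pmf_bind) simp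
  finally show ?thesis .
qed

text \<open>Joining the two orientations of a pair adds their weights to \<open>p + q\<close>, which
  cancels one denominator of \<open>dsig\<close> and leaves
  \<open>p * q / (p + q) \<ge> exp (- b) / 2\<close>. With \<open>Z \<le> k * exp b\<close> only a
  factor \<open>exp (- (2 * b))\<close> is lost in total.\<close>

lemma expected_hessian_lower_bound:
  assumes "finite S" "card S \<ge> 2" and bound: "\<And>i. i \<in> S \<Longrightarrow> \<bar>\<theta> i\<bar> \<le> b"
  shows "measure_pmf.expectation (obs_pmf \<theta> S) (\<lambda>(y, z). dsig (\<theta> y - \<theta> z) * (x y - x z)\<^sup>2) \<ge>
    exp (- (2 * b)) / (4 * real (card S) * (real (card S) - 1)) * (\<Sum>y\<in>S. \<Sum>z\<in>S. (x y - x z)\<^sup>2)"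
proof -
  define k where "k = real (card S)"
  define Z where "Z = (\<Sum>v\<in>S. exp (\<theta> v))"
  have k: "k \<ge> 2" using assms(2) by (simp add: k_def)
  have S: "S \<noteq> {}" using assms(2) by auto
  have Zpos: "Z > 0" unfolding Z_def using assms(1) S by (intro sum_pos) auto
  have "Z \<le> (\<Sum>v\<in>S. exp b)" unfolding Z_def using bound by (intro sum_mono) (auto simp: abs_le_iff)
  hence Zle: "Z \<le> k * exp b" by (simp add: k_def)
  define f where "f y z = (if y = z then 0 else exp (\<theta> y) / (Z * (k - 1)) * (dsig (\<theta> y - \<theta> z) * (x y - x z)\<^sup>2))" for y z
  have "measure_pmf.expectation (obs_pmf \<theta> S) (\<lambda>(y, z). dsig (\<theta> y - \<theta> z) * (x y - x z)\<^sup>2) = (\<Sum>y\<in>S. \<Sum>z\<in>S. f y z)"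
    unfolding expectation_obs_pmf[OF assms(1,2)]
    by (intro sum.cong refl) (simp add: pmf_obs_pmf[OF assms(1,2)] f_def Z_def k_def)
  also have "\<dots> = (\<Sum>y\<in>S. \<Sum>z\<in>S. (f y z + f z y) / 2)"
    using sum.swap[of f S S] by (simp add: sum.distrib add_divide_distrib sum_divide_distrib[symmetric])
  also have "\<dots> \<ge> (\<Sum>y\<in>S. \<Sum>z\<in>S. exp (- (2 * b)) / (4 * k * (k - 1)) * (x y - x z)\<^sup>2)"
  proof (intro sum_mono)
    fix y z assume yz: "y \<in> S" "z \<in> S"
    define p where "p = exp (\<theta> y)"
    define q where "q = exp (\<theta> z)"
    have pq: "p > 0" "q > 0" by (simp_all add: p_def q_def)
    have pb: "p \<ge> exp (- b)" "q \<ge> exp (- b)" using bound[OF yz(1)] bound[OF yz(2)]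
      by (auto simp: p_def q_def abs_le_iff)
    have d: "dsig (\<theta> y - \<theta> z) = p * q / (p + q)\<^sup>2" "dsig (\<theta> z - \<theta> y) = p * q / (p + q)\<^sup>2"
    proof -
      have "p + q > 0" using pq by simp
      thus "dsig (\<theta> y - \<theta> z) = p * q / (p + q)\<^sup>2"
        by (simp add: dsig_def sig_diff p_def q_def power2_eq_square divide_simps)
      moreover have "dsig (\<theta> z - \<theta> y) = dsig (\<theta> y - \<theta> z)" using dsig_minus[of "\<theta> y - \<theta> z"] by simp
      ultimately show "dsig (\<theta> z - \<theta> y) = p * q / (p + q)\<^sup>2" by simp
    qed
    have harm: "p * q / (p + q) \<ge> exp (- b) / 2"
    proof -
      have "exp (- b) * p \<le> q * p" using pb pq by (intro mult_right_mono) auto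
      moreover have "exp (- b) * q \<le> p * q" using pb pq by (intro mult_right_mono) auto
      ultimately have "exp (- b) * (p + q) \<le> 2 * (p * q)" by (simp add: algebra_simps)
      thus ?thesis using pq by (simp add: pos_le_divide_eq)
    qed
    show "exp (- (2 * b)) / (4 * k * (k - 1)) * (x y - x z)\<^sup>2 \<le> (f y z + f z y) / 2"
    proof (cases "y = z")
      case False
      have "(f y z + f z y) / 2 = (p / (Z * (k - 1)) * (p * q / (p + q)\<^sup>2 * (x y - x z)\<^sup>2) +
          q / (Z * (k - 1)) * (p * q / (p + q)\<^sup>2 * (x y - x z)\<^sup>2)) / 2"
        using False by (simp add: f_def d p_def[symmetric] q_def[symmetric] power2_commute[of "x z"])
      also have "\<dots> = (p + q) * (p * q / (p + q)\<^sup>2) / (2 * Z * (k - 1)) * (x y - x z)\<^sup>2"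
      proof -
        have "(p / N * (g * W) + q / N * (g * W)) / 2 = (p + q) * g / (2 * N) * W" for N g W :: real
          by (simp add: add_divide_distrib distrib_right)
        thus ?thesis by (simp only: mult.assoc)
      qed
      also have "(p + q) * (p * q / (p + q)\<^sup>2) = p * q / (p + q)"
        using pq by (simp add: power2_eq_square)
      finally have fz: "(f y z + f z y) / 2 = p * q / (p + q) / (2 * Z * (k - 1)) * (x y - x z)\<^sup>2" .
      have "p * q / (p + q) / (2 * Z * (k - 1)) \<ge> (exp (- b) / 2) / (2 * (k * exp b) * (k - 1))"
      proof (rule frac_le[OF _ harm])
        show "2 * Z * (k - 1) \<le> 2 * (k * exp b) * (k - 1)"
          using Zle k by (intro mult_right_mono mult_left_mono) auto
      qed (use pq Zpos k in auto)
      hence ge: "p * q / (p + q) / (2 * Z * (k - 1)) * (x y - x z)\<^sup>2 \<ge>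
          (exp (- b) / 2) / (2 * (k * exp b) * (k - 1)) * (x y - x z)\<^sup>2"
        by (intro mult_right_mono) auto
      have eq: "(exp (- b) / 2) / (2 * (k * exp b) * (k - 1)) = exp (- (2 * b)) / (4 * k * (k - 1))"
      proof -
        have "exp (- (2 * b)) = exp (- b) / exp b" by (simp flip: exp_diff)
        thus ?thesis by (simp add: mult_ac)
      qed
      show ?thesis using ge unfolding fz eq .
    qed (simp add: f_def)
  qed
  finally show ?thesis unfolding sum_distrib_left k_def .
qed

section \<open>Concentration of the score\<close>

definition dvec :: "nat \<times> nat \<Rightarrow> nat \<Rightarrow> real" where
  "dvec w l = of_bool (l = fst w) - of_bool (l = snd w)"

definition hess :: "nat \<Rightarrow> (nat \<Rightarrow> real) \<Rightarrow> (nat \<Rightarrow> nat \<times> nat) \<Rightarrow> nat \<Rightarrow> nat \<Rightarrow> real" where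
  "hess m \<theta> \<omega> l j = (\<Sum>t<m. dsig (\<theta> (fst (\<omega> t)) - \<theta> (snd (\<omega> t))) * (dvec (\<omega> t) l * dvec (\<omega> t) j))"

text \<open>The quadratic form of \<open>hess\<close> in coordinates, free of the index set: a
  weighted graph Laplacian form whose edges are the compared pairs.\<close>

definition hess_form :: "nat \<Rightarrow> (nat \<Rightarrow> real) \<Rightarrow> (nat \<Rightarrow> nat \<times> nat) \<Rightarrow> (nat \<Rightarrow> real) \<Rightarrow> real" where
  "hess_form m \<theta> \<omega> x = (\<Sum>t<m. dsig (\<theta> (fst (\<omega> t)) - \<theta> (snd (\<omega> t))) * (x (fst (\<omega> t)) - x (snd (\<omega> t)))\<^sup>2)"

text \<open>The derivative of \<open>loglik1\<close> at \<open>\<theta>\<close> in the direction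
  \<open>x\<close>.\<close>

definition score :: "nat \<Rightarrow> (nat \<Rightarrow> real) \<Rightarrow> (nat \<Rightarrow> nat \<times> nat) \<Rightarrow> (nat \<Rightarrow> real) \<Rightarrow> real" where
  "score m \<theta> \<omega> x = (\<Sum>t<m. (1 - sig (\<theta> (fst (\<omega> t)) - \<theta> (snd (\<omega> t)))) * (x (fst (\<omega> t)) - x (snd (\<omega> t))))"

lemma ip_dvec:
  assumes "finite I" "fst w \<in> I" "snd w \<in> I"
  shows "ip I (dvec w) x = x (fst w) - x (snd w)"
  using assms by (simp add: ip_def dvec_def left_diff_distrib sum_subtractf)

lemma hess_symmetric: "symmetric_on I (hess m \<theta> \<omega>)"
  by (simp add: symmetric_on_def hess_def mult.commute)

lemma hess_bilinear:
  assumes "finite I" "\<And>t. t < m \<Longrightarrow> fst (\<omega> t) \<in> I \<and> snd (\<omega> t) \<in> I"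
  shows "ip I y (mv I (hess m \<theta> \<omega>) z) = (\<Sum>t<m. dsig (\<theta> (fst (\<omega> t)) - \<theta> (snd (\<omega> t))) *
    ((y (fst (\<omega> t)) - y (snd (\<omega> t))) * (z (fst (\<omega> t)) - z (snd (\<omega> t)))))"
  unfolding hess_def[abs_def] ip_mv_rank_one_sum
  using assms by (intro sum.cong refl) (simp add: ip_dvec)

lemma hess_quadratic_form:
  assumes "finite I" "\<And>t. t < m \<Longrightarrow> fst (\<omega> t) \<in> I \<and> snd (\<omega> t) \<in> I"
  shows "ip I y (mv I (hess m \<theta> \<omega>) y) = hess_form m \<theta> \<omega> y"
  using hess_bilinear[where y = y and z = y and \<theta> = \<theta>] assms by (simp add: hess_form_def power2_eq_square)

text \<open>Each difference of coordinates of \<open>x\<close> is an inner product with an edge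
  vector \<open>dvec\<close>, to which Parseval's identity applies.\<close>

lemma score_eigen_expansion:
  assumes "finite I" "eigensystem I A a u" "\<And>t. t < m \<Longrightarrow> fst (\<omega> t) \<in> I \<and> snd (\<omega> t) \<in> I"
  shows "score m \<theta> \<omega> x = (\<Sum>i\<in>I. score m \<theta> \<omega> (u i) * ip I (u i) x)"
proof -
  define c where "c t = 1 - sig (\<theta> (fst (\<omega> t)) - \<theta> (snd (\<omega> t)))" for t
  have "(\<Sum>i\<in>I. score m \<theta> \<omega> (u i) * ip I (u i) x) =
      (\<Sum>i\<in>I. \<Sum>t<m. c t * ((u i (fst (\<omega> t)) - u i (snd (\<omega> t))) * ip I (u i) x))"
    by (simp add: score_def c_def sum_distrib_right mult.assoc)
  also have "\<dots> = (\<Sum>t<m. c t * (\<Sum>i\<in>I. (u i (fst (\<omega> t)) - u i (snd (\<omega> t))) * ip I (u i) x))"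
    by (subst sum.swap) (simp add: sum_distrib_left)
  also have "\<dots> = (\<Sum>t<m. c t * (\<Sum>i\<in>I. ip I (u i) (dvec (\<omega> t)) * ip I (u i) x))"
    using assms(1,3) by (intro sum.cong refl) (simp add: ip_dvec ip_commute[of I _ "dvec _"])
  also have "\<dots> = score m \<theta> \<omega> x"
    unfolding eigensystem_parseval[OF assms(1,2)] score_def c_def
    using assms(1,3) by (intro sum.cong refl) (simp add: ip_dvec)
  finally show ?thesis ..
qed

text \<open>An eigenvector with nonzero eigenvalue is orthogonal to the ones vector, so the gap
  applies to it. One with eigenvalue zero stays in the kernel after subtraction of its mean, where
  the gap makes it vanish; hence it is constant.\<close>

lemma eigensystem_kernel_ones:
  assumes "finite I" "I \<noteq> {}" "symmetric_on I A" "eigensystem I A a u"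
    and ker: "\<And>l. l \<in> I \<Longrightarrow> mv I A (\<lambda>_. 1) l = 0"
    and gap: "\<And>x. ip I (\<lambda>_. 1) x = 0 \<Longrightarrow> ip I x (mv I A x) \<ge> h * ip I x x" and "h > 0"
    and i: "i \<in> I"
  shows "a i \<noteq> 0 \<Longrightarrow> a i \<ge> h"
    and "a i = 0 \<Longrightarrow> ip I (\<lambda>_. 1) x = 0 \<Longrightarrow> ip I (u i) x = 0"
proof -
  have a1: "a i * ip I (u i) (\<lambda>_. 1) = 0"
  proof -
    have "a i * ip I (u i) (\<lambda>_. 1) = ip I (u i) (mv I A (\<lambda>_. 1))"
      using eigensystem_ip_mv[OF assms(3,4) i] by simp
    also have "\<dots> = ip I (u i) (\<lambda>_. 0)" by (rule ip_cong) (auto simp: ker)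
    finally show ?thesis by (simp add: ip_def)
  qed
  show "a i \<ge> h" if "a i \<noteq> 0"
  proof -
    have "ip I (\<lambda>_. 1) (u i) = 0" using a1 that by (simp add: ip_commute)
    thus ?thesis
      using gap[of "u i"] eigensystem_eigenvalue[OF assms(4) i] eigensystemD(1)[OF assms(4) i i] by simp
  qed
  show "ip I (u i) x = 0" if a0: "a i = 0" and x: "ip I (\<lambda>_. 1) x = 0"
  proof -
    define c where "c = ip I (\<lambda>_. 1) (u i) / card I"
    define w where "w l = u i l - c * 1" for l
    have "card I \<noteq> 0" using assms(1,2) by simp
    hence w1: "ip I (\<lambda>_. 1) w = 0"
      unfolding w_def[abs_def] ip_diff_right ip_scale_right by (simp add: c_def) (simp add: ip_def)
    have "mv I A w l = 0" if "l \<in> I" for l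
      unfolding w_def[abs_def] mv_diff mv_scale using ker[OF that] eigensystemD(3)[OF assms(4) i that] a0 by simp
    hence "ip I w (mv I A w) = ip I w (\<lambda>_. 0)" by (intro ip_cong) auto
    hence "h * ip I w w \<le> 0" using gap[OF w1] by (simp add: ip_def)
    hence "ip I w w = 0"
      using ip_self_nonneg[of I w] \<open>h > 0\<close> by (simp add: mult_le_0_iff)
    hence "\<forall>l\<in>I. u i l = c * 1" using assms(1) by (simp add: ip_self_eq_0 w_def)
    hence "ip I (u i) x = ip I (\<lambda>l. c * 1) x" by (intro ip_cong) auto
    also have "\<dots> = c * ip I (\<lambda>_. 1) x" by (rule ip_scale_left)
    finally show ?thesis using x by simp
  qed
qed

text \<open>A redrawn summand is \<open>(1 - s) * e\<close> with probability \<open>s\<close> and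
  \<open>- s * e\<close> otherwise: it is centred with variance
  \<open>s * (1 - s) * e\<^sup>2\<close>. The assumption \<open>quad\<close> keeps the constant
  \<kappa> of the Bernstein bound open.\<close>

lemma flip_pmf_mgf:
  assumes "\<kappa> \<ge> 0" and quad: "\<And>x. \<bar>x\<bar> \<le> r \<Longrightarrow> exp x \<le> 1 + x + \<kappa> * x\<^sup>2"
    and "fst w \<noteq> snd w" and c: "\<bar>\<eta> * (x (fst w) - x (snd w))\<bar> \<le> r"
  shows "measure_pmf.expectation (flip_pmf \<theta> w)
      (\<lambda>v. exp (\<eta> * ((1 - sig (\<theta> (fst v) - \<theta> (snd v))) * (x (fst v) - x (snd v))))) \<le>
    exp (\<kappa> * \<eta>\<^sup>2 * (dsig (\<theta> (fst w) - \<theta> (snd w)) * (x (fst w) - x (snd w))\<^sup>2))"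
proof -
  define s where "s = sig (\<theta> (fst w) - \<theta> (snd w))"
  define e where "e = \<eta> * (x (fst w) - x (snd w))"
  have s: "0 \<le> s" "s \<le> 1" using sig_pos sig_less_1 by (simp_all add: s_def less_imp_le)
  have s': "sig (\<theta> (snd w) - \<theta> (fst w)) = 1 - s"
    using sig_minus[of "\<theta> (fst w) - \<theta> (snd w)"] by (simp add: s_def)
  have er: "\<bar>e\<bar> \<le> r" using c by (simp add: e_def)
  have "\<bar>(1 - s) * e\<bar> \<le> r" "\<bar>- s * e\<bar> \<le> r"
    using s er mult_left_le_one_le[of "\<bar>e\<bar>" "1 - s"] mult_left_le_one_le[of "\<bar>e\<bar>" s] by (auto simp: abs_mult)
  note q = quad[OF this(1)] quad[OF this(2)]
  have "measure_pmf.expectation (flip_pmf \<theta> w)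
      (\<lambda>v. exp (\<eta> * ((1 - sig (\<theta> (fst v) - \<theta> (snd v))) * (x (fst v) - x (snd v))))) =
    s * exp ((1 - s) * e) + (1 - s) * exp (- s * e)"
    using s s' unfolding flip_pmf_def integral_map_pmf s_def[symmetric]
    by (simp add: integral_bernoulli_pmf s_def[symmetric]) (simp add: e_def algebra_simps)
  also have "\<dots> \<le> s * (1 + (1 - s) * e + \<kappa> * ((1 - s) * e)\<^sup>2) + (1 - s) * (1 + - s * e + \<kappa> * (- s * e)\<^sup>2)"
    using s q by (intro add_mono mult_left_mono) auto
  also have "\<dots> = 1 + \<kappa> * (s * (1 - s) * e\<^sup>2)"
    by (simp add: power2_eq_square algebra_simps)
  also have "\<dots> \<le> exp (\<kappa> * (s * (1 - s) * e\<^sup>2))" by simp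
  finally show ?thesis by (simp add: dsig_def s_def[symmetric] e_def power_mult_distrib mult_ac)
qed

lemma finite_set_Pi_pmf:
  assumes "finite A" "\<And>t. t \<in> A \<Longrightarrow> finite (set_pmf (p t))"
  shows "finite (set_pmf (Pi_pmf A d p))"
  using assms by (subst set_Pi_pmf) (auto intro!: finite_PiE_dflt)

lemma pmf_markov:
  assumes "finite (set_pmf p)" "\<And>w. w \<in> set_pmf p \<Longrightarrow> f w \<ge> 0" "\<And>w. w \<in> set_pmf p \<Longrightarrow> w \<in> E \<Longrightarrow> f w \<ge> 1"
  shows "measure_pmf.prob p E \<le> measure_pmf.expectation p f"
proof -
  have "measure_pmf.prob p E = measure_pmf.expectation p (indicator E)" by simp
  also have "\<dots> \<le> measure_pmf.expectation p f"
    using assms by (intro integral_mono_AE integrable_measure_pmf_finite)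
      (auto simp: AE_measure_pmf_iff indicator_def)
  finally show ?thesis .
qed

text \<open>Exponential Markov inequality: independence factorizes the moment generating function,
  and the variances of the summands add up to \<open>hess_form\<close>.\<close>

lemma score_tail_one_sided:
  assumes "\<kappa> \<ge> 0" and quad: "\<And>x. \<bar>x\<bar> \<le> r \<Longrightarrow> exp x \<le> 1 + x + \<kappa> * x\<^sup>2"
    and w: "\<And>t. t < m \<Longrightarrow> fst (\<omega>0 t) \<noteq> snd (\<omega>0 t)"
    and c: "\<And>t. t < m \<Longrightarrow> \<bar>\<eta> * (x (fst (\<omega>0 t)) - x (snd (\<omega>0 t)))\<bar> \<le> r" and "\<eta> \<ge> 0"
  shows "measure_pmf.prob (Pi_pmf {..<m} (0, 0) (\<lambda>t. flip_pmf \<theta> (\<omega>0 t))) {\<omega>. score m \<theta> \<omega> x \<ge> s} \<le>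
    exp (\<kappa> * \<eta>\<^sup>2 * hess_form m \<theta> \<omega>0 x - \<eta> * s)"
proof -
  let ?P = "Pi_pmf {..<m} (0, 0) (\<lambda>t. flip_pmf \<theta> (\<omega>0 t))"
  define f where "f v = exp (\<eta> * ((1 - sig (\<theta> (fst v) - \<theta> (snd v))) * (x (fst v) - x (snd v))))" for v
  have fin1: "finite (set_pmf (flip_pmf \<theta> v))" for v by (simp add: flip_pmf_def)
  have fin: "finite (set_pmf ?P)" by (rule finite_set_Pi_pmf) (simp_all add: fin1)
  have "measure_pmf.prob ?P {\<omega>. score m \<theta> \<omega> x \<ge> s} \<le>
      measure_pmf.expectation ?P (\<lambda>\<omega>. exp (\<eta> * (score m \<theta> \<omega> x - s)))"
    using \<open>\<eta> \<ge> 0\<close> by (intro pmf_markov[OF fin]) auto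
  also have "(\<lambda>\<omega>. exp (\<eta> * (score m \<theta> \<omega> x - s))) = (\<lambda>\<omega>. exp (- \<eta> * s) * (\<Prod>t<m. f (\<omega> t)))"
    by (rule ext) (simp add: score_def f_def sum_distrib_left right_diff_distrib flip: exp_sum exp_add)
  also have "measure_pmf.expectation ?P (\<lambda>\<omega>. exp (- \<eta> * s) * (\<Prod>t<m. f (\<omega> t))) =
      exp (- \<eta> * s) * (\<Prod>t<m. measure_pmf.expectation (flip_pmf \<theta> (\<omega>0 t)) f)"
    by (subst integral_mult_right_zero, subst expectation_prod_Pi_pmf)
      (auto intro!: integrable_measure_pmf_finite fin1 simp: f_def)
  also have "\<dots> \<le> exp (- \<eta> * s) * (\<Prod>t<m. exp (\<kappa> * \<eta>\<^sup>2 *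
      (dsig (\<theta> (fst (\<omega>0 t)) - \<theta> (snd (\<omega>0 t))) * (x (fst (\<omega>0 t)) - x (snd (\<omega>0 t)))\<^sup>2)))"
  proof (intro mult_left_mono prod_mono conjI)
    fix t assume "t \<in> {..<m}"
    thus "measure_pmf.expectation (flip_pmf \<theta> (\<omega>0 t)) f \<le> exp (\<kappa> * \<eta>\<^sup>2 *
      (dsig (\<theta> (fst (\<omega>0 t)) - \<theta> (snd (\<omega>0 t))) * (x (fst (\<omega>0 t)) - x (snd (\<omega>0 t)))\<^sup>2))"
      unfolding f_def using w c by (intro flip_pmf_mgf[OF \<open>\<kappa> \<ge> 0\<close> quad]) auto
    show "0 \<le> measure_pmf.expectation (flip_pmf \<theta> (\<omega>0 t)) f"
      by (rule integral_nonneg_AE) (simp add: f_def)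
  qed simp
  also have "\<dots> = exp (\<kappa> * \<eta>\<^sup>2 * hess_form m \<theta> \<omega>0 x - \<eta> * s)"
    by (simp add: hess_form_def sum_distrib_left flip: exp_sum exp_add)
  finally show ?thesis .
qed

lemma score_uminus: "score m \<theta> \<omega> (\<lambda>l. - x l) = - score m \<theta> \<omega> x"
  by (simp add: score_def sum_negf[symmetric] algebra_simps)

lemma hess_form_uminus: "hess_form m \<theta> \<omega> (\<lambda>l. - x l) = hess_form m \<theta> \<omega> x"
  by (simp add: hess_form_def power2_commute)

text \<open>The squares of \<open>x i - x j\<close> and \<open>x i + x j\<close> add up to at most
  2.\<close>

lemma unit_vector_diff_le:
  assumes "finite I" "ip I x x = 1" "i \<in> I" "j \<in> I" "i \<noteq> j"
  shows "\<bar>x i - x j\<bar> \<le> sqrt 2"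
proof -
  have "(\<Sum>l\<in>{i, j}. x l * x l) \<le> (\<Sum>l\<in>I. x l * x l)"
    using assms by (intro sum_mono2) auto
  hence "x i * x i + x j * x j \<le> 1" using assms by (simp add: ip_def)
  moreover have "0 \<le> (x i + x j)\<^sup>2" by simp
  ultimately have "(x i - x j)\<^sup>2 \<le> 2" by (simp add: power2_eq_square algebra_simps)
  thus ?thesis using real_sqrt_le_mono by fastforce
qed

text \<open>Each coordinate of the score in the eigenbasis of the Hessian has variance equal to the
  corresponding eigenvalue; hence the Bernstein bound with the same relative width in all of them.\<close>

lemma score_tail:
  fixes K \<kappa> r h :: real
  assumes I: "finite I" "I \<noteq> {}"
    and w: "\<And>t. t < m \<Longrightarrow> fst (\<omega>0 t) \<in> I \<and> snd (\<omega>0 t) \<in> I \<and> fst (\<omega>0 t) \<noteq> snd (\<omega>0 t)"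
    and gap: "\<And>x. (\<Sum>i\<in>I. x i) = 0 \<Longrightarrow> hess_form m \<theta> \<omega>0 x \<ge> h * (\<Sum>i\<in>I. (x i)\<^sup>2)" and "h > 0"
    and "\<kappa> > 0" "K > 0" "r \<ge> 0" and K: "K \<le> r\<^sup>2 * h"
    and quad: "\<And>x. \<bar>x\<bar> \<le> r / (sqrt 2 * \<kappa>) \<Longrightarrow> exp x \<le> 1 + x + \<kappa> * x\<^sup>2"
  shows "measure_pmf.prob (Pi_pmf {..<m} (0, 0) (\<lambda>t. flip_pmf \<theta> (\<omega>0 t)))
      {\<omega>. \<exists>x. (\<Sum>i\<in>I. x i) = 0 \<and> (score m \<theta> \<omega> x)\<^sup>2 > card I * K * hess_form m \<theta> \<omega>0 x} \<le>
    2 * real (card I) * exp (- K / (4 * \<kappa>))" (is "measure_pmf.prob ?P ?E \<le> _")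
proof -
  define H where "H = hess m \<theta> \<omega>0"
  have w': "\<And>t. t < m \<Longrightarrow> fst (\<omega>0 t) \<in> I \<and> snd (\<omega>0 t) \<in> I" using w by blast
  have sym: "symmetric_on I H" unfolding H_def by (rule hess_symmetric)
  have qf: "ip I x (mv I H x) = hess_form m \<theta> \<omega>0 x" for x
    unfolding H_def by (rule hess_quadratic_form[OF I(1) w'])
  obtain a u where au: "eigensystem I H a u" by (rule eigensystem_exists[OF I(1) sym])
  have ker: "mv I H (\<lambda>_. 1) l = 0" if "l \<in> I" for l
  proof -
    have "mv I H (\<lambda>_. 1) l = ip I (\<lambda>j. of_bool (j = l)) (mv I H (\<lambda>_. 1))"
      using that I(1) by (simp add: ip_def)
    also have "\<dots> = 0" unfolding H_def by (subst hess_bilinear[OF I(1)]) (use w' in auto)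
    finally show ?thesis .
  qed
  have gap': "ip I x (mv I H x) \<ge> h * ip I x x" if "ip I (\<lambda>_. 1) x = 0" for x
    using gap[of x] that unfolding qf by (simp add: ip_def power2_eq_square)
  note ev = eigensystem_kernel_ones[OF I sym au ker gap' \<open>h > 0\<close>]
  define J where "J = {i\<in>I. a i \<noteq> 0}"
  have finJ: "finite J" using I(1) by (simp add: J_def)
  have aJ: "a i \<ge> h" "a i > 0" if "i \<in> J" for i
    using ev(1)[of i] that \<open>h > 0\<close> by (auto simp: J_def)
  define bad where "bad i = {\<omega>. (score m \<theta> \<omega> (u i))\<^sup>2 > K * a i}" for i
  have good_imp: "(score m \<theta> \<omega> x)\<^sup>2 \<le> card I * K * hess_form m \<theta> \<omega>0 x"
    if \<omega>: "\<And>t. t < m \<Longrightarrow> fst (\<omega> t) \<in> I \<and> snd (\<omega> t) \<in> I" and good: "\<And>i. i \<in> J \<Longrightarrow> \<omega> \<notin> bad i"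
      and x: "(\<Sum>i\<in>I. x i) = 0" for \<omega> x
  proof -
    have zero: "ip I (u i) x = 0" if "i \<in> I" "a i = 0" for i
      by (rule ev(2)) (use that x in \<open>simp_all add: ip_def\<close>)
    have "score m \<theta> \<omega> x = (\<Sum>i\<in>I. score m \<theta> \<omega> (u i) * ip I (u i) x)"
      by (rule score_eigen_expansion[OF I(1) au \<omega>])
    also have "\<dots> = (\<Sum>i\<in>J. score m \<theta> \<omega> (u i) * ip I (u i) x)"
      using I(1) zero by (intro sum.mono_neutral_right) (auto simp: J_def)
    \<comment> \<open>Inserting \<open>sqrt (a i)\<close> before the Cauchy-Schwarz inequality turns
      the second factor into the quadratic form of the Hessian and normalizes each score coordinate
      by its standard deviation.\<close>
    also have "\<dots> = (\<Sum>i\<in>J. (score m \<theta> \<omega> (u i) / sqrt (a i)) * (sqrt (a i) * ip I (u i) x))"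
      using aJ(2) by (intro sum.cong refl) (simp add: less_imp_neq[symmetric])
    finally have "(score m \<theta> \<omega> x)\<^sup>2 =
      (\<Sum>i\<in>J. (score m \<theta> \<omega> (u i) / sqrt (a i)) * (sqrt (a i) * ip I (u i) x))\<^sup>2" by simp
    also have "\<dots> \<le> (\<Sum>i\<in>J. (score m \<theta> \<omega> (u i) / sqrt (a i))\<^sup>2) * (\<Sum>i\<in>J. (sqrt (a i) * ip I (u i) x)\<^sup>2)"
      by (rule Cauchy_Schwarz_ineq_sum)
    also have "(\<Sum>i\<in>J. (sqrt (a i) * ip I (u i) x)\<^sup>2) = (\<Sum>i\<in>J. a i * (ip I (u i) x)\<^sup>2)"
      using aJ(2) by (intro sum.cong refl) (simp add: power_mult_distrib less_imp_le)
    also have "\<dots> = (\<Sum>i\<in>I. a i * (ip I (u i) x)\<^sup>2)"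
      using I(1) by (intro sum.mono_neutral_left) (auto simp: J_def)
    also have "\<dots> = hess_form m \<theta> \<omega>0 x"
      using eigensystem_quadratic_form[OF I(1) sym au, of x] qf[of x] by simp
    also have "(\<Sum>i\<in>J. (score m \<theta> \<omega> (u i) / sqrt (a i))\<^sup>2) * hess_form m \<theta> \<omega>0 x \<le>
        (card I * K) * hess_form m \<theta> \<omega>0 x"
    proof (rule mult_right_mono)
      have "(\<Sum>i\<in>J. (score m \<theta> \<omega> (u i) / sqrt (a i))\<^sup>2) \<le> (\<Sum>i\<in>J. K)"
      proof (rule sum_mono)
        fix i assume "i \<in> J"
        thus "(score m \<theta> \<omega> (u i) / sqrt (a i))\<^sup>2 \<le> K"
          using good[of i] aJ(2)[of i] by (simp add: bad_def power_divide pos_divide_le_eq)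
      qed
      also have "\<dots> \<le> card I * K"
        using \<open>K > 0\<close> card_mono[OF I(1), of J] by (simp add: J_def)
      finally show "(\<Sum>i\<in>J. (score m \<theta> \<omega> (u i) / sqrt (a i))\<^sup>2) \<le> card I * K" .
      show "0 \<le> hess_form m \<theta> \<omega>0 x"
        unfolding hess_form_def using dsig_pos by (intro sum_nonneg mult_nonneg_nonneg) (auto simp: less_imp_le)
    qed
    finally show ?thesis by simp
  qed
  have bad_prob: "measure_pmf.prob ?P (bad i) \<le> 2 * exp (- K / (4 * \<kappa>))" if i: "i \<in> J" for i
  proof -
    have iI: "i \<in> I" using i by (simp add: J_def)
    have hf: "hess_form m \<theta> \<omega>0 (u i) = a i"
      using eigensystem_eigenvalue[OF au iI] qf by simp
    \<comment> \<open>This value minimizes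
      \<open>\<kappa> * \<eta>\<^sup>2 * a i - \<eta> * sqrt (K * a i)\<close>. The assumption on
      \<open>K\<close> and \<open>a i \<ge> h\<close> give
      \<open>\<eta> \<le> r / (2 * \<kappa>)\<close>, so the exponents stay in the range of
      \<open>quad\<close>.\<close>
    define \<eta> where "\<eta> = sqrt (K / a i) / (2 * \<kappa>)"
    have eta: "\<eta> \<ge> 0" using \<open>K > 0\<close> \<open>\<kappa> > 0\<close> aJ(2)[OF i] by (simp add: \<eta>_def)
    have "K \<le> r\<^sup>2 * a i" using K aJ(1)[OF i] by (meson mult_left_mono order_trans zero_le_power2)
    hence "K / a i \<le> r\<^sup>2" using aJ(2)[OF i] by (simp add: pos_divide_le_eq)
    hence "sqrt (K / a i) \<le> r" using \<open>r \<ge> 0\<close> real_sqrt_le_mono by fastforce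
    hence eta_le: "\<eta> \<le> r / (2 * \<kappa>)" using \<open>\<kappa> > 0\<close> by (simp add: \<eta>_def divide_right_mono)
    have c: "\<bar>\<eta> * (v (fst (\<omega>0 t)) - v (snd (\<omega>0 t)))\<bar> \<le> r / (sqrt 2 * \<kappa>)"
      if "t < m" "ip I v v = 1" for t v
    proof -
      have "\<bar>\<eta> * (v (fst (\<omega>0 t)) - v (snd (\<omega>0 t)))\<bar> \<le> r / (2 * \<kappa>) * sqrt 2"
        unfolding abs_mult using eta eta_le w[OF that(1)] \<open>\<kappa> > 0\<close> \<open>r \<ge> 0\<close> that(2)
        by (intro mult_mono unit_vector_diff_le[OF I(1)]) auto
      also have "\<dots> = r / (sqrt 2 * \<kappa>)" using \<open>\<kappa> > 0\<close> by (simp add: field_simps)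
      finally show ?thesis .
    qed
    have unit: "ip I (u i) (u i) = 1" "ip I (\<lambda>l. - u i l) (\<lambda>l. - u i l) = 1"
      using eigensystemD(1)[OF au iI iI] by (simp_all add: ip_def)
    have expo: "\<kappa> * \<eta>\<^sup>2 * a i - \<eta> * sqrt (K * a i) = - K / (4 * \<kappa>)"
    proof -
      have "\<eta>\<^sup>2 = K / a i / (4 * \<kappa>\<^sup>2)"
        using \<open>K > 0\<close> aJ(2)[OF i] by (simp add: \<eta>_def power_divide power_mult_distrib)
      moreover have "\<eta> * sqrt (K * a i) = K / (2 * \<kappa>)"
      proof -
        have "sqrt (K / a i) * sqrt (K * a i) = sqrt (K * K)"
          using aJ(2)[OF i] by (simp flip: real_sqrt_mult)
        thus ?thesis using \<open>K > 0\<close> by (simp add: \<eta>_def)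
      qed
      ultimately show ?thesis
        using \<open>\<kappa> > 0\<close> aJ(2)[OF i] by (simp add: field_simps power2_eq_square)
    qed
    have tail: "measure_pmf.prob ?P {\<omega>. score m \<theta> \<omega> v \<ge> sqrt (K * a i)} \<le> exp (- K / (4 * \<kappa>))"
      if "ip I v v = 1" "hess_form m \<theta> \<omega>0 v = a i" for v
      using score_tail_one_sided[of \<kappa> "r / (sqrt 2 * \<kappa>)" m \<omega>0 \<eta> v \<theta> "sqrt (K * a i)"]
        quad w c[OF _ that(1)] eta \<open>\<kappa> > 0\<close> expo that(2) by (simp add: less_imp_le)
    have "bad i \<subseteq> {\<omega>. score m \<theta> \<omega> (u i) \<ge> sqrt (K * a i)} \<union> {\<omega>. score m \<theta> \<omega> (\<lambda>l. - u i l) \<ge> sqrt (K * a i)}"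
    proof
      fix \<omega> assume "\<omega> \<in> bad i"
      hence "sqrt (K * a i) < sqrt ((score m \<theta> \<omega> (u i))\<^sup>2)"
        unfolding bad_def mem_Collect_eq by (rule real_sqrt_less_mono)
      hence "sqrt (K * a i) < \<bar>score m \<theta> \<omega> (u i)\<bar>" by simp
      thus "\<omega> \<in> {\<omega>. score m \<theta> \<omega> (u i) \<ge> sqrt (K * a i)} \<union> {\<omega>. score m \<theta> \<omega> (\<lambda>l. - u i l) \<ge> sqrt (K * a i)}"
        by (auto simp: score_uminus)
    qed
    hence "measure_pmf.prob ?P (bad i) \<le>
        measure_pmf.prob ?P ({\<omega>. score m \<theta> \<omega> (u i) \<ge> sqrt (K * a i)} \<union> {\<omega>. score m \<theta> \<omega> (\<lambda>l. - u i l) \<ge> sqrt (K * a i)})"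
      by (intro measure_pmf.finite_measure_mono) auto
    also have "\<dots> \<le> measure_pmf.prob ?P {\<omega>. score m \<theta> \<omega> (u i) \<ge> sqrt (K * a i)} +
        measure_pmf.prob ?P {\<omega>. score m \<theta> \<omega> (\<lambda>l. - u i l) \<ge> sqrt (K * a i)}"
      by (rule measure_Un_le) auto
    also have "\<dots> \<le> exp (- K / (4 * \<kappa>)) + exp (- K / (4 * \<kappa>))"
      using unit hf by (intro add_mono tail) (simp_all add: hess_form_uminus)
    finally show ?thesis by simp
  qed
  have supp: "fst (\<omega> t) \<in> I \<and> snd (\<omega> t) \<in> I" if "\<omega> \<in> set_pmf ?P" "t < m" for \<omega> t
  proof -
    have "\<omega> t \<in> set_pmf (flip_pmf \<theta> (\<omega>0 t))"
      using that by (subst (asm) set_Pi_pmf) (auto simp: PiE_dflt_def)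
    thus ?thesis using w'[OF that(2)] by (auto simp: flip_pmf_def split: if_splits)
  qed
  have "\<omega> \<in> (\<Union>i\<in>J. bad i)" if \<omega>: "\<omega> \<in> set_pmf ?P" and E: "\<omega> \<in> ?E" for \<omega>
  proof (rule ccontr)
    assume "\<omega> \<notin> (\<Union>i\<in>J. bad i)"
    hence "\<And>i. i \<in> J \<Longrightarrow> \<omega> \<notin> bad i" by blast
    moreover from E obtain x where "(\<Sum>i\<in>I. x i) = 0"
      "(score m \<theta> \<omega> x)\<^sup>2 > card I * K * hess_form m \<theta> \<omega>0 x" by blast
    ultimately show False using good_imp[of \<omega> x] supp[OF \<omega>] by (meson not_less)
  qed
  hence "measure_pmf.prob ?P ?E \<le> measure_pmf.prob ?P (\<Union>i\<in>J. bad i)"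
    by (intro measure_pmf.finite_measure_mono_AE AE_pmfI) auto
  also have "\<dots> \<le> (\<Sum>i\<in>J. measure_pmf.prob ?P (bad i))"
    by (rule measure_pmf.finite_measure_subadditive_finite[OF finJ]) auto
  also have "\<dots> \<le> (\<Sum>i\<in>J. 2 * exp (- K / (4 * \<kappa>)))"
    by (intro sum_mono bad_prob)
  also have "\<dots> \<le> 2 * real (card I) * exp (- K / (4 * \<kappa>))"
    using card_mono[OF I(1), of J] by (simp add: J_def)
  finally show ?thesis .
qed

section \<open>Spectral gap of the Hessian\<close>

lemma laplacian_quadratic_form:
  fixes W :: "nat \<Rightarrow> nat \<Rightarrow> real"
  assumes "finite I" "\<And>i j. W i j = W j i"
  shows "ip I y (mv I (\<lambda>i j. (if i = j then (\<Sum>l\<in>I. W i l) else 0) - W i j) y) =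
    (\<Sum>i\<in>I. \<Sum>j\<in>I. W i j * (y i - y j)\<^sup>2) / 2"
proof -
  have "mv I (\<lambda>i j. (if i = j then (\<Sum>l\<in>I. W i l) else 0) - W i j) y i = (\<Sum>j\<in>I. W i j * (y i - y j))"
    if "i \<in> I" for i
  proof -
    have "mv I (\<lambda>i j. (if i = j then (\<Sum>l\<in>I. W i l) else 0) - W i j) y i =
        (\<Sum>j\<in>I. if i = j then (\<Sum>l\<in>I. W i l) * y j else 0) - (\<Sum>j\<in>I. W i j * y j)"
      unfolding mv_def sum_subtractf[symmetric] by (intro sum.cong refl) (simp add: left_diff_distrib)
    also have "\<dots> = (\<Sum>l\<in>I. W i l * y i) - (\<Sum>j\<in>I. W i j * y j)"
      using that assms(1) by (simp add: sum_distrib_right)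
    finally show ?thesis by (simp add: right_diff_distrib sum_subtractf)
  qed
  hence "ip I y (mv I (\<lambda>i j. (if i = j then (\<Sum>l\<in>I. W i l) else 0) - W i j) y) =
      (\<Sum>i\<in>I. \<Sum>j\<in>I. W i j * (y i * (y i - y j)))"
    unfolding ip_def by (intro sum.cong refl) (simp add: sum_distrib_left mult_ac)
  moreover have "(\<Sum>i\<in>I. \<Sum>j\<in>I. W i j * (y i * (y i - y j))) = (\<Sum>i\<in>I. \<Sum>j\<in>I. W i j * (y j * (y j - y i)))"
    by (subst sum.swap) (simp add: assms(2))
  moreover have "(\<Sum>i\<in>I. \<Sum>j\<in>I. W i j * (y i * (y i - y j))) + (\<Sum>i\<in>I. \<Sum>j\<in>I. W i j * (y j * (y j - y i))) =
      (\<Sum>i\<in>I. \<Sum>j\<in>I. W i j * (y i - y j)\<^sup>2)"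
    unfolding sum.distrib[symmetric] by (intro sum.cong refl) (simp add: power2_eq_square algebra_simps)
  ultimately show ?thesis by simp
qed

text \<open>The weight of a pair counts the sets containing it, so the Laplacian form is a sum over
  \<open>t\<close> of complete-graph forms on \<open>S t\<close>. The division by 2 is due to
  ordered pairs.\<close>

lemma comparison_laplacian_gap:
  fixes n m :: nat and S :: "nat \<Rightarrow> nat set"
  defines "lam \<equiv> lambda2 (laplacian (Mmat n m S))"
  assumes "n \<ge> 2" and S: "\<And>t. t < m \<Longrightarrow> S t \<subseteq> {1..n}" and "lam > 0" and x: "(\<Sum>i=1..n. x i) = 0"
  shows "lam * (\<Sum>i=1..n. (x i)\<^sup>2) \<le>
    real n / real m * (\<Sum>t<m. \<Sum>y\<in>S t. \<Sum>z\<in>S t. (x y - x z)\<^sup>2) / 2"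
proof -
  define W where "W i j = (if i = j then 0 else
      real n / real m * real (card {t\<in>{..<m}. {i + 1, j + 1} \<subseteq> S t}))" for i j
  define A where "A i j = (if i = j then (\<Sum>l<n. W i l) else 0) - W i j" for i j
  have Wsym: "W i j = W j i" for i j by (auto simp: W_def insert_commute)
  have lap: "laplacian (Mmat n m S) = mat n n (\<lambda>(i, j). A i j)"
    by (rule eq_matI) (auto simp: laplacian_def Mmat_def A_def W_def intro!: sum.cong)
  have sym: "symmetric_on {..<n} A" by (simp add: symmetric_on_def A_def Wsym)
  have ker: "mv {..<n} A (\<lambda>_. 1) l = 0" if "l < n" for l
    using that by (simp add: mv_def A_def sum_subtractf)
  \<comment> \<open>Items start at 1 and matrix indices at 0, hence the shift.\<close>
  define y where "y l = x (Suc l)" for l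
  have shift: "(\<Sum>i=1..n. f i) = (\<Sum>l<n. f (Suc l))" for f :: "nat \<Rightarrow> real"
    by (simp add: sum.atLeast1_atMost_eq)
  have "lam * ip {..<n} y y \<le> ip {..<n} y (mv {..<n} A y)"
    unfolding lam_def lap
    by (rule lambda2_quadratic_form[OF sym \<open>n \<ge> 2\<close>])
      (use ker \<open>lam > 0\<close> x[unfolded shift] in \<open>simp_all add: lam_def lap y_def ip_def\<close>)
  also have "\<dots> = (\<Sum>i<n. \<Sum>j<n. W i j * (y i - y j)\<^sup>2) / 2"
    unfolding A_def[abs_def] by (rule laplacian_quadratic_form) (simp_all add: Wsym)
  also have "(\<Sum>i<n. \<Sum>j<n. W i j * (y i - y j)\<^sup>2) =
      (\<Sum>i<n. \<Sum>j<n. real n / real m * (\<Sum>t<m. of_bool ({i + 1, j + 1} \<subseteq> S t)) * (y i - y j)\<^sup>2)"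
    by (intro sum.cong refl) (auto simp: W_def sum_of_bool_eq Collect_conj_eq lessThan_def)
  also have "\<dots> = (\<Sum>i=1..n. \<Sum>j=1..n. real n / real m * (\<Sum>t<m. of_bool ({i, j} \<subseteq> S t)) * (x i - x j)\<^sup>2)"
    unfolding shift y_def by simp
  also have "\<dots> = real n / real m * (\<Sum>i=1..n. \<Sum>j=1..n. \<Sum>t<m. of_bool ({i, j} \<subseteq> S t) * (x i - x j)\<^sup>2)"
    by (simp add: sum_distrib_left sum_distrib_right mult.assoc)
  also have "(\<Sum>i=1..n. \<Sum>j=1..n. \<Sum>t<m. of_bool ({i, j} \<subseteq> S t) * (x i - x j)\<^sup>2) =
      (\<Sum>i=1..n. \<Sum>t<m. \<Sum>j=1..n. of_bool ({i, j} \<subseteq> S t) * (x i - x j)\<^sup>2)"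
    by (rule sum.cong[OF refl], rule sum.swap)
  also have "\<dots> = (\<Sum>t<m. \<Sum>i=1..n. \<Sum>j=1..n. of_bool ({i, j} \<subseteq> S t) * (x i - x j)\<^sup>2)"
    by (rule sum.swap)
  also have "\<dots> = (\<Sum>t<m. \<Sum>y\<in>S t. \<Sum>z\<in>S t. (x y - x z)\<^sup>2)"
  proof (rule sum.cong[OF refl])
    fix t assume "t \<in> {..<m}"
    hence St: "S t \<subseteq> {1..n}" using S by simp
    have "(\<Sum>j=1..n. of_bool ({i, j} \<subseteq> S t) * (x i - x j)\<^sup>2) =
        (if i \<in> S t then \<Sum>j\<in>S t. (x i - x j)\<^sup>2 else 0)" for i
    proof (cases "i \<in> S t")
      case True
      have "(\<Sum>j=1..n. of_bool ({i, j} \<subseteq> S t) * (x i - x j)\<^sup>2) =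
          (\<Sum>j\<in>S t. of_bool ({i, j} \<subseteq> S t) * (x i - x j)\<^sup>2)"
        using St by (intro sum.mono_neutral_right) auto
      thus ?thesis using True by simp
    qed simp
    hence "(\<Sum>i=1..n. \<Sum>j=1..n. of_bool ({i, j} \<subseteq> S t) * (x i - x j)\<^sup>2) =
        (\<Sum>i=1..n. if i \<in> S t then \<Sum>j\<in>S t. (x i - x j)\<^sup>2 else 0)" by simp
    also have "\<dots> = (\<Sum>i\<in>S t. if i \<in> S t then \<Sum>j\<in>S t. (x i - x j)\<^sup>2 else 0)"
      using St by (intro sum.mono_neutral_right) auto
    finally show "(\<Sum>i=1..n. \<Sum>j=1..n. of_bool ({i, j} \<subseteq> S t) * (x i - x j)\<^sup>2) =
        (\<Sum>y\<in>S t. \<Sum>z\<in>S t. (x y - x z)\<^sup>2)" by simp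
  qed
  finally show ?thesis unfolding ip_def y_def shift by (simp add: power2_eq_square)
qed

text \<open>Summing the spectral gap over the test vectors \<open>e\<^sub>i - 1/n\<close> bounds it by the trace.\<close>

lemma comparison_laplacian_gap_le:
  fixes n m k :: nat and S :: "nat \<Rightarrow> nat set"
  defines "lam \<equiv> lambda2 (laplacian (Mmat n m S))"
  assumes "n \<ge> 2" "m > 0" and S: "\<And>t. t < m \<Longrightarrow> S t \<subseteq> {1..n} \<and> card (S t) = k" and "lam > 0"
  shows "lam * (real n - 1) \<le> real n * (real k * (real k - 1))"
proof -
  define e where "e i l = of_bool (l = i) - 1 / real n" for i l :: nat
  have sum0: "(\<Sum>l=1..n. e i l) = 0" if "i \<in> {1..n}" for i
    using that \<open>n \<ge> 2\<close> by (simp add: e_def sum_subtractf)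
  have sq: "(\<Sum>l=1..n. (e i l)\<^sup>2) = 1 - 1 / real n" if "i \<in> {1..n}" for i
  proof -
    have "(\<Sum>l=1..n. (e i l)\<^sup>2) = (\<Sum>l=1..n. of_bool (l = i) * (1 - 2 / real n) + 1 / (real n)\<^sup>2)"
      by (intro sum.cong refl) (simp add: e_def power2_eq_square algebra_simps)
    also have "\<dots> = (1 - 2 / real n) + real n * (1 / (real n)\<^sup>2)"
      using that by (simp add: sum.distrib)
    finally show ?thesis using \<open>n \<ge> 2\<close> by (simp add: power2_eq_square field_simps)
  qed
  have "lam * (real n - 1) = (\<Sum>i=1..n. lam * (\<Sum>l=1..n. (e i l)\<^sup>2))"
  proof -
    have "(\<Sum>i=1..n. lam * (\<Sum>l=1..n. (e i l)\<^sup>2)) = (\<Sum>i=1..n. lam * (1 - 1 / real n))"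
      by (intro sum.cong refl) (simp only: sq)
    also have "\<dots> = lam * (real n - 1)" using \<open>n \<ge> 2\<close> by (simp add: field_simps)
    finally show ?thesis ..
  qed
  also have "\<dots> \<le> (\<Sum>i=1..n. real n / real m * (\<Sum>t<m. \<Sum>y\<in>S t. \<Sum>z\<in>S t. (e i y - e i z)\<^sup>2) / 2)"
    unfolding lam_def using assms sum0 by (intro sum_mono comparison_laplacian_gap) auto
  also have "\<dots> = real n / real m * (\<Sum>i=1..n. \<Sum>t<m. \<Sum>y\<in>S t. \<Sum>z\<in>S t. (e i y - e i z)\<^sup>2) / 2"
    by (simp add: sum_distrib_left sum_divide_distrib)
  also have "(\<Sum>i=1..n. \<Sum>t<m. \<Sum>y\<in>S t. \<Sum>z\<in>S t. (e i y - e i z)\<^sup>2) =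
      (\<Sum>t<m. \<Sum>i=1..n. \<Sum>y\<in>S t. \<Sum>z\<in>S t. (e i y - e i z)\<^sup>2)"
    by (rule sum.swap)
  also have "\<dots> = (\<Sum>t<m. 2 * (real k * (real k - 1)))"
  proof (intro sum.cong refl)
    fix t assume "t \<in> {..<m}"
    hence St: "S t \<subseteq> {1..n}" "card (S t) = k" using S by auto
    hence fin: "finite (S t)" using finite_subset by blast
    have "(\<Sum>i=1..n. \<Sum>y\<in>S t. \<Sum>z\<in>S t. (e i y - e i z)\<^sup>2) = (\<Sum>y\<in>S t. \<Sum>i=1..n. \<Sum>z\<in>S t. (e i y - e i z)\<^sup>2)"
      by (rule sum.swap)
    also have "\<dots> = (\<Sum>y\<in>S t. \<Sum>z\<in>S t. \<Sum>i=1..n. (e i y - e i z)\<^sup>2)"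
      by (rule sum.cong[OF refl], rule sum.swap)
    also have "\<dots> = (\<Sum>y\<in>S t. \<Sum>z\<in>S t. 2 - 2 * of_bool (z = y))"
    proof (intro sum.cong refl)
      fix y z assume yz: "y \<in> S t" "z \<in> S t"
      \<comment> \<open>The terms \<open>1 / real n\<close> cancel, so the sum counts the
        \<open>i\<close> that equal exactly one of \<open>y\<close> and \<open>z\<close>: it is 2
        for distinct items and 0 otherwise.\<close>
      have "(\<Sum>i=1..n. (e i y - e i z)\<^sup>2) = (\<Sum>i=1..n. of_bool (i = y) * (1 - 2 * of_bool (z = y)) + of_bool (i = z))"
        by (intro sum.cong refl) (auto simp: e_def)
      also have "\<dots> = 2 - 2 * of_bool (z = y)"
      proof -
        have "{Suc 0..n} \<inter> {y} = {y}" "{Suc 0..n} \<inter> {z} = {z}" using yz St(1) by auto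
        thus ?thesis by (simp add: sum.distrib)
      qed
      finally show "(\<Sum>i=1..n. (e i y - e i z)\<^sup>2) = 2 - 2 * of_bool (z = y)" .
    qed
    also have "\<dots> = 2 * (real k * (real k - 1))"
      using fin St(2) by (simp add: sum_subtractf flip: sum_distrib_left)
    finally show "(\<Sum>i=1..n. \<Sum>y\<in>S t. \<Sum>z\<in>S t. (e i y - e i z)\<^sup>2) = 2 * (real k * (real k - 1))" .
  qed
  also have "real n / real m * (\<Sum>t<m. 2 * (real k * (real k - 1))) / 2 = real n * (real k * (real k - 1))"
    using \<open>m > 0\<close> by simp
  finally show ?thesis .
qed

section \<open>Matrix Chernoff bound for the Hessian\<close>

lemma mv_sum_matrix: "mv I (\<lambda>l j. \<Sum>t<m. D t l j) y l = (\<Sum>t<m. mv I (D t) y l)"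
  unfolding mv_def sum_distrib_right by (rule sum.swap)

lemma ip_sum_right: "ip I y (\<lambda>l. \<Sum>t\<in>J. f t l) = (\<Sum>t\<in>J. ip I y (f t))"
  unfolding ip_def sum_distrib_left by (rule sum.swap)

text \<open>The constant matrix \<open>N/n\<close> lifts the kernel direction, so that the trace exponential sees only
  the spectral gap.\<close>

lemma hessian_lower_tail:
  fixes A :: real
  assumes "n \<ge> 1" "A > 0"
    and S: "\<And>t. t < m \<Longrightarrow> S t \<subseteq> {1..n} \<and> card (S t) \<ge> 2"
    and low: "\<And>x. (\<Sum>i=1..n. x i) = 0 \<Longrightarrow> A / 2 * (\<Sum>i=1..n. (x i)\<^sup>2) \<le>
      (\<Sum>t<m. measure_pmf.expectation (obs_pmf \<theta> (S t)) (\<lambda>(y, z). dsig (\<theta> y - \<theta> z) * (x y - x z)\<^sup>2))"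
  shows "measure_pmf.prob (sample_pmf m S \<theta>)
      {\<omega>. \<exists>x. (\<Sum>i=1..n. x i) = 0 \<and> hess_form m \<theta> \<omega> x < 5 / 16 * A * (\<Sum>i=1..n. (x i)\<^sup>2)} \<le>
    n * exp (- (9 / 128 * A))" (is "measure_pmf.prob ?P ?E \<le> _")
proof -
  define I where "I = {1..n}"
  have I: "finite I" "card I = n" by (simp_all add: I_def)
  have finS: "finite (S t)" if "t < m" for t using S[OF that] finite_subset by blast
  \<comment> \<open>\<open>39 / 128\<close> is \<open>13 / 16 * (3 / 4) * (1 / 2)\<close>: the loss
    factor \<open>1 - s / 2\<close> with \<open>s = 3 / 8\<close>, the scaling below, and the
    constant of assumption \<open>low\<close>.\<close>
  define N where "N = 39 / 128 * A"
  define C where "C l j = N / real n" for l j :: nat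
  \<comment> \<open>The factor \<open>3 / 4\<close> is the exponential parameter of the Chernoff
    bound. With \<open>dsig \<le> 1 / 4\<close> and squared length 2 of an edge vector it gives the
    norm bound \<open>3 / 8\<close>.\<close>
  define x where "x w l = sqrt (3 / 4 * dsig (\<theta> (fst w) - \<theta> (snd w))) * dvec w l" for w l
  have symC: "symmetric_on I C" by (simp add: symmetric_on_def C_def)
  have finp: "finite (set_pmf (obs_pmf \<theta> (S t)))" if "t < m" for t
    using finite_set_pmf_obs_pmf S that finS by blast
  have supp: "fst w \<in> I \<and> snd w \<in> I \<and> fst w \<noteq> snd w" if "t < m" "w \<in> set_pmf (obs_pmf \<theta> (S t))" for t w
    using set_pmf_obs_pmf[OF finS[OF that(1)], of \<theta>] S[OF that(1)] that(2) by (fastforce simp: I_def)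
  have ipx: "(ip I (x w) y)\<^sup>2 = 3 / 4 * (dsig (\<theta> (fst w) - \<theta> (snd w)) * (y (fst w) - y (snd w))\<^sup>2)"
    if "fst w \<in> I" "snd w \<in> I" for w y
    using dsig_pos[of "\<theta> (fst w) - \<theta> (snd w)"] that
    by (simp add: x_def[abs_def] ip_scale_left ip_dvec[OF I(1)] power_mult_distrib less_imp_le)
  have norm: "ip I (x w) (x w) \<le> 3 / 8" if "t < m" "w \<in> set_pmf (obs_pmf \<theta> (S t))" for t w
  proof -
    have "ip I (x w) (x w) = 3 / 4 * dsig (\<theta> (fst w) - \<theta> (snd w)) * ip I (dvec w) (dvec w)"
      using dsig_pos[of "\<theta> (fst w) - \<theta> (snd w)"]
      by (simp add: x_def[abs_def] ip_scale_left ip_scale_right less_imp_le flip: mult.assoc)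
    also have "ip I (dvec w) (dvec w) = 2"
      using supp[OF that] by (simp add: ip_dvec[OF I(1)]) (simp add: dvec_def)
    finally show ?thesis using dsig_le[of "\<theta> (fst w) - \<theta> (snd w)"] by simp
  qed
  have qC: "ip I y (mv I C y) = N / n * (\<Sum>i\<in>I. y i)\<^sup>2" for y
  proof -
    have "mv I C y = (\<lambda>_. N / n * (\<Sum>i\<in>I. y i))"
      by (simp add: fun_eq_iff mv_def C_def sum_distrib_left)
    thus ?thesis by (simp only: ip_def power2_eq_square sum_distrib_right[symmetric]) (simp add: mult_ac)
  qed
  define T where "T \<omega> = exp_trace I (\<lambda>l j. C l j + (\<Sum>t<m. x (\<omega> t) l * x (\<omega> t) j))" for \<omega>
  define G where "G l j = (\<Sum>t<m. measure_pmf.expectation (obs_pmf \<theta> (S t)) (\<lambda>z. x z l * x z j))" for l j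
  have finP: "finite (set_pmf ?P)"
    unfolding sample_pmf_def by (rule finite_set_Pi_pmf) (use finp in auto)
  have suppP: "fst (\<omega> t) \<in> I \<and> snd (\<omega> t) \<in> I" if "\<omega> \<in> set_pmf ?P" "t < m" for \<omega> t
  proof -
    have "\<omega> t \<in> set_pmf (obs_pmf \<theta> (S t))"
      using that unfolding sample_pmf_def by (subst (asm) set_Pi_pmf) (auto simp: PiE_dflt_def)
    thus ?thesis using supp that(2) by blast
  qed
  have upper: "measure_pmf.expectation ?P T \<le> n * exp (- N)"
  proof -
    have "measure_pmf.expectation ?P T \<le> exp_trace I (\<lambda>l j. C l j + (1 - (3 / 8) / 2) * G l j)"
      unfolding T_def G_def sample_pmf_def
      by (rule exp_trace_independent_sum[OF I(1) symC]) (use finp norm in auto)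
    also have "\<dots> \<le> card I * exp (- N)"
    proof (rule exp_trace_le[OF I(1)])
      show "symmetric_on I (\<lambda>l j. C l j + (1 - (3 / 8) / 2) * G l j)"
        by (auto simp: symmetric_on_def C_def G_def mult_ac)
      fix y
      define c where "c = (\<Sum>i\<in>I. y i) / n"
      \<comment> \<open>Splitting off the mean separates the two lower bounds: the constant matrix
        handles the mean, the expected Hessian the part of sum zero.\<close>
      define y' where "y' i = y i - c" for i
      have sum0: "(\<Sum>i=1..n. y' i) = 0"
        using \<open>n \<ge> 1\<close> by (simp add: y'_def sum_subtractf c_def I_def)
      have yy: "ip I y y = (\<Sum>i=1..n. (y' i)\<^sup>2) + n * c\<^sup>2"
      proof -
        have "ip I y y = (\<Sum>i=1..n. (y' i)\<^sup>2 + 2 * c * y' i + c\<^sup>2)"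
          unfolding ip_def I_def by (intro sum.cong refl) (simp add: y'_def power2_eq_square algebra_simps)
        also have "\<dots> = (\<Sum>i=1..n. (y' i)\<^sup>2) + 2 * c * (\<Sum>i=1..n. y' i) + n * c\<^sup>2"
          by (simp add: sum.distrib sum_distrib_left)
        finally show ?thesis unfolding sum0 by simp
      qed
      have "ip I y (mv I G y) = (\<Sum>t<m. measure_pmf.expectation (obs_pmf \<theta> (S t)) (\<lambda>z. (ip I (x z) y)\<^sup>2))"
        unfolding G_def[abs_def] mv_sum_matrix[abs_def] ip_sum_right
        by (intro sum.cong refl ip_mv_expectation finp) simp
      also have "\<dots> = (\<Sum>t<m. measure_pmf.expectation (obs_pmf \<theta> (S t))
          (\<lambda>w. 3 / 4 * (case w of (i, j) \<Rightarrow> dsig (\<theta> i - \<theta> j) * (y' i - y' j)\<^sup>2)))"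
      proof (intro sum.cong refl integral_cong_AE)
        fix t assume "t \<in> {..<m}"
        thus "AE w in measure_pmf (obs_pmf \<theta> (S t)). (ip I (x w) y)\<^sup>2 =
            3 / 4 * (case w of (i, j) \<Rightarrow> dsig (\<theta> i - \<theta> j) * (y' i - y' j)\<^sup>2)"
          using supp by (intro AE_pmfI) (auto simp: ipx y'_def)
      qed simp_all
      also have "\<dots> = 3 / 4 * (\<Sum>t<m. measure_pmf.expectation (obs_pmf \<theta> (S t))
          (\<lambda>(i, j). dsig (\<theta> i - \<theta> j) * (y' i - y' j)\<^sup>2))"
        unfolding sum_distrib_left integral_mult_right_zero ..
      also have "\<dots> \<ge> 3 / 4 * (A / 2 * (\<Sum>i=1..n. (y' i)\<^sup>2))"
        by (intro mult_left_mono low[OF sum0]) simp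
      finally have G: "ip I y (mv I G y) \<ge> 3 / 4 * (A / 2 * (\<Sum>i=1..n. (y' i)\<^sup>2))" .
      have "N * (n * c\<^sup>2) = N / n * (\<Sum>i\<in>I. y i)\<^sup>2"
        using \<open>n \<ge> 1\<close> by (simp add: c_def power2_eq_square)
      moreover have "N * (\<Sum>i=1..n. (y' i)\<^sup>2) \<le> (1 - (3 / 8) / 2) * ip I y (mv I G y)"
        using G by (simp add: N_def)
      ultimately have "N * ip I y y \<le> N / n * (\<Sum>i\<in>I. y i)\<^sup>2 + (1 - (3 / 8) / 2) * ip I y (mv I G y)"
        unfolding yy distrib_left by linarith
      also have "\<dots> = ip I y (mv I (\<lambda>l j. C l j + (1 - (3 / 8) / 2) * G l j) y)"
        unfolding mv_add_matrix[abs_def] mv_scale_matrix[abs_def] ip_add_right ip_scale_right qC ..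
      finally show "N * ip I y y \<le> ip I y (mv I (\<lambda>l j. C l j + (1 - (3 / 8) / 2) * G l j) y)" .
    qed
    finally show ?thesis by (simp add: I)
  qed
  have lower: "T \<omega> \<ge> exp (- (15 / 64 * A))" if \<omega>: "\<omega> \<in> set_pmf ?P" "\<omega> \<in> ?E" for \<omega>
  proof -
    obtain y where y: "(\<Sum>i=1..n. y i) = 0" "hess_form m \<theta> \<omega> y < 5 / 16 * A * (\<Sum>i=1..n. (y i)\<^sup>2)"
      using \<omega>(2) by blast
    have yy: "ip I y y = (\<Sum>i=1..n. (y i)\<^sup>2)" by (simp add: ip_def I_def power2_eq_square)
    have "hess_form m \<theta> \<omega> y \<ge> 0"
      unfolding hess_form_def using dsig_pos by (intro sum_nonneg mult_nonneg_nonneg) (auto simp: less_imp_le)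
    hence "0 < 5 / 16 * A * ip I y y" using y(2) unfolding yy by linarith
    hence pos: "ip I y y > 0" using \<open>A > 0\<close> by (simp add: zero_less_mult_iff)
    have "ip I y (mv I (\<lambda>l j. C l j + (\<Sum>t<m. x (\<omega> t) l * x (\<omega> t) j)) y) = (\<Sum>t<m. (ip I (x (\<omega> t)) y)\<^sup>2)"
      using ip_mv_rank_one_sum[of I y "\<lambda>_. 1" "\<lambda>t. x (\<omega> t)" "{..<m}" y] y(1)[folded I_def]
      by (simp add: mv_add_matrix[abs_def] ip_add_right qC power2_eq_square)
    also have "\<dots> = 3 / 4 * hess_form m \<theta> \<omega> y"
      unfolding hess_form_def sum_distrib_left using suppP[OF \<omega>(1)] by (intro sum.cong refl ipx) auto
    also have "\<dots> \<le> 15 / 64 * A * ip I y y" using y(2) unfolding yy by simp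
    finally have "ip I y (mv I (\<lambda>l j. C l j + (\<Sum>t<m. x (\<omega> t) l * x (\<omega> t) j)) y) \<le> 15 / 64 * A * ip I y y" .
    moreover have "symmetric_on I (\<lambda>l j. C l j + (\<Sum>t<m. x (\<omega> t) l * x (\<omega> t) j))"
      by (auto simp: symmetric_on_def C_def mult_ac)
    ultimately show ?thesis unfolding T_def by (intro exp_trace_ge[OF I(1) _ pos])
  qed
  have T0: "T \<omega> \<ge> 0" for \<omega>
    unfolding T_def exp_trace_def by (auto simp: Let_def split: prod.splits intro!: sum_nonneg)
  \<comment> \<open>On the event the form of the scaled Hessian is at most
    \<open>3 / 4 * (5 / 16) * A = 15 / 64 * A\<close>. Markov's inequality then leaves the exponent
    \<open>39 / 128 - 15 / 64 = 9 / 128\<close>.\<close>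
  have "measure_pmf.prob ?P ?E \<le> measure_pmf.expectation ?P (\<lambda>\<omega>. exp (15 / 64 * A) * T \<omega>)"
  proof (rule pmf_markov[OF finP])
    fix \<omega> assume "\<omega> \<in> set_pmf ?P" "\<omega> \<in> ?E"
    from lower[OF this] have "exp (15 / 64 * A) * exp (- (15 / 64 * A)) \<le> exp (15 / 64 * A) * T \<omega>"
      by (intro mult_left_mono) auto
    thus "1 \<le> exp (15 / 64 * A) * T \<omega>" by (simp flip: exp_add)
  qed (simp add: T0)
  also have "\<dots> = exp (15 / 64 * A) * measure_pmf.expectation ?P T" by simp
  also have "\<dots> \<le> exp (15 / 64 * A) * (n * exp (- N))" by (intro mult_left_mono upper) simp
  also have "\<dots> = n * exp (15 / 64 * A + - N)" unfolding exp_add by simp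
  also have "15 / 64 * A + - N = - (9 / 128 * A)" by (simp add: N_def)
  finally show ?thesis .
qed

section \<open>The error bound\<close>

text \<open>Squaring \<open>exp b \<ge> exp 1 * b\<close> and using
  \<open>exp 1 \<ge> 8 / 3\<close>. The constant is the one for which
  \<open>9 / 128 * 4 * (64 / 9) = 2\<close>, the exponent wanted in the Hessian tail.\<close>

lemma exp_double_ge_square: "exp (2 * b) \<ge> 64 / 9 * b\<^sup>2" if "b > 0" for b :: real
proof -
  have "8 / 3 \<le> (1 + 1 / 4 + (1 / 4)\<^sup>2 / 2 :: real) ^ 4" by (simp add: power2_eq_square power4_eq_xxxx)
  also have "\<dots> \<le> exp (1 / 4) ^ 4" by (intro power_mono exp_lower_Taylor_quadratic) auto
  also have "\<dots> = exp 1" by (simp flip: exp_of_nat_mult)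
  finally have "8 / 3 * b \<le> exp 1 * exp (b - 1)"
    using exp_ge_add_one_self[of "b - 1"] that by (intro mult_mono) auto
  hence "8 / 3 * b \<le> exp b" by (simp flip: exp_add)
  hence "(8 / 3 * b)\<^sup>2 \<le> (exp b)\<^sup>2" using that by (intro power_mono) auto
  thus ?thesis by (simp add: power_mult_distrib power2_eq_square flip: exp_add)
qed

text \<open>This is what Bernstein's inequality requires of
  \<open>\<kappa> = 5 / 8 * \<beta>\<close> on the range of exponents that occurs. The left side is
  controlled by \<open>(sinh b / b)\<^sup>2 \<ge> 1 + b\<^sup>2 / 3\<close>, the right side by
  \<open>\<epsilon> \<le> 2 * b / (1 + b)\<close> from the Pade comparison.\<close>

lemma curvature_constant_bound:
  fixes b :: real
  assumes "b > 0"
  defines "\<epsilon> \<equiv> 1 - exp (- (2 * b))"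
  shows "5 / 4 * ((\<epsilon> / (2 * b))\<^sup>2 * exp (2 * b)) \<ge> 1 + sqrt 2 / 3 * \<epsilon>"
proof -
  have "\<epsilon> * exp b = 2 * sinh b"
    by (simp add: \<epsilon>_def sinh_field_def left_diff_distrib flip: exp_add)
  hence "\<epsilon> / (2 * b) * exp b = sinh b / b" using assms(1) by (simp add: field_simps)
  also have "\<dots> \<ge> 1 + b\<^sup>2 / 6"
    using sinh_lower_bound[of b] assms(1) by (simp add: field_simps power2_eq_square power3_eq_cube)
  finally have "(1 + b\<^sup>2 / 6)\<^sup>2 \<le> (\<epsilon> / (2 * b) * exp b)\<^sup>2" by (intro power_mono) auto
  moreover have "1 + b\<^sup>2 / 3 \<le> (1 + b\<^sup>2 / 6)\<^sup>2" by (simp add: power2_sum)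
  ultimately have "1 + b\<^sup>2 / 3 \<le> (\<epsilon> / (2 * b) * exp b)\<^sup>2" by (rule order_trans[rotated])
  also have "(\<epsilon> / (2 * b) * exp b)\<^sup>2 = (\<epsilon> / (2 * b))\<^sup>2 * exp (2 * b)"
    by (simp only: power_mult_distrib exp_double)
  finally have "1 + b\<^sup>2 / 3 \<le> (\<epsilon> / (2 * b))\<^sup>2 * exp (2 * b)" .
  moreover have "sqrt 2 / 3 * \<epsilon> \<le> 1 / 4 + 5 / 12 * b\<^sup>2"
  proof -
    have "\<epsilon> * (1 + b) \<le> 2 * b"
    proof -
      have "exp (2 * b) * (1 - b) \<le> 1 + b" using exp_pade_mono[of 0 "2 * b"] assms(1) by (simp add: algebra_simps)
      hence "exp (- (2 * b)) * (exp (2 * b) * (1 - b)) \<le> exp (- (2 * b)) * (1 + b)" by (intro mult_left_mono) auto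
      hence "1 - b \<le> exp (- (2 * b)) * (1 + b)" by (simp add: mult.assoc[symmetric] flip: exp_add)
      thus ?thesis by (simp add: \<epsilon>_def algebra_simps)
    qed
    have "sqrt 2 \<le> 2829 / 2000" by (rule real_le_lsqrt) (simp_all add: power2_eq_square)
    hence "sqrt 2 / 3 \<le> 943 / 2000" by simp
    hence "sqrt 2 / 3 * (\<epsilon> * (1 + b)) \<le> 943 / 2000 * (2 * b)"
      by (rule mult_mono) (use \<open>\<epsilon> * (1 + b) \<le> 2 * b\<close> assms(1) in \<open>simp_all add: \<epsilon>_def\<close>)
    also have "\<dots> \<le> (1 / 4 + 5 / 12 * b\<^sup>2) * (1 + b)"
    proof -
      \<comment> \<open>The cubic and the quadratic term are replaced by their tangents at
        \<open>1 / 2\<close> and \<open>457 / 1000\<close>; the linear coefficients then add up to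
        slightly more than \<open>943 / 1000\<close>.\<close>
      have "0 \<le> (b - 1 / 2)\<^sup>2 * (b + 1)" using assms(1) by simp
      also have "\<dots> = b * b * b - 3 / 4 * b + 1 / 4" by (simp add: power2_eq_square field_simps)
      finally have "b * b * b \<ge> 3 / 4 * b - 1 / 4" by simp
      moreover have "0 \<le> (b - 457 / 1000)\<^sup>2" by simp
      hence "0 \<le> b * b - 914 / 1000 * b + 208849 / 1000000" by (simp add: power2_eq_square field_simps)
      moreover have "(1 / 4 + 5 / 12 * b\<^sup>2) * (1 + b) = 1 / 4 + b / 4 + 5 / 12 * (b * b) + 5 / 12 * (b * b * b)"
        by (simp add: power2_eq_square field_simps)
      ultimately show ?thesis using assms(1) by linarith
    qed
    finally have "(sqrt 2 / 3 * \<epsilon>) * (1 + b) \<le> (1 / 4 + 5 / 12 * b\<^sup>2) * (1 + b)" by (simp add: mult.assoc)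
    thus ?thesis using assms(1) by simp
  qed
  ultimately show ?thesis by linarith
qed

text \<open>Both \<open>dsig\<close> and the squared difference are unchanged by a swap, so the form
  depends on the unordered pairs only.\<close>

lemma hess_form_flip_invariant:
  assumes "\<omega> \<in> set_pmf (Pi_pmf {..<m} (0, 0) (\<lambda>t. flip_pmf \<theta> (\<omega>0 t)))"
  shows "hess_form m \<theta> \<omega> x = hess_form m \<theta> \<omega>0 x"
  unfolding hess_form_def
proof (intro sum.cong refl)
  fix t assume "t \<in> {..<m}"
  hence "\<omega> t \<in> set_pmf (flip_pmf \<theta> (\<omega>0 t))"
    using assms by (subst (asm) set_Pi_pmf) (auto simp: PiE_dflt_def)
  hence "\<omega> t = \<omega>0 t \<or> \<omega> t = prod.swap (\<omega>0 t)" by (auto simp: flip_pmf_def split: if_splits)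
  thus "dsig (\<theta> (fst (\<omega> t)) - \<theta> (snd (\<omega> t))) * (x (fst (\<omega> t)) - x (snd (\<omega> t)))\<^sup>2 =
      dsig (\<theta> (fst (\<omega>0 t)) - \<theta> (snd (\<omega>0 t))) * (x (fst (\<omega>0 t)) - x (snd (\<omega>0 t)))\<^sup>2"
    using dsig_minus[of "\<theta> (fst (\<omega>0 t)) - \<theta> (snd (\<omega>0 t))"] by (auto simp: power2_commute)
qed

lemma prob_bind_pmf_le:
  assumes "\<And>x. x \<in> set_pmf p \<Longrightarrow> measure_pmf.prob (f x) E \<le> c"
  shows "measure_pmf.prob (bind_pmf p f) E \<le> c"
proof -
  obtain x where "x \<in> set_pmf p" using set_pmf_not_empty by fast
  from assms[OF this] have c: "c \<ge> 0"
    using measure_nonneg[of "measure_pmf (f x)" E] by linarith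
  have "emeasure (bind_pmf p f) E = (\<integral>\<^sup>+x. emeasure (f x) E \<partial>p)" by simp
  also have "\<dots> \<le> (\<integral>\<^sup>+x. ennreal c \<partial>p)"
    using assms c by (intro nn_integral_mono_AE AE_pmfI) (simp add: measure_pmf.emeasure_eq_measure ennreal_leI)
  also have "\<dots> = ennreal c" by (simp add: measure_pmf.emeasure_space_1[simplified])
  finally show ?thesis using c by (simp add: measure_pmf.emeasure_eq_measure)
qed

text \<open>Once the unordered pairs are fixed, the gap condition holds either for all orientations
  or for none. In the first case \<open>score_tail\<close> applies, in the second the event is null;
  the bound thus survives averaging over the pairs.\<close>

lemma score_deviation_probability:
  fixes K \<kappa> r h :: real
  assumes "n \<ge> 1" and S: "\<And>t. t < m \<Longrightarrow> S t \<subseteq> {1..n} \<and> card (S t) \<ge> 2"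
    and "h > 0" "\<kappa> > 0" "K > 0" "r \<ge> 0" and K: "K \<le> r\<^sup>2 * h"
    and quad: "\<And>x. \<bar>x\<bar> \<le> r / (sqrt 2 * \<kappa>) \<Longrightarrow> exp x \<le> 1 + x + \<kappa> * x\<^sup>2"
  shows "measure_pmf.prob (sample_pmf m S \<theta>)
      {\<omega>. (\<forall>x. (\<Sum>i=1..n. x i) = 0 \<longrightarrow> hess_form m \<theta> \<omega> x \<ge> h * (\<Sum>i=1..n. (x i)\<^sup>2)) \<and>
           (\<exists>x. (\<Sum>i=1..n. x i) = 0 \<and> (score m \<theta> \<omega> x)\<^sup>2 > n * K * hess_form m \<theta> \<omega> x)} \<le>
    2 * real n * exp (- K / (4 * \<kappa>))" (is "measure_pmf.prob _ ?E \<le> _")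
proof -
  have finS: "finite (S t)" if "t < m" for t using S[OF that] finite_subset by blast
  have flip: "sample_pmf m S \<theta> = sample_pmf m S \<theta> \<bind> (\<lambda>\<omega>. Pi_pmf {..<m} (0, 0) (\<lambda>t. flip_pmf \<theta> (\<omega> t)))"
    by (rule sample_pmf_flip) (use S finS in blast)
  have "measure_pmf.prob (sample_pmf m S \<theta> \<bind> (\<lambda>\<omega>. Pi_pmf {..<m} (0, 0) (\<lambda>t. flip_pmf \<theta> (\<omega> t)))) ?E \<le>
      2 * real n * exp (- K / (4 * \<kappa>))"
  proof (rule prob_bind_pmf_le)
    fix \<omega>0 assume \<omega>0: "\<omega>0 \<in> set_pmf (sample_pmf m S \<theta>)"
    let ?Q = "Pi_pmf {..<m} (0, 0) (\<lambda>t. flip_pmf \<theta> (\<omega>0 t))"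
    have w: "fst (\<omega>0 t) \<in> {1..n} \<and> snd (\<omega>0 t) \<in> {1..n} \<and> fst (\<omega>0 t) \<noteq> snd (\<omega>0 t)" if "t < m" for t
    proof -
      have "\<omega>0 t \<in> set_pmf (obs_pmf \<theta> (S t))"
        using \<omega>0 that unfolding sample_pmf_def by (subst (asm) set_Pi_pmf) (auto simp: PiE_dflt_def)
      hence "\<omega>0 t \<in> {(y, z). y \<in> S t \<and> z \<in> S t \<and> y \<noteq> z}"
        by (rule subsetD[OF set_pmf_obs_pmf[OF finS[OF that]], rotated]) (use S[OF that] in simp)
      thus ?thesis using S[OF that] by auto
    qed
    show "measure_pmf.prob ?Q ?E \<le> 2 * real n * exp (- K / (4 * \<kappa>))"
    proof (cases "\<forall>x. (\<Sum>i=1..n. x i) = 0 \<longrightarrow> hess_form m \<theta> \<omega>0 x \<ge> h * (\<Sum>i=1..n. (x i)\<^sup>2)")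
      case True
      have "measure_pmf.prob ?Q ?E \<le> measure_pmf.prob ?Q
          {\<omega>. \<exists>x. (\<Sum>i\<in>{1..n}. x i) = 0 \<and> (score m \<theta> \<omega> x)\<^sup>2 > card {1..n} * K * hess_form m \<theta> \<omega>0 x}"
        by (intro measure_pmf.finite_measure_mono_AE AE_pmfI) (auto simp: hess_form_flip_invariant)
      also have "\<dots> \<le> 2 * real (card {1..n}) * exp (- K / (4 * \<kappa>))"
        by (rule score_tail) (use assms w True in auto)
      finally show ?thesis by simp
    next
      case False
      hence "measure_pmf.prob ?Q ?E \<le> measure_pmf.prob ?Q {}"
        by (intro measure_pmf.finite_measure_mono_AE AE_pmfI) (auto simp: hess_form_flip_invariant)
      also have "\<dots> \<le> 2 * real n * exp (- K / (4 * \<kappa>))" by simp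
      finally show ?thesis .
    qed
  qed
  thus ?thesis by (simp only: flip[symmetric])
qed

text \<open>Outside two exceptional events the form \<open>H\<close> of the error satisfies
  \<open>(\<psi> * H)\<^sup>2 \<le> n * K * H\<close> by optimality and score concentration, and
  \<open>H\<close> is at least \<open>h\<close> times the squared error. Dividing gives the rate
  \<open>K / (\<psi>\<^sup>2 * h)\<close>.\<close>

lemma pseudo_mle_error_bound:
  fixes n m k :: nat and b :: real and S :: "nat \<Rightarrow> nat set" and \<theta>s :: "nat \<Rightarrow> real"
  defines "A \<equiv> exp (- (2 * b)) * real m * lambda2 (laplacian (Mmat n m S)) / (real n * (real k * (real k - 1)))"
  assumes \<theta>s: "\<theta>s \<in> Theta n b" and "n \<ge> 2" "m > 0" "k \<ge> 2"
    and S: "\<And>t. t < m \<Longrightarrow> S t \<subseteq> {1..n} \<and> card (S t) = k"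
    and lam: "lambda2 (laplacian (Mmat n m S)) > 0" and "b > 0"
    and A: "A > 4 * (ln n + 1) * exp (2 * b) / b\<^sup>2"
  shows "measure_pmf.prob (sample_pmf m S \<theta>s)
      {\<omega>. \<forall>\<theta>h \<in> Theta n b. (\<forall>\<theta> \<in> Theta n b. loglik1 m \<omega> \<theta> \<le> loglik1 m \<omega> \<theta>h) \<longrightarrow>
            MSE n \<theta>h \<theta>s \<le> 16 * exp (2 * b) * (ln n + 1) / A} \<ge> 1 - 3 / real n"
    (is "measure_pmf.prob ?P ?G \<ge> _")
proof -
  define lam where "lam = lambda2 (laplacian (Mmat n m S))"
  define L where "L = ln (real n) + 1"
  define \<epsilon> where "\<epsilon> = 1 - exp (- (2 * b))"
  define \<psi> where "\<psi> = \<epsilon> / (2 * b)"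
  define \<beta> where "\<beta> = \<psi>\<^sup>2 * exp (2 * b)"
  \<comment> \<open>The ratio of \<open>K\<close> and \<kappa> is set so that
    \<open>K / (4 * \<kappa>) = 2 * L\<close>, hence each two-sided coordinate tail is at most
    \<open>2 / n\<^sup>2\<close>. The factor \<beta> in \<open>K\<close> cancels
    \<open>\<psi>\<^sup>2\<close> in the final bound.\<close>
  define \<kappa> where "\<kappa> = 5 / 8 * \<beta>"
  define K where "K = 5 * \<beta> * L"
  define h where "h = 5 / 16 * A"
  have L: "L > 0" using \<open>n \<ge> 2\<close> by (simp add: L_def add_pos_pos)
  have \<epsilon>: "\<epsilon> > 0" using \<open>b > 0\<close> by (simp add: \<epsilon>_def)
  have \<psi>: "\<psi> > 0" using \<open>b > 0\<close> \<epsilon> by (simp add: \<psi>_def)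
  have \<beta>: "\<beta> > 0" using \<psi> by (simp add: \<beta>_def)
  have \<kappa>: "\<kappa> > 0" using \<beta> by (simp add: \<kappa>_def)
  have K: "K > 0" using \<beta> L by (simp add: K_def)
  have A': "A > 4 * L * exp (2 * b) / b\<^sup>2" using A by (simp add: L_def)
  have "4 * L * exp (2 * b) / b\<^sup>2 > 0" using L \<open>b > 0\<close> by simp
  hence Apos: "A > 0" using A' by linarith
  hence h: "h > 0" by (simp add: h_def)
  \<comment> \<open>The lower bound on \<open>A\<close> is exactly what this needs; \<epsilon> plays
    the part of \<open>r\<close> in the score tail.\<close>
  have "K \<le> \<epsilon>\<^sup>2 * h"
  proof -
    have "K = 5 / 16 * \<epsilon>\<^sup>2 * (4 * L * exp (2 * b) / b\<^sup>2)"
      using \<open>b > 0\<close> by (simp add: K_def \<beta>_def \<psi>_def power_divide power_mult_distrib field_simps)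
    also have "\<dots> \<le> 5 / 16 * \<epsilon>\<^sup>2 * A" using A' by (intro mult_left_mono) auto
    finally show ?thesis by (simp add: h_def)
  qed
  have quad: "exp x \<le> 1 + x + \<kappa> * x\<^sup>2" if "\<bar>x\<bar> \<le> \<epsilon> / (sqrt 2 * \<kappa>)" for x
  proof -
    define B where "B = \<epsilon> / (sqrt 2 * \<kappa>)"
    have "5 / 4 * \<beta> \<ge> 1 + sqrt 2 / 3 * \<epsilon>"
      unfolding \<beta>_def \<psi>_def \<epsilon>_def by (rule curvature_constant_bound[OF \<open>b > 0\<close>])
    hence "2 * \<kappa> \<ge> 1 + sqrt 2 / 3 * \<epsilon>" by (simp add: \<kappa>_def)
    moreover have "2 * \<kappa> * (B / 3) = sqrt 2 / 3 * \<epsilon>" using \<kappa> by (simp add: B_def field_simps)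
    ultimately have *: "1 \<le> \<kappa> * (2 * (1 - B / 3))" by (simp add: algebra_simps)
    hence "0 < \<kappa> * (2 * (1 - B / 3))" by linarith
    hence pos: "0 < 2 * (1 - B / 3)" using \<kappa> by (simp add: zero_less_mult_iff)
    have "x \<le> B" using that by (simp add: B_def)
    hence "exp x \<le> 1 + x + x\<^sup>2 / (2 * (1 - B / 3))"
      using pos by (intro exp_quadratic_bound) auto
    also have "x\<^sup>2 / (2 * (1 - B / 3)) \<le> \<kappa> * x\<^sup>2"
    proof -
      have "1 * x\<^sup>2 \<le> \<kappa> * (2 * (1 - B / 3)) * x\<^sup>2" using * by (intro mult_right_mono) auto
      thus ?thesis using pos by (simp add: pos_divide_le_eq mult_ac)
    qed
    finally show ?thesis by simp
  qed
  have S': "S t \<subseteq> {1..n} \<and> card (S t) \<ge> 2" if "t < m" for t using S[OF that] \<open>k \<ge> 2\<close> by simp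
  have finS: "finite (S t)" if "t < m" for t using S[OF that] finite_subset by blast
  have bound: "\<bar>\<theta>s i\<bar> \<le> b" if "i \<in> {1..n}" for i using \<theta>s that by (simp add: Theta_def)
  have tail: "exp (- (2 * L)) \<le> 1 / (real n)\<^sup>2"
  proof -
    have "exp (- (2 * L)) \<le> exp (- (2 * ln (real n)))" by (simp add: L_def)
    also have "\<dots> = 1 / (real n)\<^sup>2"
      using \<open>n \<ge> 2\<close> by (simp add: exp_minus exp_double inverse_eq_divide)
    finally show ?thesis .
  qed
  \<comment> \<open>\<open>B1\<close>: the Hessian loses its spectral gap. \<open>B2\<close>: the
    gap holds but the score is too large in some direction. They cost \<open>1 / n\<close> and
    \<open>2 / n\<close>.\<close>
  define B1 where "B1 = {\<omega>. \<exists>x. (\<Sum>i=1..n. x i) = 0 \<and> hess_form m \<theta>s \<omega> x < h * (\<Sum>i=1..n. (x i)\<^sup>2)}"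
  define B2 where "B2 = {\<omega>. (\<forall>x. (\<Sum>i=1..n. x i) = 0 \<longrightarrow> hess_form m \<theta>s \<omega> x \<ge> h * (\<Sum>i=1..n. (x i)\<^sup>2)) \<and>
           (\<exists>x. (\<Sum>i=1..n. x i) = 0 \<and> (score m \<theta>s \<omega> x)\<^sup>2 > n * K * hess_form m \<theta>s \<omega> x)}"
  have P1: "measure_pmf.prob ?P B1 \<le> 1 / real n"
  proof -
    have "measure_pmf.prob ?P B1 \<le> real n * exp (- (9 / 128 * A))"
      unfolding B1_def h_def
    proof (rule hessian_lower_tail)
      fix x :: "nat \<Rightarrow> real" assume x: "(\<Sum>i=1..n. x i) = 0"
      define c where "c = exp (- (2 * b)) / (4 * real k * (real k - 1))"
      have c: "c \<ge> 0" using \<open>k \<ge> 2\<close> by (simp add: c_def)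
      have "lam * (\<Sum>i=1..n. (x i)\<^sup>2) \<le> real n / real m * (\<Sum>t<m. \<Sum>y\<in>S t. \<Sum>z\<in>S t. (x y - x z)\<^sup>2) / 2"
        unfolding lam_def by (rule comparison_laplacian_gap) (use S x \<open>n \<ge> 2\<close> lam in auto)
      hence "2 * c * real m / real n * (lam * (\<Sum>i=1..n. (x i)\<^sup>2)) \<le>
          2 * c * real m / real n * (real n / real m * (\<Sum>t<m. \<Sum>y\<in>S t. \<Sum>z\<in>S t. (x y - x z)\<^sup>2) / 2)"
        using c by (intro mult_left_mono) auto
      also have "2 * c * real m / real n * (lam * (\<Sum>i=1..n. (x i)\<^sup>2)) = A / 2 * (\<Sum>i=1..n. (x i)\<^sup>2)"
      proof -
        have "2 * (e / (4 * a * p)) * M / N * (l * X) = e * M * l / (N * (a * p)) / 2 * X"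
          for e a p M N l X :: real by (simp add: mult_ac)
        thus ?thesis unfolding A_def c_def lam_def by this
      qed
      also have "2 * c * real m / real n * (real n / real m * (\<Sum>t<m. \<Sum>y\<in>S t. \<Sum>z\<in>S t. (x y - x z)\<^sup>2) / 2) =
          (\<Sum>t<m. c * (\<Sum>y\<in>S t. \<Sum>z\<in>S t. (x y - x z)\<^sup>2))"
        unfolding sum_distrib_left[of c, symmetric] using \<open>n \<ge> 2\<close> \<open>m > 0\<close> by simp
      also have "\<dots> \<le> (\<Sum>t<m. measure_pmf.expectation (obs_pmf \<theta>s (S t))
          (\<lambda>(y, z). dsig (\<theta>s y - \<theta>s z) * (x y - x z)\<^sup>2))"
      proof (rule sum_mono)
        fix t assume "t \<in> {..<m}"
        hence t: "t < m" by simp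
        have ck: "c = exp (- (2 * b)) / (4 * real (card (S t)) * (real (card (S t)) - 1))"
          using S[OF t] by (simp add: c_def)
        show "c * (\<Sum>y\<in>S t. \<Sum>z\<in>S t. (x y - x z)\<^sup>2) \<le> measure_pmf.expectation (obs_pmf \<theta>s (S t))
            (\<lambda>(y, z). dsig (\<theta>s y - \<theta>s z) * (x y - x z)\<^sup>2)"
          unfolding ck
          by (rule expected_hessian_lower_bound[OF finS[OF t]]) (use S'[OF t] bound in blast)+
      qed
      finally show "A / 2 * (\<Sum>i=1..n. (x i)\<^sup>2) \<le> (\<Sum>t<m. measure_pmf.expectation (obs_pmf \<theta>s (S t))
          (\<lambda>(y, z). dsig (\<theta>s y - \<theta>s z) * (x y - x z)\<^sup>2))" .
    qed (use S' \<open>n \<ge> 2\<close> Apos in auto)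
    also have "\<dots> \<le> real n * exp (- (2 * L))"
    proof -
      have "64 / 9 \<le> exp (2 * b) / b\<^sup>2"
        using exp_double_ge_square[OF \<open>b > 0\<close>] \<open>b > 0\<close> by (simp add: pos_le_divide_eq)
      hence "4 * L * (64 / 9) \<le> 4 * L * (exp (2 * b) / b\<^sup>2)" using L by (intro mult_left_mono) auto
      hence "4 * L * (64 / 9) \<le> A" using A' by simp
      thus ?thesis by (intro mult_left_mono) auto
    qed
    also have "\<dots> \<le> real n * (1 / (real n)\<^sup>2)" using tail by (intro mult_left_mono) auto
    also have "\<dots> = 1 / real n" by (simp add: power2_eq_square)
    finally show ?thesis .
  qed
  have P2: "measure_pmf.prob ?P B2 \<le> 2 / real n"
  proof -
    have "measure_pmf.prob ?P B2 \<le> 2 * real n * exp (- K / (4 * \<kappa>))"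
      unfolding B2_def
      by (rule score_deviation_probability[OF _ S' h \<kappa> K _ \<open>K \<le> \<epsilon>\<^sup>2 * h\<close> quad]) (use \<open>n \<ge> 2\<close> \<epsilon> in auto)
    also have "- K / (4 * \<kappa>) = - (2 * L)" using \<beta> by (simp add: K_def \<kappa>_def)
    also have "2 * real n * exp (- (2 * L)) \<le> 2 * real n * (1 / (real n)\<^sup>2)"
      using tail by (intro mult_left_mono) auto
    also have "\<dots> = 2 / real n" by (simp add: power2_eq_square)
    finally show ?thesis .
  qed
  have good: "\<omega> \<in> ?G" if \<omega>: "\<omega> \<in> set_pmf ?P" and nb: "\<omega> \<notin> B1 \<union> B2" for \<omega>
  proof (intro CollectI ballI impI)
    fix \<theta>h assume \<theta>h: "\<theta>h \<in> Theta n b" and max: "\<forall>\<theta>\<in>Theta n b. loglik1 m \<omega> \<theta> \<le> loglik1 m \<omega> \<theta>h"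
    define x where "x i = \<theta>h i - \<theta>s i" for i
    have x0: "(\<Sum>i=1..n. x i) = 0" using \<theta>s \<theta>h by (simp add: x_def Theta_def sum_subtractf)
    define H where "H = hess_form m \<theta>s \<omega> x"
    have w: "fst (\<omega> t) \<in> {1..n} \<and> snd (\<omega> t) \<in> {1..n}" if "t < m" for t
    proof -
      have "\<omega> t \<in> set_pmf (obs_pmf \<theta>s (S t))"
        using \<omega> that unfolding sample_pmf_def by (subst (asm) set_Pi_pmf) (auto simp: PiE_dflt_def)
      hence "\<omega> t \<in> {(y, z). y \<in> S t \<and> z \<in> S t \<and> y \<noteq> z}"
        by (rule subsetD[OF set_pmf_obs_pmf[OF finS[OF that]], rotated]) (use S'[OF that] in simp)
      thus ?thesis using S[OF that] by auto
    qed
    have diff: "\<bar>\<theta> (fst (\<omega> t)) - \<theta> (snd (\<omega> t))\<bar> \<le> 2 * b" if "t < m" "\<theta> \<in> Theta n b" for t \<theta>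
    proof -
      have "\<bar>\<theta> (fst (\<omega> t))\<bar> \<le> b" "\<bar>\<theta> (snd (\<omega> t))\<bar> \<le> b"
        using w[OF that(1)] that(2) by (simp_all add: Theta_def)
      thus ?thesis by linarith
    qed
    have low: "h * (\<Sum>i=1..n. (x i)\<^sup>2) \<le> H" using nb x0 unfolding B1_def H_def by force
    have up: "(score m \<theta>s \<omega> x)\<^sup>2 \<le> n * K * H"
      using nb x0 unfolding B1_def B2_def H_def by (auto simp: not_less)
    have H0: "H \<ge> 0"
      unfolding H_def hess_form_def using dsig_pos by (intro sum_nonneg mult_nonneg_nonneg) (auto simp: less_imp_le)
    have "\<psi> * H \<le> (\<Sum>t<m. (sig (\<theta>h (fst (\<omega> t)) - \<theta>h (snd (\<omega> t))) - sig (\<theta>s (fst (\<omega> t)) - \<theta>s (snd (\<omega> t)))) *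
        (\<theta>h (fst (\<omega> t)) - \<theta>h (snd (\<omega> t)) - (\<theta>s (fst (\<omega> t)) - \<theta>s (snd (\<omega> t)))))"
      unfolding H_def hess_form_def sum_distrib_left
    proof (rule sum_mono)
      fix t assume "t \<in> {..<m}"
      hence t: "t < m" by simp
      show "\<psi> * (dsig (\<theta>s (fst (\<omega> t)) - \<theta>s (snd (\<omega> t))) * (x (fst (\<omega> t)) - x (snd (\<omega> t)))\<^sup>2) \<le>
        (sig (\<theta>h (fst (\<omega> t)) - \<theta>h (snd (\<omega> t))) - sig (\<theta>s (fst (\<omega> t)) - \<theta>s (snd (\<omega> t)))) *
        (\<theta>h (fst (\<omega> t)) - \<theta>h (snd (\<omega> t)) - (\<theta>s (fst (\<omega> t)) - \<theta>s (snd (\<omega> t))))"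
        using sig_secant[OF \<open>b > 0\<close> diff[OF t \<theta>s] diff[OF t \<theta>h]]
        by (simp add: x_def \<psi>_def \<epsilon>_def algebra_simps)
    qed
    also have "\<dots> \<le> score m \<theta>s \<omega> x"
      using loglik1_maximizer_gradient[OF \<theta>h \<theta>s max] by (simp add: score_def x_def algebra_simps)
    finally have "(\<psi> * H)\<^sup>2 \<le> (score m \<theta>s \<omega> x)\<^sup>2" using \<psi> H0 by (intro power_mono) auto
    hence "\<psi>\<^sup>2 * H * H \<le> n * K * H" using up by (simp add: power_mult_distrib power2_eq_square mult_ac)
    hence "\<psi>\<^sup>2 * H \<le> n * K"
    proof (cases "H = 0")
      case True
      thus ?thesis using K by simp
    next
      case False
      thus ?thesis using \<open>\<psi>\<^sup>2 * H * H \<le> n * K * H\<close> H0 by simp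
    qed
    moreover have "\<psi>\<^sup>2 * (h * (\<Sum>i=1..n. (x i)\<^sup>2)) \<le> \<psi>\<^sup>2 * H" using low by (intro mult_left_mono) auto
    ultimately have "\<psi>\<^sup>2 * h * (\<Sum>i=1..n. (x i)\<^sup>2) \<le> n * K" by (simp add: mult.assoc)
    hence "(\<Sum>i=1..n. (x i)\<^sup>2) / n \<le> K / (\<psi>\<^sup>2 * h)"
      using \<psi> h \<open>n \<ge> 2\<close> by (simp add: field_simps)
    also have "\<dots> = 16 * exp (2 * b) * L / A"
      using \<psi> Apos by (simp add: K_def \<beta>_def h_def)
    finally show "MSE n \<theta>h \<theta>s \<le> 16 * exp (2 * b) * (ln n + 1) / A"
      by (simp add: MSE_def x_def L_def)
  qed
  have "1 - 3 / real n \<le> 1 - (measure_pmf.prob ?P B1 + measure_pmf.prob ?P B2)"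
    using P1 P2 by (simp add: field_simps)
  also have "\<dots> \<le> 1 - measure_pmf.prob ?P (B1 \<union> B2)"
    using measure_Un_le[of B1 ?P B2] by simp
  also have "\<dots> = measure_pmf.prob ?P (- (B1 \<union> B2))"
    using measure_pmf.prob_compl[of "B1 \<union> B2" ?P] by (simp add: Compl_eq_Diff_UNIV)
  also have "\<dots> \<le> measure_pmf.prob ?P ?G"
    using good by (intro measure_pmf.finite_measure_mono_AE AE_pmfI) auto
  finally show ?thesis .
qed

theorem theorem6:
  fixes n m k :: nat and b :: real
    and S :: "nat \<Rightarrow> nat set" and \<theta>s :: "nat \<Rightarrow> real"
  assumes "\<theta>s \<in> Theta n b"
    and "0 < m"
    and "k \<ge> 2"
    and "\<forall>t<m. S t \<subseteq> {1..n} \<and> card (S t) = k"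
    and "lambda2 (laplacian (Mmat n m S))
           \<ge> 8 * k * (k - 1) * exp (2 * b) * n * ln n / m"
  shows "measure_pmf.prob (sample_pmf m S \<theta>s)
           {\<omega>. \<forall>\<theta>h \<in> Theta n b.
                 (\<forall>\<theta> \<in> Theta n b. loglik1 m \<omega> \<theta> \<le> loglik1 m \<omega> \<theta>h) \<longrightarrow>
                 MSE n \<theta>h \<theta>s \<le> (4 * k * (k - 1) * exp (2 * b))^2
                    * (n * (ln n + 2) / (lambda2 (laplacian (Mmat n m S)))^2) * (1 / m)}
         \<ge> 1 - 3 / n"
proof -
  have S: "S t \<subseteq> {1..n} \<and> card (S t) = k" if "t < m" for t using assms(4) that by blast
  have "card (S 0) \<le> card {1..n}" using S[OF assms(2)] by (intro card_mono) auto
  hence "n \<ge> 2" using S[OF assms(2)] assms(3) by simp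
  define lam where "lam = lambda2 (laplacian (Mmat n m S))"
  define kk where "kk = real k * (real k - 1)"
  have kk: "kk > 0" using assms(3) by (simp add: kk_def)
  define R where "R = (4 * k * (k - 1) * exp (2 * b))^2 * (n * (ln n + 2) / lam^2) * (1 / m)"
  have R: "R = (4 * kk * exp (2 * b))\<^sup>2 * (n * (ln n + 2) / lam\<^sup>2) * (1 / m)"
    using assms(3) by (simp add: R_def kk_def of_nat_diff mult.assoc)
  let ?G = "\<lambda>R. {\<omega>. \<forall>\<theta>h \<in> Theta n b. (\<forall>\<theta> \<in> Theta n b. loglik1 m \<omega> \<theta> \<le> loglik1 m \<omega> \<theta>h) \<longrightarrow>
            MSE n \<theta>h \<theta>s \<le> R}"
  have "measure_pmf.prob (sample_pmf m S \<theta>s) (?G R) \<ge> 1 - 3 / n"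
  proof (cases "n \<ge> 4")
    \<comment> \<open>For fewer than four items the claimed probability is not positive.\<close>
    case False
    hence "1 - 3 / real n \<le> 0" using \<open>n \<ge> 2\<close> by (simp add: field_simps)
    thus ?thesis using measure_nonneg order_trans by blast
  next
    case True
    have ln_pos: "ln (real n) > 0" using True by simp
    have "lam > 0"
    proof -
      have "0 < 8 * k * (k - 1) * exp (2 * b) * n * ln n / m"
        using ln_pos assms(2,3) True by simp
      thus ?thesis using assms(5) unfolding lam_def by linarith
    qed
    define A where "A = exp (- (2 * b)) * real m * lam / (real n * kk)"
    have Apos: "A > 0" using \<open>lam > 0\<close> kk assms(2) True by (simp add: A_def)
    define r where "r = 16 * exp (2 * b) * (ln n + 1) / A"
    have "r \<le> R"
    proof -
      \<comment> \<open>Splitting off \<open>ln 2\<close> gives \<open>ln n \<le> n / 2\<close>,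
        which is at most \<open>n - 2\<close> for \<open>n \<ge> 4\<close>. The inequality is what
        absorbs the factor \<open>n / (n - 1)\<close> of the trace bound into the passage from
        \<open>ln n + 1\<close> to \<open>ln n + 2\<close>.\<close>
      have "ln (real n) + 2 \<le> real n"
      proof -
        have "ln (real n) = ln (real n / 2) + ln 2" using True by (simp add: ln_div)
        thus ?thesis using ln_le_minus_one[of "real n / 2"] ln_le_minus_one[of 2] True by simp
      qed
      hence "(ln n + 1) * real n \<le> (ln n + 2) * (real n - 1)" by (simp add: algebra_simps)
      hence "(ln n + 1) * real n * kk \<le> (ln n + 2) * (real n - 1) * kk"
        using kk by (intro mult_right_mono) auto
      moreover have "(ln n + 1) * (lam * (real n - 1)) \<le> (ln n + 1) * (real n * kk)"
        using comparison_laplacian_gap_le[OF \<open>n \<ge> 2\<close> assms(2) S] \<open>lam > 0\<close> ln_pos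
        by (intro mult_left_mono) (auto simp: lam_def kk_def)
      ultimately have "((ln n + 1) * lam) * (real n - 1) \<le> ((ln n + 2) * kk) * (real n - 1)"
        by (simp add: mult_ac)
      hence *: "(ln n + 1) * lam \<le> (ln n + 2) * kk" using True by simp
      define c where "c = 16 * exp (2 * b) * exp (2 * b) * real n * kk / (real m * lam\<^sup>2)"
      have "r = c * ((ln n + 1) * lam)"
        using \<open>lam > 0\<close> kk assms(2) True
        by (simp add: r_def A_def c_def exp_minus power2_eq_square divide_simps)
      also have "\<dots> \<le> c * ((ln n + 2) * kk)"
        using * kk by (intro mult_left_mono) (auto simp: c_def)
      also have "\<dots> = R"
        by (simp add: R c_def power2_eq_square mult_ac)
      finally show ?thesis .
    qed
    show ?thesis
    proof (cases "b > 0 \<and> A > 4 * (ln n + 1) * exp (2 * b) / b\<^sup>2")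
      case True
      have "1 - 3 / real n \<le> measure_pmf.prob (sample_pmf m S \<theta>s) (?G r)"
        unfolding r_def A_def lam_def kk_def
        by (rule pseudo_mle_error_bound[OF assms(1) \<open>n \<ge> 2\<close> assms(2,3) S])
          (use True \<open>lam > 0\<close> in \<open>auto simp: A_def lam_def kk_def\<close>)
      also have "\<dots> \<le> measure_pmf.prob (sample_pmf m S \<theta>s) (?G R)"
        using \<open>r \<le> R\<close> by (intro measure_pmf.finite_measure_mono) force+
      finally show ?thesis .
    next
      case False
      have "b \<ge> 0" using assms(1) \<open>n \<ge> 2\<close> unfolding Theta_def by force
      \<comment> \<open>Here the concentration regime fails, or \<open>b = 0\<close>, and the bound
        is at least the largest possible mean squared error in the box. It then holds for every
        outcome.\<close>
      have "4 * b\<^sup>2 \<le> r"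
      proof (cases "b = 0")
        case True
        thus ?thesis using Apos ln_pos by (simp add: r_def)
      next
        case b: False
        hence "b > 0" using \<open>b \<ge> 0\<close> by simp
        hence "A \<le> 4 * (ln n + 1) * exp (2 * b) / b\<^sup>2" using False by simp
        hence "A * b\<^sup>2 \<le> 4 * (ln n + 1) * exp (2 * b)" using \<open>b > 0\<close> by (simp add: pos_le_divide_eq)
        thus ?thesis using Apos by (simp add: r_def pos_le_divide_eq algebra_simps)
      qed
      have "MSE n \<theta>h \<theta>s \<le> R" if "\<theta>h \<in> Theta n b" for \<theta>h
      proof -
        have "(\<Sum>i=1..n. (\<theta>h i - \<theta>s i)\<^sup>2) \<le> (\<Sum>i=1..n. (2 * b)\<^sup>2)"
        proof (rule sum_mono)
          fix i assume "i \<in> {1..n}"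
          hence "\<bar>\<theta>h i\<bar> \<le> b" "\<bar>\<theta>s i\<bar> \<le> b" using that assms(1) by (simp_all add: Theta_def)
          hence "\<bar>\<theta>h i - \<theta>s i\<bar> \<le> \<bar>2 * b\<bar>" by linarith
          thus "(\<theta>h i - \<theta>s i)\<^sup>2 \<le> (2 * b)\<^sup>2" by (simp only: abs_le_square_iff)
        qed
        also have "\<dots> = real n * (4 * b\<^sup>2)" by (simp add: power_mult_distrib)
        finally have "MSE n \<theta>h \<theta>s \<le> 4 * b\<^sup>2" using \<open>n \<ge> 2\<close> by (simp add: MSE_def field_simps)
        thus ?thesis using \<open>4 * b\<^sup>2 \<le> r\<close> \<open>r \<le> R\<close> by linarith
      qed
      hence "?G R = UNIV" by auto
      thus ?thesis by simp
    qed
  qed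
  thus ?thesis unfolding R_def lam_def .
qed

end
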